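(* Let $d\ge1$ and let $1<\beta_1\le\cdots\le\beta_d$ be real numbers (not necessarily integers). Let $\psi:\mathbb N\to\mathbb R^+$ be a positive function and let $\bm h=(h_1,\dots,h_d)$ be a $d$-tuple of Lipschitz functions $h_i:[0,1)\to[0,1]$. Let $$W_d^\times(\psi,\bm h)=\Big\{(x_1,\dots,x_d)\in[0,1)^d:\ \prod_{i=1}^d|T_{\beta_i}^nx_i-h_i(x_i)|<\psi(n)\ \text{for infinitely many }n\in\mathbb N\Big\},$$ and when $d=1$ write $\beta=\beta_1$, $h=h_1$ and $W_1(\psi,h)=W_1^\times(\psi,\bm h)$. (1) Assume that $d=1$ and that $g$ is a dimension function such that $g\preceq1$. Then $$\mathcal H^g\big(W_1(\psi,h)\big)=\begin{cases}0&\text{if }\sum_{n=1}^\infty\beta^ng\big(\beta^{-n}\psi(n)\big)<\infty,\\ \mathcal H^g([0,1])&\text{if }\sum_{n=1}^\infty\beta^ng\big(\beta^{-n}\psi(n)\big)=\infty.\end{cases}$$ (2) Assume that $d\ge2$ and that $f$ is a dimension function such that $(d-1)\prec f\preceq s$ for some $s\in(d-1,d)$. Then $$\mathcal H^f\big(W_d^\times(\psi,\bm h)\big)=\begin{cases}0&\text{if }\sum_{n=1}^\infty\beta_d^{dn}\psi(n)^{-d+1}f\big(\beta_d^{-n}\psi(n)\big)<\infty,\\ \mathcal H^f([0,1]^d)&\text{if }\sum_{n=1}^\infty\beta_d^{dn}\psi(n)^{-d+1}f\big(\beta_d^{-n}\psi(n)\big)=\infty.\end{cases}$$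
   Context: For $\beta>1$, $T_\beta:[0,1)\to[0,1)$ is the map $T_\beta x=\beta x\ (\mathrm{mod}\ 1)$, and $T_\beta^n$ is its $n$-th iterate. A dimension function is a continuous nondecreasing function $f$ on $\mathbb R_{\ge0}$ with $f(0)=0$ (positive on $(0,\infty)$). For dimension functions $f,g$, write $f\preceq g$ if $\frac{f(y)}{g(y)}\le\frac{f(x)}{g(x)}$ for all $0<x<y$; then $\lim_{r\to0^+}f(r)/g(r)\in(0,\infty]$ exists, and if moreover this limit is $\infty$ we write $f\prec g$. For a real number $s>0$, in such relations $s$ stands for the function $r\mapsto r^s$ (e.g. $f\preceq s$ means $f\preceq g$ with $g(r)=r^s$, and $s\prec f$ means $g\prec f$). $\mathbb R^d$ carries the maximum norm. The Hausdorff $f$-measure of $A\subset\mathbb R^d$ is $\mathcal H^f(A)=\lim_{\eta\to0}\inf\{\sum_i f(|B_i|): A\subset\bigcup_i B_i,\ B_i\text{ balls with }|B_i|\le\eta\}$, where $|B|$ denotes diameter. *)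

theory Defs
  imports "HOL-Analysis.Analysis"
begin

definition beta_map :: "real \<Rightarrow> real \<Rightarrow> real" where
  "beta_map \<beta> x = frac (\<beta> * x)"

definition dimension_function :: "(real \<Rightarrow> real) \<Rightarrow> bool" where
  "dimension_function f \<longleftrightarrow>
     continuous_on {0..} f \<and> mono_on {0..} f \<and> f 0 = 0 \<and> (\<forall>r>0. f r > 0)"

definition gauge_preceq :: "(real \<Rightarrow> real) \<Rightarrow> (real \<Rightarrow> real) \<Rightarrow> bool" where
  "gauge_preceq f g \<longleftrightarrow> (\<forall>x y. 0 < x \<and> x < y \<longrightarrow> f y / g y \<le> f x / g x)"

definition gauge_prec :: "(real \<Rightarrow> real) \<Rightarrow> (real \<Rightarrow> real) \<Rightarrow> bool" where
  "gauge_prec f g \<longleftrightarrow> gauge_preceq f g \<and> filterlim (\<lambda>r. f r / g r) at_top (at_right 0)"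

text \<open>The metric structure on \<open>real ^ 'n\<close> in the library is Euclidean, so balls and
  diameters for the maximum norm are defined here from \<^const>\<open>infnorm\<close>.\<close>

definition max_ball :: "real ^ 'n::finite \<Rightarrow> real \<Rightarrow> (real ^ 'n) set" where
  "max_ball c r = {x. infnorm (x - c) < r}"

definition max_diameter :: "(real ^ 'n::finite) set \<Rightarrow> real" where
  "max_diameter S = (if S = {} then 0 else SUP (x, y)\<in>S \<times> S. infnorm (x - y))"

definition ball_covers :: "real \<Rightarrow> (real ^ 'n::finite) set \<Rightarrow> (nat \<Rightarrow> (real ^ 'n) set) set" where
  "ball_covers \<eta> A =
     {B. (\<forall>i. (\<exists>c r. 0 < r \<and> B i = max_ball c r) \<and> max_diameter (B i) \<le> \<eta>) \<and>
         A \<subseteq> (\<Union>i. B i)}"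

text \<open>Finite covers need no separate treatment: they can be padded by balls of arbitrarily
  small total cost, since a dimension function tends to \<open>0\<close> at \<open>0\<close>.\<close>

definition hausdorff_pre :: "(real \<Rightarrow> real) \<Rightarrow> real \<Rightarrow> (real ^ 'n::finite) set \<Rightarrow> ennreal" where
  "hausdorff_pre f \<eta> A = (INF B\<in>ball_covers \<eta> A. \<Sum>i. ennreal (f (max_diameter (B i))))"

definition hausdorff_measure :: "(real \<Rightarrow> real) \<Rightarrow> (real ^ 'n::finite) set \<Rightarrow> ennreal" where
  "hausdorff_measure f A = Lim (at_right 0) (\<lambda>\<eta>. hausdorff_pre f \<eta> A)"

text \<open>The limit always exists, so the use of \<^const>\<open>Lim\<close> is unproblematic.\<close>

lemma tendsto_hausdorff_measure:
  "((\<lambda>\<eta>. hausdorff_pre f \<eta> A) \<longlongrightarrow> hausdorff_measure f A) (at_right 0)"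
proof -
  have anti: "hausdorff_pre f \<eta>' A \<le> hausdorff_pre f \<eta> A" if "\<eta> \<le> \<eta>'" for \<eta> \<eta>'
    unfolding hausdorff_pre_def
    by (rule INF_superset_mono) (use that in \<open>auto simp: ball_covers_def intro: order_trans\<close>)
  define l where "l = (SUP \<eta>\<in>{0<..}. hausdorff_pre f \<eta> A)"
  have "((\<lambda>\<eta>. hausdorff_pre f \<eta> A) \<longlongrightarrow> l) (at_right 0)"
  proof (rule order_tendstoI)
    fix a assume "a < l"
    then obtain e where e: "e > 0" "a < hausdorff_pre f e A"
      unfolding l_def less_SUP_iff by auto
    then have "a < hausdorff_pre f \<eta> A" if "\<eta> < e" for \<eta>
      using anti[of \<eta> e] that by (meson less_imp_le less_le_trans)
    with e(1) show "eventually (\<lambda>\<eta>. a < hausdorff_pre f \<eta> A) (at_right 0)"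
      unfolding eventually_at_right_field by blast
  next
    fix a assume "l < a"
    moreover have "hausdorff_pre f \<eta> A \<le> l" if "0 < \<eta>" for \<eta>
      unfolding l_def using that by (intro SUP_upper) auto
    ultimately show "eventually (\<lambda>\<eta>. hausdorff_pre f \<eta> A < a) (at_right 0)"
      unfolding eventually_at_right_field
      by (intro exI[of _ 1]) (auto intro: le_less_trans)
  qed
  then show ?thesis
    unfolding hausdorff_measure_def using tendsto_Lim trivial_limit_at_right_real by metis
qed

definition W_mult ::
  "('n::finite \<Rightarrow> real) \<Rightarrow> (nat \<Rightarrow> real) \<Rightarrow> ('n \<Rightarrow> real \<Rightarrow> real) \<Rightarrow> (real ^ 'n) set" where
  "W_mult \<beta> \<psi> h =
     {x. (\<forall>i. x $ i \<in> {0..<1}) \<and>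
         infinite {n. n \<ge> 1 \<and>
           (\<Prod>i\<in>UNIV. \<bar>(beta_map (\<beta> i) ^^ n) (x $ i) - h i (x $ i)\<bar>) < \<psi> n}}"

end

theory Submission
  imports Defs
begin

text \<open>Convergence: after the rescaling by \<open>\<beta>\<^sub>i\<^sup>n\<close>, the set of points with
  product of distances below \<open>\<psi>(n)\<close> is a union of hyperbolic regions. Each is cut into dyadic
  boxes, and each box is covered by cubes whose side is the shortest side of the box. As \<open>f(r) / r\<^sup>s\<close>
  decreases for some \<open>s < d\<close>, the costs form a geometric series dominated by the boxes of side
  \<open>\<beta>\<^sub>d\<^sup>-\<^sup>n \<psi>(n)\<close>.

  Divergence: only the coordinate with the largest base is used. Integrating over the other
  coordinates turns a cover of the product set with respect to \<open>f\<close> into a cover of the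
  one-dimensional target set on a line with respect to \<open>g(r) = f(r) / r\<^sup>d\<^sup>-\<^sup>1\<close>, so everything
  reduces to the following fact on the line: a family of intervals with \<open>\<Sum> g(\<delta>\<^sub>i) < \<infinity>\<close>
  and \<open>\<Sum> \<delta>\<^sub>i\<close> small compared with the length of an interval \<open>I\<close> cannot cover the target set
  in \<open>I\<close>. A point that is missed is found by nested intervals. In each step, every chosen piece
  \<open>A\<^sub>j\<close> of a target is weighted by \<open>g(r\<^sub>j)\<close>, where \<open>r\<^sub>j\<close> is its size up to a
  constant, and the weights sum to a fixed proportion of \<open>|I|\<close> because the series diverges; by
  averaging, some \<open>A\<^sub>j\<close> is met only by intervals of total length small compared with
  \<open>|A\<^sub>j|\<close>. If \<open>g(r) / r\<close> is unbounded at \<open>0\<close>, the fact gives infinite measure; otherwise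
  it gives positive density in every interval, hence a Lebesgue null complement.\<close>

section \<open>Hausdorff measure with respect to the maximum norm\<close>

text \<open>For a non-integer base the n-th iterate may map a cylinder onto a proper subinterval of
  [0,1), and such a cylinder may miss its target. The lower bounds therefore use full cylinders
  only: these are nested or disjoint, and every interval contains of the order of b^n of them per
  unit length, with a constant independent of the interval. The upper bounds use all cylinders, each
  being a full one followed by a rightmost one.

  The obstacle to averaging is that a piece A_j can be much shorter than its weight, so that a ball
  could meet many pieces cheaply. Each piece is therefore given a halo of length g(r_j) inside its
  cylinder, and the halos are kept disjoint; weights truncated at the length \<delta> of a ball then
  sum to at most 3 \<delta> over the halos it meets. Monotonicity of g(r) / r turns the cost of a
  ball shorter than a piece into its share of the weight.

  With r = \<psi>(n) / \<beta>_d^n and g(r) = f(r) / r^(d-1), the terms of the series are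
  \<beta>_d^n g(r), the form for divergence, and also \<psi>(n) f(r) / r^d, a volume count suited to
  convergence.\<close>

lemma infnorm_less_iff:
  fixes x :: "real ^ 'n"
  shows "infnorm x < r \<longleftrightarrow> (\<forall>i. \<bar>x $ i\<bar> < r)"
proof -
  have e: "infnorm x = Max (range (\<lambda>i. \<bar>x $ i\<bar>))"
    unfolding infnorm_cart by (subst cSup_eq_Max) (auto simp: full_SetCompr_eq)
  show ?thesis unfolding e by (subst Max_less_iff) auto
qed

lemma mem_max_ball_iff:
  fixes x :: "real ^ 'n"
  shows "x \<in> max_ball c r \<longleftrightarrow> (\<forall>i. \<bar>x $ i - c $ i\<bar> < r)"
  by (simp add: max_ball_def infnorm_less_iff)

lemma max_diameter_max_ball:
  fixes c :: "real ^ 'n"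
  assumes "0 < r"
  shows "max_diameter (max_ball c r) = 2 * r"
proof -
  let ?B = "max_ball c r"
  have c: "c \<in> ?B" using assms by (simp add: mem_max_ball_iff)
  have ub: "infnorm (x - y) < 2 * r" if "x \<in> ?B" "y \<in> ?B" for x y
    unfolding infnorm_less_iff
  proof
    fix i
    have "\<bar>x $ i - c $ i\<bar> < r" "\<bar>y $ i - c $ i\<bar> < r" using that by (auto simp: mem_max_ball_iff)
    then show "\<bar>(x - y) $ i\<bar> < 2 * r" by simp
  qed
  have "(SUP (x, y)\<in>?B \<times> ?B. infnorm (x - y)) = 2 * r"
  proof (rule cSup_eq_non_empty)
    show "(\<lambda>(x, y). infnorm (x - y)) ` (?B \<times> ?B) \<noteq> {}" using c by auto
    show "u \<le> 2 * r" if "u \<in> (\<lambda>(x, y). infnorm (x - y)) ` (?B \<times> ?B)" for u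
      using that ub by (auto intro: less_imp_le)
    fix y assume y: "\<And>u. u \<in> (\<lambda>(x, y). infnorm (x - y)) ` (?B \<times> ?B) \<Longrightarrow> u \<le> y"
    show "2 * r \<le> y"
    proof (rule dense_le)
      fix w assume w: "w < 2 * r"
      \<comment> \<open>The ball is open, so its diameter is only approached, by the two diagonal
        points at distance \<open>t\<close> from \<open>c\<close>. The maximum with 0 covers
        negative \<open>w\<close>.\<close>
      define t where "t = max 0 (w / 2)"
      have t: "0 \<le> t" "t < r" "w \<le> 2 * t" using w assms by (auto simp: t_def)
      have m: "c + (\<chi> i. t) \<in> ?B" "c - (\<chi> i. t) \<in> ?B"
        using t by (auto simp: mem_max_ball_iff)
      have "\<not> infnorm ((c + (\<chi> i. t)) - (c - (\<chi> i. t))) < 2 * t"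
        unfolding infnorm_less_iff using t(1) by auto
      moreover have "infnorm ((c + (\<chi> i. t)) - (c - (\<chi> i. t))) \<le> y"
        using m by (intro y) (auto intro!: image_eqI[of _ _ "(c + (\<chi> i. t), c - (\<chi> i. t))"])
      ultimately show "w \<le> y" using t(3) by linarith
    qed
  qed
  then show ?thesis unfolding max_diameter_def using c by auto
qed

text \<open>Covers are infinite sequences of balls of positive radius, so a shorter cover has to be
  padded; continuity of \<open>f\<close> at 0 supplies balls of arbitrarily small total
  cost.\<close>

lemma dimension_function_small:
  assumes "dimension_function f" "e > 0" "\<eta> > 0"
  obtains r where "0 < r" "2 * r \<le> \<eta>" "f (2 * r) < e"
proof -
  have c: "continuous_on {0..} f" and f0: "f 0 = 0"
    using assms(1) by (auto simp: dimension_function_def)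
  obtain d where d: "d > 0" "\<And>x. x \<in> {0..} \<Longrightarrow> dist x 0 < d \<Longrightarrow> dist (f x) (f 0) < e"
    using c assms(2) unfolding continuous_on_iff by (metis atLeast_iff order_refl)
  show ?thesis
    by (rule that[of "min \<eta> (d / 2) / 2"]) (use d assms f0 in \<open>auto simp: dist_real_def abs_less_iff dest!: spec d(2)[of "min \<eta> (d / 2)"]\<close>)
qed

lemma mem_ball_coversI:
  assumes "\<And>i. 0 < r i" "\<And>i. 2 * r i \<le> \<eta>" "A \<subseteq> (\<Union>i. max_ball (c i) (r i))"
  shows "(\<lambda>i. max_ball (c i) (r i)) \<in> ball_covers \<eta> A"
  using assms by (auto simp: ball_covers_def max_diameter_max_ball)

lemma ball_coversE:
  assumes "B \<in> ball_covers \<eta> A"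
  obtains c r where "\<And>i. 0 < r i" "\<And>i. 2 * r i \<le> \<eta>" "\<And>i. B i = max_ball (c i) (r i)"
    "A \<subseteq> (\<Union>i. max_ball (c i) (r i))" "\<And>i. max_diameter (B i) = 2 * r i"
proof -
  have "\<forall>i. \<exists>c r. 0 < r \<and> B i = max_ball c r" using assms by (auto simp: ball_covers_def)
  then obtain c r where cr: "\<And>i. 0 < r i \<and> B i = max_ball (c i) (r i)" by metis
  have d: "max_diameter (B i) = 2 * r i" for i using cr[of i] max_diameter_max_ball by metis
  show ?thesis
    by (rule that[of r c]) (use cr d assms in \<open>auto simp: ball_covers_def\<close>)
qed

lemma hausdorff_pre_mono:
  assumes "A \<subseteq> A'" shows "hausdorff_pre f \<eta> A \<le> hausdorff_pre f \<eta> A'"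
  unfolding hausdorff_pre_def
  by (rule INF_superset_mono) (use assms in \<open>auto simp: ball_covers_def\<close>)

lemma suminf_half_powers_ennreal: "0 \<le> e \<Longrightarrow> (\<Sum>n. ennreal (e * (1 / 2) ^ Suc n)) = ennreal e"
  by (rule suminf_ennreal_eq) (use sums_mult[OF power_half_series, of e] in auto)

lemma hausdorff_pre_Union_le:
  "hausdorff_pre f \<eta> (\<Union>n. A n) \<le> (\<Sum>n. hausdorff_pre f \<eta> (A n :: (real ^ 'n) set))"
proof (rule ennreal_le_epsilon)
  fix e :: real
  assume fin: "(\<Sum>n. hausdorff_pre f \<eta> (A n)) < top" and e: "0 < e"
  have finn: "hausdorff_pre f \<eta> (A n) < top" for n
    by (rule ennreal_suminf_lessD[OF fin])
  have "\<exists>B\<in>ball_covers \<eta> (A n). (\<Sum>i. ennreal (f (max_diameter (B i))))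
          < hausdorff_pre f \<eta> (A n) + ennreal (e * (1 / 2) ^ Suc n)" for n
  proof -
    have "hausdorff_pre f \<eta> (A n) < hausdorff_pre f \<eta> (A n) + ennreal (e * (1 / 2) ^ Suc n)"
      using finn[of n] e by (cases "hausdorff_pre f \<eta> (A n)") (auto simp flip: ennreal_plus simp: ennreal_less_iff)
    then show ?thesis by (subst (asm) (1) hausdorff_pre_def) (simp only: INF_less_iff)
  qed
  then obtain B where B: "\<And>n. B n \<in> ball_covers \<eta> (A n)"
    and less: "\<And>n. (\<Sum>i. ennreal (f (max_diameter (B n i))))
          < hausdorff_pre f \<eta> (A n) + ennreal (e * (1 / 2) ^ Suc n)" by metis
  define C where "C = (\<lambda>k. case prod_decode k of (n, i) \<Rightarrow> B n i)"
  have "C \<in> ball_covers \<eta> (\<Union>n. A n)"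
    unfolding ball_covers_def
  proof (intro CollectI conjI allI subsetI)
    fix k
    show "\<exists>c r. 0 < r \<and> C k = max_ball c r" "max_diameter (C k) \<le> \<eta>"
      using B by (auto simp: C_def ball_covers_def split: prod.split)
  next
    fix x assume "x \<in> (\<Union>n. A n)"
    then obtain n where "x \<in> A n" by blast
    moreover have "A n \<subseteq> (\<Union>i. B n i)" using B[of n] by (simp add: ball_covers_def)
    ultimately obtain i where "x \<in> B n i" by blast
    then show "x \<in> (\<Union>k. C k)" by (auto simp: C_def intro!: exI[of _ "prod_encode (n, i)"])
  qed
  then have "hausdorff_pre f \<eta> (\<Union>n. A n) \<le> (\<Sum>k. ennreal (f (max_diameter (C k))))"
    unfolding hausdorff_pre_def by (rule INF_lower)
  also have "\<dots> = (\<Sum>n. \<Sum>i. ennreal (f (max_diameter (B n i))))"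
    using suminf_ennreal_2dimen[where f = "\<lambda>(n, i). ennreal (f (max_diameter (B n i)))"
       and g = "\<lambda>n. \<Sum>i. ennreal (f (max_diameter (B n i)))"]
    by (simp add: C_def comp_def split_beta)
  also have "\<dots> \<le> (\<Sum>n. hausdorff_pre f \<eta> (A n) + ennreal (e * (1 / 2) ^ Suc n))"
    by (intro suminf_le less_imp_le less) auto
  also have "\<dots> = (\<Sum>n. hausdorff_pre f \<eta> (A n)) + ennreal e"
    by (simp only: suminf_add[OF summableI summableI, symmetric] suminf_half_powers_ennreal[OF less_imp_le[OF e]])
  finally show "hausdorff_pre f \<eta> (\<Union>n. A n) \<le> (\<Sum>n. hausdorff_pre f \<eta> (A n)) + ennreal e" .
qed

lemma hausdorff_pre_empty:
  assumes "dimension_function f" "0 < \<eta>"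
  shows "hausdorff_pre f \<eta> ({} :: (real ^ 'n) set) = 0"
proof -
  have "hausdorff_pre f \<eta> ({} :: (real ^ 'n) set) \<le> 0 + ennreal e" if e: "e > 0" for e :: real
  proof -
    have "\<exists>r. 0 < r \<and> 2 * r \<le> \<eta> \<and> f (2 * r) < e * (1 / 2) ^ Suc n" for n
      using dimension_function_small[OF assms(1) _ assms(2), of "e * (1 / 2) ^ Suc n"] e by fastforce
    then obtain r where r: "\<And>n. 0 < r n" "\<And>n. 2 * r n \<le> \<eta>" "\<And>n. f (2 * r n) < e * (1 / 2) ^ Suc n"
      by metis
    have "(\<lambda>n. max_ball (0 :: real ^ 'n) (r n)) \<in> ball_covers \<eta> {}"
      using r by (intro mem_ball_coversI) auto
    then have "hausdorff_pre f \<eta> ({} :: (real ^ 'n) set)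
        \<le> (\<Sum>n. ennreal (f (max_diameter (max_ball (0 :: real ^ 'n) (r n)))))"
      unfolding hausdorff_pre_def by (rule INF_lower)
    also have "\<dots> \<le> (\<Sum>n. ennreal (e * (1 / 2) ^ Suc n))"
      using r by (intro suminf_le ennreal_leI) (auto simp: max_diameter_max_ball less_imp_le simp del: power_Suc)
    also have "\<dots> = ennreal e" using e by (intro suminf_half_powers_ennreal) auto
    finally show ?thesis by simp
  qed
  then show ?thesis by (metis ennreal_le_epsilon le_zero_eq)
qed

lemma hausdorff_pre_ball_le:
  fixes c :: "real ^ 'n"
  assumes "dimension_function f" "0 < r" "2 * r \<le> \<eta>"
  shows "hausdorff_pre f \<eta> (max_ball c r) \<le> ennreal (f (2 * r))"
proof (rule ennreal_le_epsilon)
  fix e :: real assume e: "e > 0"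
  have \<eta>: "\<eta> > 0" using assms by linarith
  have "\<exists>r. 0 < r \<and> 2 * r \<le> \<eta> \<and> f (2 * r) < e * (1 / 2) ^ Suc n" for n
    using dimension_function_small[OF assms(1) _ \<eta>, of "e * (1 / 2) ^ Suc n"] e by fastforce
  then obtain q where q: "\<And>n. 0 < q n" "\<And>n. 2 * q n \<le> \<eta>" "\<And>n. f (2 * q n) < e * (1 / 2) ^ Suc n"
    by metis
  define r' where "r' = (\<lambda>n. if n = 0 then r else q n)"
  have "(\<lambda>n. max_ball c (r' n)) \<in> ball_covers \<eta> (max_ball c r)"
    using assms q by (intro mem_ball_coversI) (auto simp: r'_def)
  then have "hausdorff_pre f \<eta> (max_ball c r) \<le> (\<Sum>n. ennreal (f (max_diameter (max_ball c (r' n)))))"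
    unfolding hausdorff_pre_def by (rule INF_lower)
  also have "\<dots> \<le> (\<Sum>n. (if n = 0 then ennreal (f (2 * r)) else 0) + ennreal (e * (1 / 2) ^ Suc n))"
  proof (intro suminf_le)
    fix n
    show "ennreal (f (max_diameter (max_ball c (r' n))))
       \<le> (if n = 0 then ennreal (f (2 * r)) else 0) + ennreal (e * (1 / 2) ^ Suc n)"
      using assms(2) q(1,3)[of n]
      by (auto simp: r'_def max_diameter_max_ball less_imp_le intro!: ennreal_leI simp del: power_Suc)
  qed auto
  also have "\<dots> = ennreal (f (2 * r)) + ennreal e"
  proof -
    have "(\<Sum>n. if n = (0::nat) then ennreal (f (2 * r)) else 0) = ennreal (f (2 * r))"
      by (subst suminf_finite[of "{0}"]) auto
    moreover have "(\<Sum>n. ennreal (e * (1 / 2) ^ Suc n)) = ennreal e"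
      using e by (intro suminf_half_powers_ennreal) auto
    ultimately show ?thesis by (simp only: suminf_add[OF summableI summableI, symmetric])
  qed
  finally show "hausdorff_pre f \<eta> (max_ball c r) \<le> ennreal (f (2 * r)) + ennreal e" .
qed

lemma hausdorff_pre_finite_Union_le:
  fixes A :: "'a \<Rightarrow> (real ^ 'n) set"
  assumes f: "dimension_function f" and \<eta>: "0 < \<eta>" and "finite P"
  shows "hausdorff_pre f \<eta> (\<Union>p\<in>P. A p) \<le> (\<Sum>p\<in>P. hausdorff_pre f \<eta> (A p))"
proof -
  obtain p where p: "bij_betw p {..<card P} P"
    using assms(3) ex_bij_betw_nat_finite[of P] by (auto simp: atLeast0LessThan)
  define X where "X = (\<lambda>k. if k < card P then A (p k) else {})"
  have "(\<Union>p\<in>P. A p) \<subseteq> (\<Union>k. X k)"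
  proof
    fix x assume "x \<in> (\<Union>p\<in>P. A p)"
    then obtain q where "q \<in> P" "x \<in> A q" by auto
    moreover from this obtain k where "k < card P" "q = p k"
      using p by (metis bij_betw_imp_surj_on imageE lessThan_iff)
    ultimately show "x \<in> (\<Union>k. X k)" by (auto simp: X_def intro!: exI[of _ k])
  qed
  then have "hausdorff_pre f \<eta> (\<Union>p\<in>P. A p) \<le> hausdorff_pre f \<eta> (\<Union>k. X k)" by (rule hausdorff_pre_mono)
  also have "\<dots> \<le> (\<Sum>k. hausdorff_pre f \<eta> (X k))" by (rule hausdorff_pre_Union_le)
  also have "\<dots> = (\<Sum>k<card P. hausdorff_pre f \<eta> (X k))"
    by (rule suminf_finite) (use assms in \<open>auto simp: X_def hausdorff_pre_empty\<close>)
  also have "\<dots> = (\<Sum>k<card P. hausdorff_pre f \<eta> (A (p k)))" by (simp add: X_def)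
  also have "\<dots> = (\<Sum>q\<in>P. hausdorff_pre f \<eta> (A q))"
    using p by (rule sum.reindex_bij_betw)
  finally show ?thesis .
qed

lemma hausdorff_pre_finite_cover:
  fixes A :: "(real ^ 'n) set"
  assumes f: "dimension_function f" and P: "finite P" "A \<subseteq> (\<Union>p\<in>P. max_ball (c p) (r p))" and \<eta>: "0 < \<eta>"
    and r: "\<And>p. p \<in> P \<Longrightarrow> 0 < r p \<and> 2 * r p \<le> \<eta>"
  shows "hausdorff_pre f \<eta> A \<le> (\<Sum>p\<in>P. ennreal (f (2 * r p)))"
proof -
  have "hausdorff_pre f \<eta> A \<le> hausdorff_pre f \<eta> (\<Union>p\<in>P. max_ball (c p) (r p))"
    using P(2) by (rule hausdorff_pre_mono)
  also have "\<dots> \<le> (\<Sum>p\<in>P. hausdorff_pre f \<eta> (max_ball (c p) (r p)))"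
    by (rule hausdorff_pre_finite_Union_le[OF f \<eta> P(1)])
  also have "\<dots> \<le> (\<Sum>p\<in>P. ennreal (f (2 * r p)))"
    using r by (intro sum_mono hausdorff_pre_ball_le[OF f]) auto
  finally show ?thesis .
qed

lemma hausdorff_measure_le:
  assumes "\<And>\<eta>. \<eta> > 0 \<Longrightarrow> hausdorff_pre f \<eta> A \<le> hausdorff_pre f \<eta> A'"
  shows "hausdorff_measure f A \<le> hausdorff_measure f A'"
  by (rule tendsto_le[OF _ tendsto_hausdorff_measure tendsto_hausdorff_measure])
     (auto simp: trivial_limit_at_right_real eventually_at_right_field intro!: exI[of _ 1] assms)

lemma hausdorff_measure_eq_0:
  assumes "\<And>\<eta>. \<eta> > 0 \<Longrightarrow> hausdorff_pre f \<eta> A = 0"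
  shows "hausdorff_measure f A = 0"
proof -
  have "((\<lambda>\<eta>. hausdorff_pre f \<eta> A) \<longlongrightarrow> 0) (at_right 0)"
    by (rule tendsto_eventually) (auto simp: eventually_at_right_field intro!: exI[of _ 1] assms)
  then show ?thesis
    using tendsto_hausdorff_measure tendsto_unique trivial_limit_at_right_real by blast
qed

lemma hausdorff_measure_eq_top:
  assumes "\<And>M. \<exists>e>0. \<forall>\<eta>. 0 < \<eta> \<longrightarrow> \<eta> < e \<longrightarrow> hausdorff_pre f \<eta> A \<ge> of_nat M"
  shows "hausdorff_measure f A = top"
proof -
  have "of_nat M \<le> hausdorff_measure f A" for M
  proof (rule tendsto_lowerbound[OF tendsto_hausdorff_measure])
    show "\<forall>\<^sub>F \<eta> in at_right 0. of_nat M \<le> hausdorff_pre f \<eta> A"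
      unfolding eventually_at_right_field using assms[of M] by blast
  qed (simp add: trivial_limit_at_right_real)
  then show ?thesis
    by (metis ennreal_Ex_less_of_nat leD top.not_eq_extremum)
qed

section \<open>Full cylinders of the beta-transformation\<close>

text \<open>Cylinders and halos are counted through their total length. The intervals are half-open
  because neighbouring cylinders share endpoints.\<close>

lemma sum_lengths_le_of_disjoint:
  fixes p w :: "'a \<Rightarrow> real"
  assumes "finite S" "\<And>j. j \<in> S \<Longrightarrow> 0 \<le> w j" "l \<le> u"
    and sub: "\<And>j. j \<in> S \<Longrightarrow> {p j..<p j + w j} \<subseteq> {l..u}"
    and disj: "disjoint_family_on (\<lambda>j. {p j..<p j + w j}) S"
  shows "(\<Sum>j\<in>S. w j) \<le> u - l"
proof -
  have "(\<Sum>j\<in>S. w j) = (\<Sum>j\<in>S. measure lborel {p j..<p j + w j})"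
    by (rule sum.cong) (auto simp: assms)
  also have "\<dots> = measure lborel (\<Union>j\<in>S. {p j..<p j + w j})"
    by (rule measure_finite_Union[symmetric]) (use assms in auto)
  also have "\<dots> \<le> measure lborel {l..u}"
    using sub assms(1) by (intro measure_mono_fmeasurable) (auto simp: fmeasurable_def emeasure_lborel_Icc_eq)
  finally show ?thesis using assms(3) by simp
qed

lemma length_le_sum_of_cover:
  fixes p w :: "'a \<Rightarrow> real"
  assumes "finite S" "\<And>j. j \<in> S \<Longrightarrow> 0 \<le> w j" "l \<le> u"
    and sub: "{l..<u} \<subseteq> (\<Union>j\<in>S. {p j..<p j + w j})"
  shows "u - l \<le> (\<Sum>j\<in>S. w j)"
proof -
  have "u - l = measure lborel {l..<u}" using assms by simp
  also have "\<dots> \<le> measure lborel (\<Union>j\<in>S. {p j..<p j + w j})"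
    using sub assms(1) by (intro measure_mono_fmeasurable) (auto intro!: fmeasurable.finite_UN fmeasurableI[of "{_..<_}"] simp: assms)
  also have "\<dots> \<le> (\<Sum>j\<in>S. measure lborel {p j..<p j + w j})"
    using assms(1) by (intro measure_UNION_le) auto
  also have "\<dots> = (\<Sum>j\<in>S. w j)"
    by (rule sum.cong) (auto simp: assms)
  finally show ?thesis .
qed

text \<open>The cylinders of order n that the n-th iterate maps onto [0,1), recorded by the left
  endpoint \<open>a\<close>. Affinity is demanded directly instead of through digit sequences, so
  that the structure lemmas argue with the map alone.\<close>

definition full_cylinder :: "real \<Rightarrow> nat \<Rightarrow> real \<Rightarrow> bool" where
  "full_cylinder b n a \<longleftrightarrow> 0 \<le> a \<and> a + 1 / b ^ n \<le> 1 \<and>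
     (\<forall>x\<in>{a..<a + 1 / b ^ n}. (beta_map b ^^ n) x = b ^ n * (x - a))"

text \<open>The left endpoints of the rightmost cylinders of \<open>[0,1)\<close>. Taking the ceiling minus one
  instead of the floor makes the digits those of the quasi-greedy expansion of \<open>1\<close>, so that the
  rightmost cylinder is never empty.\<close>

primrec last_cylinder :: "real \<Rightarrow> nat \<Rightarrow> real" where
  "last_cylinder b 0 = 0"
| "last_cylinder b (Suc k) = last_cylinder b k
     + real_of_int (\<lceil>b ^ Suc k * (1 - last_cylinder b k)\<rceil> - 1) / b ^ Suc k"

lemma add_divide_le_iff: "0 < P \<Longrightarrow> a + s / P \<le> x \<longleftrightarrow> s \<le> P * (x - a)" for P :: real
  by (simp add: field_simps)

lemma less_add_divide_iff: "0 < P \<Longrightarrow> x < a + s / P \<longleftrightarrow> P * (x - a) < s" for P :: real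
  by (simp add: field_simps)

context
  fixes b :: real
  assumes b: "1 < b"
begin

lemma beta_iterate_bounds:
  "x \<in> {0..<1} \<Longrightarrow> (beta_map b ^^ n) x \<in> {0..<1}"
  by (cases n) (auto simp: beta_map_def frac_ge_0 frac_lt_1)

lemma beta_iterate_zero: "(beta_map b ^^ n) 0 = 0"
  by (induction n) (auto simp: beta_map_def)

lemma full_cylinder_0: "full_cylinder b 0 0"
  by (simp add: full_cylinder_def)

text \<open>The iterate of order \<open>m\<close> maps the outer cylinder affinely onto [0,1), so a
  full cylinder of order \<open>k\<close> can be pulled back into it.\<close>

lemma full_cylinder_pullback:
  assumes "full_cylinder b m a" "full_cylinder b k s"
  shows "full_cylinder b (m + k) (a + s / b ^ m)"
  unfolding full_cylinder_def
proof (intro conjI ballI)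
  have bm: "b ^ m > 0" "b ^ k > 0" using b by auto
  have a: "0 \<le> a" "a + 1 / b ^ m \<le> 1" and s: "0 \<le> s" "s + 1 / b ^ k \<le> 1"
    using assms by (auto simp: full_cylinder_def)
  show "0 \<le> a + s / b ^ m" using a s bm by simp
  have e: "a + s / b ^ m + 1 / b ^ (m + k) = a + (s + 1 / b ^ k) / b ^ m"
    by (simp add: power_add add_divide_distrib mult.commute)
  have le: "(s + 1 / b ^ k) / b ^ m \<le> 1 / b ^ m"
    using s bm by (intro divide_right_mono) auto
  show "a + s / b ^ m + 1 / b ^ (m + k) \<le> 1" unfolding e using le a by linarith
  fix x assume x: "x \<in> {a + s / b ^ m..<a + s / b ^ m + 1 / b ^ (m + k)}"
  have "0 \<le> s / b ^ m" using s bm by simp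
  then have "x \<in> {a..<a + 1 / b ^ m}" using x le unfolding e by auto
  then have 1: "(beta_map b ^^ m) x = b ^ m * (x - a)" using assms(1) by (auto simp: full_cylinder_def)
  have "b ^ m * (x - a) \<in> {s..<s + 1 / b ^ k}"
    using x bm unfolding e by (simp add: add_divide_le_iff less_add_divide_iff)
  then have 2: "(beta_map b ^^ k) (b ^ m * (x - a)) = b ^ k * (b ^ m * (x - a) - s)"
    using assms(2) by (auto simp: full_cylinder_def)
  have "(beta_map b ^^ (m + k)) x = b ^ k * (b ^ m * (x - a) - s)"
    by (subst add.commute) (simp add: funpow_add 1 2)
  also have "\<dots> = b ^ (m + k) * (x - (a + s / b ^ m))"
    using b by (simp add: power_add field_simps)
  finally show "(beta_map b ^^ (m + k)) x = b ^ (m + k) * (x - (a + s / b ^ m))" .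
qed

text \<open>On the leftmost part the next digit is 0, since \<open>b\<close> times the n-th iterate
  is still below 1 there. As left endpoints persist, the number of full cylinders is nondecreasing
  in the order.\<close>

lemma full_cylinder_Suc:
  assumes "full_cylinder b n a" shows "full_cylinder b (Suc n) a"
  unfolding full_cylinder_def
proof (intro conjI ballI)
  have bn: "b ^ n > 0" "1 / b ^ Suc n \<le> 1 / b ^ n" using b by (auto simp: field_simps)
  have a: "0 \<le> a" "a + 1 / b ^ n \<le> 1" using assms by (auto simp: full_cylinder_def)
  show "0 \<le> a" "a + 1 / b ^ Suc n \<le> 1" using a bn by linarith+
  fix x assume x: "x \<in> {a..<a + 1 / b ^ Suc n}"
  have 1: "(beta_map b ^^ n) x = b ^ n * (x - a)"
    using x bn assms by (auto simp: full_cylinder_def)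
  have x0: "0 \<le> x - a" "x - a < 1 / b ^ Suc n" using x by auto
  then have "b ^ Suc n * (x - a) < b ^ Suc n * (1 / b ^ Suc n)"
    using b by (intro mult_strict_left_mono) auto
  then have "b ^ Suc n * (x - a) < 1" using b by simp
  moreover have "0 \<le> b ^ Suc n * (x - a)" using x0 b by simp
  ultimately have "frac (b ^ Suc n * (x - a)) = b ^ Suc n * (x - a)"
    by (simp only: frac_eq)
  then show "(beta_map b ^^ Suc n) x = b ^ Suc n * (x - a)"
    by (simp add: 1 beta_map_def mult.assoc)
qed

lemma full_cylinder_mono: "m \<le> n \<Longrightarrow> full_cylinder b m a \<Longrightarrow> full_cylinder b n a"
  by (induction n rule: dec_induct) (auto intro: full_cylinder_Suc)

lemma full_cylinder_left: "full_cylinder b n a \<Longrightarrow> (beta_map b ^^ n) a = 0"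
  using b by (auto simp: full_cylinder_def)

text \<open>Since 0 is a fixed point, a zero of an earlier iterate is a zero of the n-th one, which
  is affine on the cylinder and vanishes only at \<open>a\<close>.\<close>

lemma iterate_zero_imp_eq:
  assumes "full_cylinder b n a" "m \<le> n" "x \<in> {a..<a + 1 / b ^ n}" "(beta_map b ^^ m) x = 0"
  shows "x = a"
proof -
  have "(beta_map b ^^ n) x = (beta_map b ^^ (n - m)) ((beta_map b ^^ m) x)"
    using assms(2) by (metis comp_apply funpow_add le_add_diff_inverse2)
  also have "\<dots> = 0" by (simp add: assms beta_iterate_zero)
  finally have "b ^ n * (x - a) = 0" using assms by (auto simp: full_cylinder_def)
  then show ?thesis using b by simp
qed

text \<open>If the integer part of \<open>b\<close> times the i-th iterate jumped inside the
  cylinder, the next iterate would vanish at a point other than \<open>a\<close>.\<close>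

lemma full_cylinder_affine:
  assumes full: "full_cylinder b n a" and "i \<le> n" "x \<in> {a..<a + 1 / b ^ n}"
  shows "(beta_map b ^^ i) x = (beta_map b ^^ i) a + b ^ i * (x - a)"
  using assms(2,3)
proof (induction i arbitrary: x)
  case (Suc i)
  define y where "y = b * (beta_map b ^^ i) a"
  have pos: "b ^ Suc i > 0" using b by simp
  have iter: "b * (beta_map b ^^ i) z = y + b ^ Suc i * (z - a)" if "z \<in> {a..<a + 1 / b ^ n}" for z
    unfolding y_def using Suc.prems by (subst Suc.IH[OF _ that]) (simp_all add: algebra_simps)
  define y' where "y' = y + b ^ Suc i * (x - a)"
  have yy: "y \<le> y'" using Suc.prems pos by (auto simp: y'_def)
  have "\<lfloor>y'\<rfloor> = \<lfloor>y\<rfloor>"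
  proof (rule ccontr)
    assume "\<lfloor>y'\<rfloor> \<noteq> \<lfloor>y\<rfloor>"
    then have "\<lfloor>y\<rfloor> + 1 \<le> \<lfloor>y'\<rfloor>" using floor_mono[OF yy] by linarith
    then have N: "y < of_int (\<lfloor>y\<rfloor> + 1)" "of_int (\<lfloor>y\<rfloor> + 1) \<le> y'" by linarith+
    \<comment> \<open>The point where the affine continuation reaches the next integer.\<close>
    define e where "e = a + (of_int (\<lfloor>y\<rfloor> + 1) - y) / b ^ Suc i"
    have "a < e" using N pos unfolding e_def by simp
    moreover have "e \<le> a + (y' - y) / b ^ Suc i"
      using N pos unfolding e_def by (intro add_left_mono divide_right_mono) auto
    then have "e \<le> x" using b by (simp add: y'_def)
    ultimately have e: "e \<in> {a..<a + 1 / b ^ n}" "e \<noteq> a" using Suc.prems by auto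
    have "y + b ^ Suc i * (e - a) = of_int (\<lfloor>y\<rfloor> + 1)" using b by (simp add: e_def)
    then have "b * (beta_map b ^^ i) e = of_int (\<lfloor>y\<rfloor> + 1)" by (simp only: iter[OF e(1)])
    then have "(beta_map b ^^ Suc i) e = 0" by (simp add: beta_map_def)
    then show False using iterate_zero_imp_eq[OF full _ e(1), of "Suc i"] e(2) Suc.prems by auto
  qed
  moreover have "b * (beta_map b ^^ i) x = y'" using iter[OF Suc.prems(2)] by (simp add: y'_def)
  moreover have "(beta_map b ^^ Suc i) z = frac (b * (beta_map b ^^ i) z)" for z
    by (simp add: beta_map_def)
  ultimately show ?case by (simp only: frac_def flip: y_def) (simp add: y'_def)
qed auto

text \<open>An overlap without inclusion puts an endpoint of the coarser cylinder inside the finer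
  one. The left endpoint would be a second zero of an iterate there; at the right endpoint the
  affine formula would give the value 1, which the map never takes.\<close>

lemma full_cylinder_laminar:
  assumes m: "full_cylinder b m a" and n: "full_cylinder b n a'" and "m \<le> n"
    and meet: "{a..<a + 1 / b ^ m} \<inter> {a'..<a' + 1 / b ^ n} \<noteq> {}"
  shows "{a'..<a' + 1 / b ^ n} \<subseteq> {a..<a + 1 / b ^ m}"
proof -
  obtain y where y: "a \<le> y" "y < a + 1 / b ^ m" "a' \<le> y" "y < a' + 1 / b ^ n"
    using meet unfolding disjoint_iff by force
  have "a \<le> a'"
  proof (rule ccontr)
    assume "\<not> a \<le> a'"
    then have "a \<in> {a'..<a' + 1 / b ^ n}" using y by auto
    then have "a = a'" using iterate_zero_imp_eq[OF n \<open>m \<le> n\<close>] full_cylinder_left[OF m] by blast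
    then show False using \<open>\<not> a \<le> a'\<close> by simp
  qed
  moreover have "a' + 1 / b ^ n \<le> a + 1 / b ^ m"
  proof (rule ccontr)
    define e where "e = a + 1 / b ^ m"
    assume "\<not> a' + 1 / b ^ n \<le> a + 1 / b ^ m"
    then have e: "e \<in> {a'..<a' + 1 / b ^ n}" using y by (auto simp: e_def)
    have "a' \<in> {a..<a + 1 / b ^ m}" using y \<open>a \<le> a'\<close> by auto
    then have "(beta_map b ^^ m) a' = b ^ m * (a' - a)" using m by (auto simp: full_cylinder_def)
    then have "(beta_map b ^^ m) e = b ^ m * (e - a)"
      using full_cylinder_affine[OF n \<open>m \<le> n\<close> e] by (simp add: algebra_simps)
    also have "\<dots> = 1" using b by (simp add: e_def)
    finally have "(beta_map b ^^ m) e = 1" .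
    moreover have "e \<in> {0..<1}" using e n by (auto simp: full_cylinder_def)
    ultimately show False using beta_iterate_bounds[of e m] by auto
  qed
  ultimately show ?thesis by auto
qed

lemma full_cylinder_separated:
  assumes "full_cylinder b n a" "full_cylinder b n a'" "a \<noteq> a'"
  shows "{a..<a + 1 / b ^ n} \<inter> {a'..<a' + 1 / b ^ n} = {}"
proof (rule ccontr)
  assume *: "\<not> ?thesis"
  have p: "1 / b ^ n > 0" using b by simp
  have "{a'..<a' + 1 / b ^ n} \<subseteq> {a..<a + 1 / b ^ n}" "{a..<a + 1 / b ^ n} \<subseteq> {a'..<a' + 1 / b ^ n}"
    using full_cylinder_laminar[OF assms(1,2)] full_cylinder_laminar[OF assms(2,1)] * by blast+
  then have "{a..<a + 1 / b ^ n} = {a'..<a' + 1 / b ^ n}" by auto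
  then show False using assms(3) p by (auto simp: atLeastLessThan_eq_iff)
qed

lemma card_full_cylinders_le:
  "finite {a. full_cylinder b n a} \<and> real (card {a. full_cylinder b n a}) \<le> b ^ n"
proof -
  \<comment> \<open>A bound uniform over finite subsets yields finiteness and the count at
    once.\<close>
  have "card G \<le> nat \<lfloor>b ^ n\<rfloor>" if G: "G \<subseteq> {a. full_cylinder b n a}" "finite G" for G
  proof -
    have "(\<Sum>a\<in>G. 1 / b ^ n) \<le> 1 - 0"
    proof (rule sum_lengths_le_of_disjoint[where p = "\<lambda>a. a"])
      show "disjoint_family_on (\<lambda>a. {a..<a + 1 / b ^ n}) G"
        unfolding disjoint_family_on_def using full_cylinder_separated G(1) by blast
      show "\<And>j. j \<in> G \<Longrightarrow> {j..<j + 1 / b ^ n} \<subseteq> {0..1}"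
        using G(1) by (auto simp: full_cylinder_def)
    qed (use G b in auto)
    then have "real (card G) \<le> b ^ n" using b by (simp add: field_simps)
    then show ?thesis by (simp add: le_nat_floor)
  qed
  then have "finite {a. full_cylinder b n a} \<and> card {a. full_cylinder b n a} \<le> nat \<lfloor>b ^ n\<rfloor>"
    by (intro finite_if_finite_subsets_card_bdd) auto
  moreover have "real (nat \<lfloor>b ^ n\<rfloor>) \<le> b ^ n" using b by simp
  ultimately show ?thesis by linarith
qed

section \<open>Rightmost cylinders and the decomposition of [0,1)\<close>

text \<open>The quantity \<open>b ^ k * (1 - last_cylinder b k)\<close> is the quasi-greedy orbit of
  1: multiplied by \<open>b\<close> it becomes \<open>t\<close>, and one less than the ceiling of
  \<open>t\<close> is subtracted, which leaves a number in (0,1].\<close>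

lemma last_cylinder_bounds:
  "last_cylinder b k < 1" "b ^ k * (1 - last_cylinder b k) \<le> 1"
proof (induction k)
  case (Suc k)
  define t where "t = b ^ Suc k * (1 - last_cylinder b k)"
  have p: "b ^ Suc k > 0" using b by simp
  have "b ^ Suc k * (1 - last_cylinder b (Suc k))
      = t - b ^ Suc k * ((of_int \<lceil>t\<rceil> - 1) / b ^ Suc k)"
    by (simp add: t_def algebra_simps del: power_Suc)
  then have e: "b ^ Suc k * (1 - last_cylinder b (Suc k)) = t - (of_int \<lceil>t\<rceil> - 1)"
    using p by (simp del: power_Suc last_cylinder.simps power_eq_0_iff)
  have "t - (of_int \<lceil>t\<rceil> - 1) > 0" "t - (of_int \<lceil>t\<rceil> - 1) \<le> 1" by linarith+
  then have "b ^ Suc k * (1 - last_cylinder b (Suc k)) > 0" "b ^ Suc k * (1 - last_cylinder b (Suc k)) \<le> 1"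
    unfolding e by auto
  then show "last_cylinder b (Suc k) < 1" "b ^ Suc k * (1 - last_cylinder b (Suc k)) \<le> 1"
    using p by (simp_all only: zero_less_mult_iff) auto
qed auto

lemma last_cylinder_Suc_ge: "last_cylinder b k \<le> last_cylinder b (Suc k)"
proof -
  have "0 < b ^ Suc k * (1 - last_cylinder b k)" using b last_cylinder_bounds(1)[of k] by simp
  then have "1 \<le> \<lceil>b ^ Suc k * (1 - last_cylinder b k)\<rceil>" by (simp only: one_le_ceiling)
  then have "0 \<le> real_of_int (\<lceil>b ^ Suc k * (1 - last_cylinder b k)\<rceil> - 1)" by simp
  then show ?thesis using b by (simp del: power_Suc)
qed

lemma last_cylinder_nonneg: "0 \<le> last_cylinder b k"
  by (induction k) (use last_cylinder_Suc_ge order_trans in auto)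

text \<open>For x < 1 the scaled distance stays below its value at 1, hence below the ceiling, so
  the digit is \<open>N\<close> on the whole rightmost cylinder.\<close>

lemma last_cylinder_iterate:
  "x \<in> {last_cylinder b k..<1} \<Longrightarrow> (beta_map b ^^ k) x = b ^ k * (x - last_cylinder b k)"
proof (induction k)
  case (Suc k)
  define s where "s = last_cylinder b k"
  define N where "N = \<lceil>b ^ Suc k * (1 - s)\<rceil> - 1"
  have p: "b ^ Suc k > 0" using b by simp
  have s': "last_cylinder b (Suc k) = s + of_int N / b ^ Suc k" by (simp add: s_def N_def)
  have x: "s \<le> x" "x < 1" using Suc.prems last_cylinder_Suc_ge[of k] by (auto simp: s_def)
  then have 1: "(beta_map b ^^ k) x = b ^ k * (x - s)" using Suc.IH by (auto simp: s_def)
  have "s + of_int N / b ^ Suc k \<le> x" using Suc.prems unfolding s' by simp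
  then have "of_int N \<le> b ^ Suc k * (x - s)" using p by (simp only: add_divide_le_iff)
  moreover have "b ^ Suc k * (x - s) < b ^ Suc k * (1 - s)" using x b by simp
  then have "b ^ Suc k * (x - s) < of_int N + 1" unfolding N_def by linarith
  ultimately have "\<lfloor>b ^ Suc k * (x - s)\<rfloor> = N" by linarith
  then have "(beta_map b ^^ Suc k) x = b ^ Suc k * (x - s) - of_int N"
    by (simp add: 1 beta_map_def frac_def mult.assoc)
  also have "\<dots> = b ^ Suc k * (x - last_cylinder b (Suc k))"
    unfolding s' using b by (simp add: field_simps)
  finally show ?case .
qed auto

text \<open>Refining the rightmost cylinder of order \<open>k\<close> cuts off one full cylinder of
  order \<open>Suc k\<close> for each digit smaller than the last one; \<open>j\<close> is the digit
  of \<open>z\<close>.\<close>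

lemma full_cylinder_between_last:
  assumes z: "last_cylinder b k \<le> z" "z < last_cylinder b (Suc k)"
  obtains a where "full_cylinder b (Suc k) a" "z \<in> {a..<a + 1 / b ^ Suc k}"
proof -
  define s where "s = last_cylinder b k"
  define N where "N = \<lceil>b ^ Suc k * (1 - s)\<rceil> - 1"
  define j where "j = \<lfloor>b ^ Suc k * (z - s)\<rfloor>"
  define a where "a = s + of_int j / b ^ Suc k"
  have p: "b ^ Suc k > 0" using b by simp
  have s': "last_cylinder b (Suc k) = s + of_int N / b ^ Suc k" by (simp add: s_def N_def)
  have a1: "a + 1 / b ^ Suc k = s + (of_int j + 1) / b ^ Suc k" by (simp add: a_def add_divide_distrib)
  have s0: "0 \<le> s" by (simp add: s_def last_cylinder_nonneg)
  have zs: "s \<le> z" "z < s + of_int N / b ^ Suc k" using z unfolding s' by (auto simp: s_def)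
  have zb: "b ^ Suc k * (z - s) < of_int N" using zs(2) p by (simp only: less_add_divide_iff)
  have z0: "0 \<le> b ^ Suc k * (z - s)" using zs p by simp
  have j: "0 \<le> j" "j + 1 \<le> N" using zb z0 unfolding j_def by linarith+
  have aN: "a + 1 / b ^ Suc k \<le> last_cylinder b (Suc k)"
  proof -
    have "a + 1 / b ^ Suc k = s + (of_int (j + 1)) / b ^ Suc k" by (simp add: a_def add_divide_distrib)
    also have "\<dots> \<le> s + of_int N / b ^ Suc k"
      using j p by (intro add_left_mono divide_right_mono) (simp_all only: of_int_le_iff less_imp_le)
    finally show ?thesis unfolding s' .
  qed
  have as: "s \<le> a" using j p by (simp add: a_def)
  show ?thesis
  proof (rule that)
    have "of_int j \<le> b ^ Suc k * (z - s)" "b ^ Suc k * (z - s) < of_int j + 1"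
      unfolding j_def by linarith+
    then show "z \<in> {a..<a + 1 / b ^ Suc k}"
      unfolding atLeastLessThan_iff a1 using p by (simp only: atLeastLessThan_iff a_def add_divide_le_iff less_add_divide_iff)
    show "full_cylinder b (Suc k) a"
      unfolding full_cylinder_def
    proof (intro conjI ballI)
      show "0 \<le> a" using s0 as by simp
      show "a + 1 / b ^ Suc k \<le> 1" using aN last_cylinder_bounds(1)[of "Suc k"] by simp
      fix x assume x: "x \<in> {a..<a + 1 / b ^ Suc k}"
      then have "x \<in> {s..<1}" using as aN last_cylinder_bounds(1)[of "Suc k"] by auto
      then have 1: "(beta_map b ^^ k) x = b ^ k * (x - s)"
        using last_cylinder_iterate unfolding s_def by auto
      have "of_int j \<le> b ^ Suc k * (x - s)" "b ^ Suc k * (x - s) < of_int j + 1"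
        using x p unfolding atLeastLessThan_iff a1 by (simp_all only: a_def add_divide_le_iff less_add_divide_iff)
      then have "\<lfloor>b ^ Suc k * (x - s)\<rfloor> = j" by linarith
      then have "(beta_map b ^^ Suc k) x = b ^ Suc k * (x - s) - of_int j"
        by (simp add: 1 beta_map_def frac_def mult.assoc)
      also have "\<dots> = b ^ Suc k * (x - a)" using b by (simp add: a_def field_simps)
      finally show "(beta_map b ^^ Suc k) x = b ^ Suc k * (x - a)" .
    qed
  qed
qed

text \<open>Every cylinder of order \<open>n\<close> is a full one of order \<open>m\<close>
  followed by the rightmost one of order \<open>n - m\<close>. In the induction a point either stays
  in the rightmost part or has a smaller digit, and then lies in a full cylinder of the new
  order.\<close>

lemma cylinder_decomposition:
  assumes "x \<in> {0..<1}"
  obtains m a where "m \<le> n" "full_cylinder b m a"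
    "a + last_cylinder b (n - m) / b ^ m \<le> x" "x < a + 1 / b ^ m"
proof -
  have "\<exists>m a. m \<le> n \<and> full_cylinder b m a \<and> a + last_cylinder b (n - m) / b ^ m \<le> x \<and> x < a + 1 / b ^ m"
  proof (induction n)
    case 0
    then show ?case using assms full_cylinder_0 by (intro exI[of _ 0]) auto
  next
    case (Suc n)
    then obtain m a where m: "m \<le> n" "full_cylinder b m a"
      "a + last_cylinder b (n - m) / b ^ m \<le> x" "x < a + 1 / b ^ m" by blast
    define k where "k = n - m"
    define z where "z = b ^ m * (x - a)"
    have p: "b ^ m > 0" using b by simp
    have z: "last_cylinder b k \<le> z" using m(3) p by (simp add: z_def k_def add_divide_le_iff)
    have xz: "x = a + z / b ^ m" using b by (simp add: z_def)
    have Sk: "Suc n - m = Suc k" using m by (simp add: k_def)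
    show ?case
    proof (cases "z < last_cylinder b (Suc k)")
      case False
      then have "last_cylinder b (Suc k) / b ^ m \<le> z / b ^ m" using p by (simp add: divide_right_mono)
      then show ?thesis using m Sk xz by (intro exI[of _ m] exI[of _ a]) auto
    next
      case True
      obtain a' where a': "full_cylinder b (Suc k) a'" "z \<in> {a'..<a' + 1 / b ^ Suc k}"
        using full_cylinder_between_last[OF z True] by blast
      have n: "m + Suc k = Suc n" using m by (simp add: k_def)
      have "full_cylinder b (Suc n) (a + a' / b ^ m)"
        using full_cylinder_pullback[OF m(2) a'(1)] unfolding n .
      moreover have "a + a' / b ^ m \<le> x" using a'(2) p by (simp add: xz divide_right_mono)
      moreover have "z / b ^ m < (a' + 1 / b ^ Suc k) / b ^ m"
        using a'(2) p by (intro divide_strict_right_mono) auto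
      then have "x < a + a' / b ^ m + 1 / b ^ Suc n"
        unfolding xz n[symmetric] power_add using p by (simp add: add_divide_distrib mult.commute)
      ultimately show ?thesis by (intro exI[of _ "Suc n"] exI[of _ "a + a' / b ^ m"]) auto
    qed
  qed
  then show ?thesis using that by blast
qed

lemma cylinder_iterate:
  assumes "m \<le> n" "full_cylinder b m a" "a + last_cylinder b (n - m) / b ^ m \<le> x" "x < a + 1 / b ^ m"
  shows "(beta_map b ^^ n) x = b ^ n * (x - (a + last_cylinder b (n - m) / b ^ m))"
proof -
  define z where "z = b ^ m * (x - a)"
  have p: "b ^ m > 0" using b by simp
  have "0 \<le> last_cylinder b (n - m) / b ^ m" using p last_cylinder_nonneg by simp
  then have "x \<in> {a..<a + 1 / b ^ m}" using assms by auto
  then have 1: "(beta_map b ^^ m) x = z" using assms(2) by (auto simp: full_cylinder_def z_def)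
  have "z \<in> {last_cylinder b (n - m)..<1}" using assms p by (simp add: z_def add_divide_le_iff less_add_divide_iff)
  then have 2: "(beta_map b ^^ (n - m)) z = b ^ (n - m) * (z - last_cylinder b (n - m))"
    by (rule last_cylinder_iterate)
  have "(beta_map b ^^ n) x = (beta_map b ^^ (n - m)) ((beta_map b ^^ m) x)"
    using assms(1) by (metis comp_apply funpow_add le_add_diff_inverse2)
  also have "\<dots> = b ^ (n - m) * (z - last_cylinder b (n - m))" by (simp add: 1 2)
  also have "\<dots> = b ^ (n - m) * b ^ m * (x - (a + last_cylinder b (n - m) / b ^ m))"
    using b by (simp add: z_def field_simps)
  also have "b ^ (n - m) * b ^ m = b ^ n" using assms(1) by (simp flip: power_add)
  finally show ?thesis .
qed

lemma last_cylinder_tendsto: "z < 1 \<Longrightarrow> \<exists>k. z < last_cylinder b k"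
proof -
  assume z: "z < 1"
  obtain k where k: "1 / (1 - z) < b ^ k" using real_arch_pow[OF b] by blast
  have "b ^ k * (1 - last_cylinder b k) \<le> 1" by (rule last_cylinder_bounds)
  also have "1 < b ^ k * (1 - z)" using k z by (simp add: field_simps)
  finally have "1 - last_cylinder b k < 1 - z" using b by simp
  then show ?thesis by auto
qed

text \<open>The rightmost cylinders shrink to 1, so a point z < 1 has to leave them, and it then
  enters a full cylinder of positive order; this is repeated inside that cylinder.\<close>

lemma full_cylinders_contract:
  assumes x: "x \<in> {0..<1}"
  shows "\<exists>n\<ge>m. \<exists>a. full_cylinder b n a \<and> x \<in> {a..<a + 1 / b ^ n}"
proof (induction m)
  case 0
  then show ?case using x full_cylinder_0 by (intro exI[of _ 0] exI[of _ 0] conjI) auto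
next
  case (Suc m)
  then obtain n a where n: "m \<le> n" "full_cylinder b n a" "x \<in> {a..<a + 1 / b ^ n}" by blast
  define z where "z = b ^ n * (x - a)"
  have p: "b ^ n > 0" using b by simp
  have xz: "x = a + z / b ^ n" using b by (simp add: z_def)
  have z: "0 \<le> z" "z < 1" using n(3) p by (simp_all add: z_def less_add_divide_iff)
  define k where "k = (LEAST k. z < last_cylinder b k)"
  have k: "z < last_cylinder b k" unfolding k_def using last_cylinder_tendsto[OF z(2)] by (rule LeastI_ex)
  then obtain l where l: "k = Suc l" using z by (cases k) auto
  have "last_cylinder b l \<le> z" using not_less_Least[of l "\<lambda>k. z < last_cylinder b k"] l by (simp add: k_def)
  then obtain a' where a': "full_cylinder b k a'" "z \<in> {a'..<a' + 1 / b ^ k}"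
    using full_cylinder_between_last k unfolding l by blast
  have "a + a' / b ^ n \<le> x" using a'(2) p by (simp add: xz divide_right_mono)
  moreover have "z / b ^ n < (a' + 1 / b ^ k) / b ^ n"
    using a'(2) p by (intro divide_strict_right_mono) auto
  then have "x < a + a' / b ^ n + 1 / b ^ (n + k)"
    unfolding xz power_add using p by (simp add: add_divide_distrib mult.commute)
  ultimately show ?case using full_cylinder_pullback[OF n(2) a'(1)] n(1) l
    by (intro exI[of _ "n + k"]) auto
qed

section \<open>Counting full cylinders\<close>

text \<open>Each full cylinder of order m <= n, followed by the rightmost one of order n - m,
  accounts for length at most \<open>1 / b ^ n\<close>, and these pieces cover [0,1).\<close>

lemma power_le_sum_card_full_cylinders:
  "b ^ n \<le> (\<Sum>m\<le>n. real (card {a. full_cylinder b m a}))"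
proof -
  let ?P = "SIGMA m:{..n}. {a. full_cylinder b m a}"
  have fin: "finite {a. full_cylinder b m a}" for m using card_full_cylinders_le by blast
  have "1 - 0 \<le> (\<Sum>p\<in>?P. 1 / b ^ n)"
  proof (rule length_le_sum_of_cover[where p = "\<lambda>(m, a). a + last_cylinder b (n - m) / b ^ m"])
    show "{0..<1} \<subseteq> (\<Union>j\<in>?P. {(case j of (m, a) \<Rightarrow> a + last_cylinder b (n - m) / b ^ m)..<
             (case j of (m, a) \<Rightarrow> a + last_cylinder b (n - m) / b ^ m) + 1 / b ^ n})"
    proof
      fix x :: real assume x: "x \<in> {0..<1}"
      obtain m a where m: "m \<le> n" "full_cylinder b m a"
        "a + last_cylinder b (n - m) / b ^ m \<le> x" "x < a + 1 / b ^ m"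
        using cylinder_decomposition[OF x] by blast
      have "(beta_map b ^^ n) x < 1" using beta_iterate_bounds[OF x] by auto
      then have "x < a + last_cylinder b (n - m) / b ^ m + 1 / b ^ n"
        using b by (simp add: cylinder_iterate[OF m] less_add_divide_iff)
      then show "x \<in> (\<Union>j\<in>?P. {(case j of (m, a) \<Rightarrow> a + last_cylinder b (n - m) / b ^ m)..<
             (case j of (m, a) \<Rightarrow> a + last_cylinder b (n - m) / b ^ m) + 1 / b ^ n})"
        using m by (intro UN_I[of "(m, a)"]) auto
    qed
  qed (use b fin in auto)
  then have "b ^ n \<le> real (card ?P)" using b by (simp add: field_simps)
  also have "card ?P = (\<Sum>m\<le>n. card {a. full_cylinder b m a})"
    using fin by (intro card_SigmaI) auto
  finally show ?thesis by simp
qed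

lemma sum_powers_le: "(\<Sum>m\<le>n. b ^ m) \<le> b / (b - 1) * b ^ n"
proof -
  have "(\<Sum>m\<le>n. b ^ m) = (b ^ Suc n - 1) / (b - 1)"
    using b geometric_sum[of b "Suc n"] by (simp add: lessThan_Suc_atMost)
  also have "\<dots> \<le> b ^ Suc n / (b - 1)" using b by (intro divide_right_mono) auto
  finally show ?thesis by simp
qed

text \<open>In the preceding estimate the orders up to n - K contribute at most
  \<open>b ^ n / 2\<close>, because the m-th count is at most \<open>b ^ m\<close> and
  \<open>K\<close> makes the geometric sum small; the remaining counts are at most the n-th one by
  monotonicity.\<close>

lemma card_full_cylinders_ge:
  obtains c where "0 < c" "\<And>n. c * b ^ n \<le> real (card {a. full_cylinder b n a})"
proof -
  define f where "f = (\<lambda>n. real (card {a. full_cylinder b n a}))"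
  have fin: "finite {a. full_cylinder b m a}" for m using card_full_cylinders_le by blast
  have mono: "f m \<le> f n" if "m \<le> n" for m n
    unfolding f_def using fin that by (intro of_nat_mono card_mono) (auto intro: full_cylinder_mono)
  have f0: "f 0 \<ge> 1"
  proof -
    have "{0} \<subseteq> {a. full_cylinder b 0 a}" using full_cylinder_0 by auto
    then have "card {0::real} \<le> card {a. full_cylinder b 0 a}" using fin card_mono by blast
    then show ?thesis by (simp add: f_def)
  qed
  obtain K where K: "2 * b / (b - 1) < b ^ K" using real_arch_pow[OF b] by blast
  define c where "c = min (1 / b ^ K) (1 / (2 * real (Suc K)))"
  have c: "c > 0" using b by (simp add: c_def)
  have "c * b ^ n \<le> f n" for n
  proof (cases "n < K")
    case True
    then have "b ^ n \<le> b ^ K" using b by (intro power_increasing) auto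
    have "c * b ^ n \<le> (1 / b ^ K) * b ^ K"
      using b \<open>b ^ n \<le> b ^ K\<close> by (intro mult_mono) (auto simp: c_def)
    also have "\<dots> = 1" using b by simp
    also have "1 \<le> f n" using f0 mono[of 0 n] by simp
    finally show ?thesis .
  next
    case False
    then obtain q where q: "n = q + K" by (metis add.commute le_add_diff_inverse not_less)
    have "b ^ n \<le> (\<Sum>m\<le>n. f m)" unfolding f_def by (rule power_le_sum_card_full_cylinders)
    also have "{..n} = {..q} \<union> {Suc q..n}" using q by auto
    also have "(\<Sum>m\<in>{..q} \<union> {Suc q..n}. f m) = (\<Sum>m\<le>q. f m) + (\<Sum>m\<in>{Suc q..n}. f m)"
      by (rule sum.union_disjoint) auto
    also have "\<dots> \<le> (\<Sum>m\<le>q. b ^ m) + (\<Sum>m\<in>{Suc q..n}. f n)"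
      using card_full_cylinders_le by (intro add_mono sum_mono mono) (auto simp: f_def)
    also have "\<dots> \<le> b / (b - 1) * b ^ q + real (Suc K) * f n"
      using sum_powers_le[of q] q f0 mono[of 0 n] by (auto intro!: add_mono mult_right_mono)
    also have "b / (b - 1) * b ^ q \<le> b ^ n / 2"
    proof -
      have "b / (b - 1) * b ^ q \<le> (b ^ K / 2) * b ^ q"
        using K b by (intro mult_right_mono) (simp_all add: mult.commute)
      then show ?thesis by (simp add: q power_add mult.commute)
    qed
    finally have "b ^ n / 2 \<le> real (Suc K) * f n" by (simp add: field_simps)
    then have "1 / (2 * real (Suc K)) * b ^ n \<le> f n" by (simp add: field_simps)
    moreover have "c * b ^ n \<le> 1 / (2 * real (Suc K)) * b ^ n"
      using b by (intro mult_right_mono) (auto simp: c_def)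
    ultimately show ?thesis by linarith
  qed
  then show ?thesis using c that unfolding f_def by blast
qed

text \<open>The point is that the constant does not depend on the interval. Finitely many disjoint
  full cylinders inside it fill half of its length, and each one of order m contains, by pullback,
  at least a fixed multiple of \<open>b ^ (n - m)\<close> full cylinders of order n.\<close>

lemma card_full_cylinders_in_interval:
  obtains c where "0 < c"
    "\<And>u v. 0 \<le> u \<Longrightarrow> u < v \<Longrightarrow> v \<le> 1 \<Longrightarrow> \<exists>n0. \<forall>n\<ge>n0.
       c * (v - u) * b ^ n \<le> real (card {a. full_cylinder b n a \<and> u \<le> a \<and> a + 1 / b ^ n \<le> v})"
proof -
  obtain c where c: "0 < c" "\<And>n. c * b ^ n \<le> real (card {a. full_cylinder b n a})"
    using card_full_cylinders_ge by metis
  have fin: "finite {a. full_cylinder b m a}" for m using card_full_cylinders_le by blast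
  show thesis
  proof (rule that[of "c / 2"])
    fix u v :: real assume uv: "0 \<le> u" "u < v" "v \<le> 1"
    define I where "I = (\<lambda>(m, a). {a..<a + 1 / b ^ m})"
    define \<C> where "\<C> p = {(m, a). m \<le> p \<and> full_cylinder b m a \<and> u \<le> a \<and> a + 1 / b ^ m \<le> v}" for p
    define X where "X p = (\<Union>q\<in>\<C> p. I q)" for p
    have finC: "finite (\<C> p)" for p
      by (rule finite_subset[of _ "SIGMA m:{..p}. {a. full_cylinder b m a}"]) (use fin in \<open>auto simp: \<C>_def\<close>)
    have Xs: "X p \<subseteq> {u..v}" for p by (auto simp: X_def \<C>_def I_def)
    have Xm: "X p \<in> sets lborel" for p
      unfolding X_def I_def using finC by (intro sets.finite_UN) auto
    have inc: "incseq X" unfolding incseq_def X_def by (intro allI impI UN_mono) (auto simp: \<C>_def)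
    have sup: "{u<..<v} \<subseteq> (\<Union>p. X p)"
    proof
      fix x assume x: "x \<in> {u<..<v}"
      define e where "e = min (x - u) (v - x)"
      have e: "e > 0" using x by (simp add: e_def)
      obtain m where m: "1 / e < b ^ m" using real_arch_pow[OF b] by blast
      have "x \<in> {0..<1}" using x uv by auto
      then obtain n a where n: "m \<le> n" "full_cylinder b n a" "x \<in> {a..<a + 1 / b ^ n}"
        using full_cylinders_contract[of x m] by blast
      have "b ^ m \<le> b ^ n" using b n by (intro power_increasing) auto
      then have "1 / e < b ^ n" using m by simp
      then have "1 / b ^ n < e" using e b by (simp add: field_simps)
      then have "(n, a) \<in> \<C> n" using n by (auto simp: \<C>_def e_def)
      then have "x \<in> X n" using n(3) unfolding X_def I_def by blast
      then show "x \<in> (\<Union>p. X p)" by blast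
    qed
    have Uf: "(\<Union>p. X p) \<subseteq> {u..v}" using Xs by blast
    have Um: "(\<Union>p. X p) \<in> sets lborel" using Xm by blast
    have Ufin: "emeasure lborel (\<Union>p. X p) \<noteq> \<infinity>"
      using emeasure_mono[OF Uf, of lborel] uv by (auto simp: top_unique)
    have lim: "(\<lambda>p. measure lborel (X p)) \<longlonglongrightarrow> measure lborel (\<Union>p. X p)"
      by (rule Lim_measure_incseq) (use Xm inc Ufin in auto)
    have "v - u = measure lborel {u<..<v}" using uv by simp
    also have "\<dots> \<le> measure lborel (\<Union>p. X p)"
      using sup Um Ufin by (intro measure_mono_fmeasurable) (auto simp: fmeasurable_def less_top)
    finally have "(v - u) / 2 < measure lborel (\<Union>p. X p)" using uv by simp
    from order_tendstoD(1)[OF lim this] obtain p where p: "(v - u) / 2 < measure lborel (X p)"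
      using eventually_happens[of _ sequentially] by auto
    \<comment> \<open>Inclusion-maximal cylinders have the same union as all of them and, by
      laminarity, are pairwise disjoint.\<close>
    define M where "M = {q \<in> \<C> p. \<forall>q'\<in>\<C> p. I q \<subseteq> I q' \<longrightarrow> I q = I q'}"
    have If: "I q \<in> fmeasurable lborel" for q
      using b by (cases q) (auto simp: I_def fmeasurable_def)
    have finM: "finite M" using finC by (simp add: M_def)
    have ne: "I q \<noteq> {}" if "q \<in> \<C> p" for q using b that by (auto simp: I_def \<C>_def)
    have disj: "I q \<inter> I q' = {}" if q: "q \<in> M" "q' \<in> M" "q \<noteq> q'" for q q'
    proof (rule ccontr)
      assume *: "I q \<inter> I q' \<noteq> {}"
      obtain m a m' a' where qq: "q = (m, a)" "q' = (m', a')" by (cases q, cases q') auto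
      have full: "full_cylinder b m a" "full_cylinder b m' a'" using q qq by (auto simp: M_def \<C>_def)
      have "I q \<subseteq> I q' \<or> I q' \<subseteq> I q"
      proof (cases "m \<le> m'")
        case True
        then show ?thesis using full_cylinder_laminar[OF full True] * unfolding qq I_def by auto
      next
        case False
        then have "m' \<le> m" by simp
        then show ?thesis using full_cylinder_laminar[OF full(2,1)] * unfolding qq I_def by auto
      qed
      then have "I q = I q'" using q unfolding M_def by blast
      then have "{a..<a + 1 / b ^ m} = {a'..<a' + 1 / b ^ m'}" unfolding qq I_def by simp
      moreover have "1 / b ^ m > 0" "1 / b ^ m' > 0" using b by auto
      ultimately have "a = a'" "1 / b ^ m = 1 / b ^ m'" by (auto simp: atLeastLessThan_eq_iff)
      then have "a = a'" "m = m'" using b by auto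
      then show False using q qq by simp
    qed
    have "X p \<subseteq> (\<Union>q\<in>M. I q)"
    proof
      fix x assume "x \<in> X p"
      then obtain q where q: "q \<in> \<C> p" "x \<in> I q" by (auto simp: X_def)
      obtain S where S: "S \<in> I ` \<C> p" "I q \<subseteq> S" "\<forall>T\<in>I ` \<C> p. S \<subseteq> T \<longrightarrow> S = T"
        using finite_has_maximal2[of "I ` \<C> p" "I q"] finC[of p] q by blast
      then obtain q' where "q' \<in> \<C> p" "S = I q'" by auto
      then have "q' \<in> M" using S unfolding M_def by auto
      then show "x \<in> (\<Union>q\<in>M. I q)" using q S \<open>S = I q'\<close> by auto
    qed
    then have "measure lborel (X p) \<le> measure lborel (\<Union>q\<in>M. I q)"
      using finM Xm If by (intro measure_mono_fmeasurable) (auto intro!: fmeasurable.finite_UN)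
    also have "\<dots> \<le> (\<Sum>q\<in>M. measure lborel (I q))"
      using finM by (intro measure_UNION_le) (auto simp: I_def split: prod.split)
    also have "\<dots> = (\<Sum>q\<in>M. 1 / b ^ fst q)"
      by (rule sum.cong) (use b in \<open>auto simp: I_def split: prod.split\<close>)
    finally have sum: "(v - u) / 2 < (\<Sum>q\<in>M. 1 / b ^ fst q)" using p by simp
    have "c / 2 * (v - u) * b ^ n \<le> real (card {a. full_cylinder b n a \<and> u \<le> a \<and> a + 1 / b ^ n \<le> v})"
      (is "_ \<le> real (card ?N)") if n: "p \<le> n" for n
    proof -
      define G where "G = (\<lambda>(m, a). (\<lambda>s. a + s / b ^ m) ` {s. full_cylinder b (n - m) s})"
      have finN: "finite ?N" by (rule finite_subset[OF _ fin[of n]]) auto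
      have GI: "G q \<subseteq> I q" if "q \<in> M" for q
      proof
        fix y assume y: "y \<in> G q"
        obtain m a where q: "q = (m, a)" by (cases q)
        obtain s where s: "full_cylinder b (n - m) s" "y = a + s / b ^ m" using y unfolding q G_def by auto
        have "0 \<le> s" "s < 1" using s b by (auto simp: full_cylinder_def) (smt (verit) divide_pos_pos zero_less_power)
        then show "y \<in> I q" using b unfolding q I_def s(2) by (auto simp: divide_strict_right_mono)
      qed
      have GN: "G q \<subseteq> ?N" if "q \<in> M" for q
      proof
        fix y assume y: "y \<in> G q"
        obtain m a where q: "q = (m, a)" by (cases q)
        have ma: "m \<le> p" "full_cylinder b m a" "u \<le> a" "a + 1 / b ^ m \<le> v"
          using that unfolding q M_def \<C>_def by auto
        obtain s where s: "full_cylinder b (n - m) s" "y = a + s / b ^ m" using y unfolding q G_def by auto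
        have full: "full_cylinder b n y"
          using full_cylinder_pullback[OF ma(2) s(1)] ma(1) n by (simp add: s)
        have "y \<in> I q" using GI[OF that] y by blast
        then have "{a..<a + 1 / b ^ m} \<inter> {y..<y + 1 / b ^ n} \<noteq> {}"
          using b unfolding q I_def by auto
        then have "{y..<y + 1 / b ^ n} \<subseteq> {a..<a + 1 / b ^ m}"
          using full_cylinder_laminar[OF ma(2) full] ma(1) n by auto
        moreover have "0 < b ^ n" using b by simp
        ultimately have "a \<le> y" "y + 1 / b ^ n \<le> a + 1 / b ^ m"
          using \<open>0 < b ^ n\<close> by (auto simp: ivl_subset)
        then show "y \<in> ?N" using full ma by auto
      qed
      have cardG: "c * b ^ n * (1 / b ^ fst q) \<le> real (card (G q))" if "q \<in> M" for q
      proof -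
        obtain m a where q: "q = (m, a)" by (cases q)
        have "m \<le> n" using that n unfolding q M_def \<C>_def by auto
        then have "c * b ^ n * (1 / b ^ fst q) = c * b ^ (n - m)" using b by (simp add: q power_diff)
        moreover have "inj_on (\<lambda>s. a + s / b ^ m) {s. full_cylinder b (n - m) s}"
          using b by (auto simp: inj_on_def)
        then have "card (G q) = card {s. full_cylinder b (n - m) s}"
          unfolding q G_def by (simp add: card_image)
        ultimately show ?thesis using c(2)[of "n - m"] by (simp only:)
      qed
      have "c / 2 * (v - u) * b ^ n = c * b ^ n * ((v - u) / 2)" by simp
      also have "\<dots> \<le> c * b ^ n * (\<Sum>q\<in>M. 1 / b ^ fst q)"
        using sum c b by (intro mult_left_mono) auto
      also have "\<dots> \<le> (\<Sum>q\<in>M. real (card (G q)))"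
        unfolding sum_distrib_left by (intro sum_mono cardG)
      also have "\<dots> = real (\<Sum>q\<in>M. card (G q))" by simp
      also have "(\<Sum>q\<in>M. card (G q)) = card (\<Union>q\<in>M. G q)"
      proof (rule card_UN_disjoint[symmetric])
        show "\<forall>q\<in>M. finite (G q)" using GN finN finite_subset by blast
        show "\<forall>q\<in>M. \<forall>q'\<in>M. q \<noteq> q' \<longrightarrow> G q \<inter> G q' = {}" using GI disj by blast
      qed (rule finM)
      also have "real \<dots> \<le> real (card ?N)"
        using GN finN by (intro of_nat_mono card_mono) auto
      finally show ?thesis .
    qed
    then show "\<exists>n0. \<forall>n\<ge>n0. c / 2 * (v - u) * b ^ n
        \<le> real (card {a. full_cylinder b n a \<and> u \<le> a \<and> a + 1 / b ^ n \<le> v})" by blast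
  qed (use c in simp)
qed

section \<open>Points close to the moving target in one coordinate\<close>

text \<open>The bound on \<open>L\<close> makes the difference of the n-th iterate and
  \<open>h\<close> expand by at least \<open>b ^ n / 2\<close> on every cylinder of order n, full or
  not, so the set meets each in diameter at most \<open>4 * \<tau> / b ^ n\<close>. The number of
  cylinders is at most the sum of the \<open>b ^ m\<close>.\<close>

lemma small_distance_set_cover:
  assumes lip: "L-lipschitz_on {0..<1} h" and n: "2 * L \<le> b ^ n" and \<tau>: "0 \<le> \<tau>"
  obtains Y where "finite Y" "real (card Y) \<le> b / (b - 1) * b ^ n"
    "{x \<in> {0..<1}. \<bar>(beta_map b ^^ n) x - h x\<bar> \<le> \<tau>} \<subseteq> (\<Union>y\<in>Y. {y..y + 4 * \<tau> / b ^ n})"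
proof -
  let ?P = "SIGMA m:{..n}. {a. full_cylinder b m a}"
  have fin: "finite {a. full_cylinder b m a}" for m using card_full_cylinders_le by blast
  have finP: "finite ?P" using fin by auto
  define Z where "Z = (\<lambda>(m, a). {x. a + last_cylinder b (n - m) / b ^ m \<le> x \<and> x < a + 1 / b ^ m \<and>
      \<bar>(beta_map b ^^ n) x - h x\<bar> \<le> \<tau>})"
  have p: "b ^ n > 0" using b by simp
  have close: "x \<le> x' + 4 * \<tau> / b ^ n" if "q \<in> ?P" "x \<in> Z q" "x' \<in> Z q" for q x x'
  proof -
    obtain m a where q: "q = (m, a)" by (cases q)
    have ma: "m \<le> n" "full_cylinder b m a" using that q by auto
    have x: "a + last_cylinder b (n - m) / b ^ m \<le> x" "x < a + 1 / b ^ m" "\<bar>(beta_map b ^^ n) x - h x\<bar> \<le> \<tau>"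
      and x': "a + last_cylinder b (n - m) / b ^ m \<le> x'" "x' < a + 1 / b ^ m" "\<bar>(beta_map b ^^ n) x' - h x'\<bar> \<le> \<tau>"
      using that by (auto simp: Z_def q)
    have "0 \<le> last_cylinder b (n - m) / b ^ m" using b last_cylinder_nonneg by simp
    then have r: "x \<in> {0..<1}" "x' \<in> {0..<1}" using x(1,2) x'(1,2) ma(2) by (auto simp: full_cylinder_def)
    have "(beta_map b ^^ n) x - (beta_map b ^^ n) x' = b ^ n * (x - x')"
      using cylinder_iterate[OF ma x(1,2)] cylinder_iterate[OF ma x'(1,2)] by (simp add: algebra_simps)
    moreover have "\<bar>h x - h x'\<bar> \<le> L * \<bar>x - x'\<bar>"
      using lipschitz_onD[OF lip r] by (simp add: dist_real_def)
    moreover have "b ^ n * (x - x') \<le> b ^ n * \<bar>x - x'\<bar>" using p by (intro mult_left_mono) auto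
    moreover have "\<bar>b ^ n * (x - x')\<bar> = b ^ n * \<bar>x - x'\<bar>" using p by (simp add: abs_mult)
    moreover have "2 * L * \<bar>x - x'\<bar> \<le> b ^ n * \<bar>x - x'\<bar>" using n by (intro mult_right_mono) auto
    ultimately have "b ^ n * \<bar>x - x'\<bar> \<le> 4 * \<tau>" using x(3) x'(3) by linarith
    then have "\<bar>x - x'\<bar> \<le> 4 * \<tau> / b ^ n" using p by (simp add: pos_le_divide_eq mult.commute)
    then show ?thesis by linarith
  qed
  show ?thesis
  \<comment> \<open>Pairs with empty \<open>Z q\<close> contribute an arbitrary point; only the
    number of pairs is bounded.\<close>
  proof (rule that[of "(\<lambda>q. Inf (Z q)) ` ?P"])
    show "finite ((\<lambda>q. Inf (Z q)) ` ?P)" using finP by simp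
    have "card ((\<lambda>q. Inf (Z q)) ` ?P) \<le> card ?P" using finP by (rule card_image_le)
    also have "card ?P = (\<Sum>m\<le>n. card {a. full_cylinder b m a})"
      using fin by (intro card_SigmaI) auto
    finally have "real (card ((\<lambda>q. Inf (Z q)) ` ?P)) \<le> (\<Sum>m\<le>n. real (card {a. full_cylinder b m a}))"
      by (simp flip: of_nat_sum)
    also have "\<dots> \<le> (\<Sum>m\<le>n. b ^ m)" using card_full_cylinders_le by (intro sum_mono) auto
    also have "\<dots> \<le> b / (b - 1) * b ^ n" by (rule sum_powers_le)
    finally show "real (card ((\<lambda>q. Inf (Z q)) ` ?P)) \<le> b / (b - 1) * b ^ n" .
    show "{x \<in> {0..<1}. \<bar>(beta_map b ^^ n) x - h x\<bar> \<le> \<tau>}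
       \<subseteq> (\<Union>y\<in>(\<lambda>q. Inf (Z q)) ` ?P. {y..y + 4 * \<tau> / b ^ n})"
    proof clarify
      fix x :: real assume x: "x \<in> {0..<1}" "\<bar>(beta_map b ^^ n) x - h x\<bar> \<le> \<tau>"
      obtain m a where m: "m \<le> n" "full_cylinder b m a"
        "a + last_cylinder b (n - m) / b ^ m \<le> x" "x < a + 1 / b ^ m"
        using cylinder_decomposition[OF x(1)] by blast
      have q: "(m, a) \<in> ?P" using m by auto
      have xZ: "x \<in> Z (m, a)" using m x by (auto simp: Z_def)
      have lb: "x - 4 * \<tau> / b ^ n \<le> z" if "z \<in> Z (m, a)" for z
        using close[OF q xZ that] by linarith
      have "Inf (Z (m, a)) \<le> x" using lb xZ by (intro cInf_lower bdd_belowI)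
      moreover have "x - 4 * \<tau> / b ^ n \<le> Inf (Z (m, a))" using lb xZ by (intro cInf_greatest) auto
      ultimately show "x \<in> (\<Union>y\<in>(\<lambda>q. Inf (Z q)) ` ?P. {y..y + 4 * \<tau> / b ^ n})"
        using q by (intro UN_I[of "Inf (Z (m, a))"]) auto
    qed
  qed
qed

text \<open>At the left end the difference to \<open>h\<close> is at most 0. If it becomes
  nonnegative, it has a zero, and its slope is at most \<open>b ^ n * (1 + L)\<close>. Otherwise it
  is negative throughout, and as \<open>h\<close> is at most 1 it is small near the right end, where
  the iterate is close to 1.\<close>

lemma full_cylinder_target:
  assumes lip: "L-lipschitz_on {0..<1} h" and h: "h \<in> {0..<1} \<rightarrow> {0..1}"
    and full: "full_cylinder b n a" and \<psi>: "0 < \<psi>" "\<psi> \<le> 1"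
    and \<sigma>: "0 < \<sigma>" "\<sigma> \<le> 1 / 4" "\<sigma> * (1 + L) < 1"
  obtains z where "a \<le> z" "z + \<sigma> * (\<psi> / b ^ n) < a + 1 / b ^ n"
    "\<And>x. x \<in> {z..z + \<sigma> * (\<psi> / b ^ n)} \<Longrightarrow> \<bar>(beta_map b ^^ n) x - h x\<bar> < \<psi>"
proof -
  define l where "l = 1 / b ^ n"
  define e where "e = a + l"
  define w where "w = \<sigma> * (\<psi> / b ^ n)"
  define \<phi> where "\<phi> = (\<lambda>x. b ^ n * (x - a) - h x)"
  have p: "b ^ n > 0" "1 \<le> b ^ n" using b by auto
  have l: "l > 0" "b ^ n * l = 1" using b by (auto simp: l_def)
  have L: "0 \<le> L" using lip by (rule lipschitz_on_nonneg)
  have w: "0 < w" "w \<le> l / 4" "b ^ n * w = \<sigma> * \<psi>"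
  proof -
    have "\<sigma> * \<psi> \<le> 1 / 4 * 1" using \<sigma> \<psi> by (intro mult_mono) auto
    then show "w \<le> l / 4" using p by (simp add: w_def l_def field_simps)
  qed (use \<sigma> \<psi> b in \<open>auto simp: w_def\<close>)
  have e1: "0 \<le> a" "e \<le> 1" using full by (auto simp: full_cylinder_def e_def l_def)
  have \<phi>: "(beta_map b ^^ n) x - h x = \<phi> x" if "x \<in> {a..<e}" for x
    using that full by (auto simp: full_cylinder_def \<phi>_def e_def l_def)
  have hx: "0 \<le> h x" "h x \<le> 1" if "x \<in> {a..<e}" for x
    using h that e1 by (auto simp: Pi_iff)
  have "\<exists>z. a \<le> z \<and> z + w < e \<and> (\<forall>x\<in>{z..z + w}. \<bar>\<phi> x\<bar> < \<psi>)"
  proof (cases "\<exists>x1\<in>{a..<e}. 0 \<le> \<phi> x1")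
    case True
    then obtain x1 where x1: "a \<le> x1" "x1 < e" "0 \<le> \<phi> x1" by auto
    have "continuous_on {a..x1} h"
      using lip e1 x1 by (intro lipschitz_on_continuous_on[OF lipschitz_on_subset]) auto
    then have "continuous_on {a..x1} \<phi>" unfolding \<phi>_def by (intro continuous_intros)
    moreover have "\<phi> a \<le> 0" using hx[of a] x1 by (auto simp: \<phi>_def)
    ultimately obtain x0 where x0: "a \<le> x0" "x0 \<le> x1" "\<phi> x0 = 0"
      using IVT'[of \<phi> a 0 x1] x1 by auto
    have small: "\<bar>\<phi> x\<bar> < \<psi>" if x: "x \<in> {a..<e}" "\<bar>x - x0\<bar> \<le> w" for x
    proof -
      have "\<bar>h x - h x0\<bar> \<le> L * \<bar>x - x0\<bar>"
        using lipschitz_onD[OF lip, of x x0] x x0 x1 e1 by (auto simp: dist_real_def)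
      moreover have "\<phi> x = b ^ n * (x - x0) - (h x - h x0)"
        using x0(3) by (simp add: \<phi>_def algebra_simps)
      moreover have "\<bar>b ^ n * (x - x0)\<bar> = b ^ n * \<bar>x - x0\<bar>" using p by (simp add: abs_mult)
      moreover have "L * \<bar>x - x0\<bar> \<le> b ^ n * L * \<bar>x - x0\<bar>"
        using p L mult_right_mono[of 1 "b ^ n" "L * \<bar>x - x0\<bar>"] by (simp add: mult.assoc)
      ultimately have "\<bar>\<phi> x\<bar> \<le> b ^ n * (1 + L) * \<bar>x - x0\<bar>" by (simp add: algebra_simps)
      also have "\<dots> \<le> b ^ n * (1 + L) * w" using x p L by (intro mult_left_mono) auto
      also have "\<dots> = (\<sigma> * (1 + L)) * \<psi>" using w(3) by (metis mult.commute mult.left_commute)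
      also have "\<dots> < 1 * \<psi>" using \<sigma> \<psi> by (intro mult_strict_right_mono) auto
      finally show ?thesis by simp
    qed
    show ?thesis
    \<comment> \<open>The interval extends from the zero towards the farther end of the cylinder, so
      that it fits.\<close>
    proof (cases "x0 \<le> a + l / 2")
      case True
      then show ?thesis using w x0 l by (intro exI[of _ x0] conjI ballI small) (auto simp: e_def)
    next
      case False
      then show ?thesis using w x0 x1 l by (intro exI[of _ "x0 - w"] conjI ballI small) (auto simp: e_def)
    qed
  next
    case False
    \<comment> \<open>On this interval, which stops \<open>w\<close> short of the right end, 1 minus
      the iterate is at most \<open>2 * \<sigma> * \<psi>\<close>, hence at most
      \<open>\<psi> / 2\<close>.\<close>
    have "\<bar>\<phi> x\<bar> < \<psi>" if x: "x \<in> {e - 2 * w..e - 2 * w + w}" for x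
    proof -
      have xe: "x \<in> {a..<e}" using x w l by (auto simp: e_def)
      then have "\<phi> x < 0" using False by (auto simp: not_le)
      moreover have "b ^ n * (x - a) - 1 \<le> \<phi> x" using hx[OF xe] by (simp add: \<phi>_def)
      moreover have "b ^ n * (x - a) - 1 = b ^ n * (x - e)" using l(2) by (simp add: e_def algebra_simps)
      moreover have "b ^ n * (- 2 * w) \<le> b ^ n * (x - e)" using x p by (intro mult_left_mono) auto
      moreover have "\<sigma> * \<psi> \<le> 1 / 4 * \<psi>" using \<sigma> \<psi> by (intro mult_right_mono) auto
      moreover have "b ^ n * (- 2 * w) = - 2 * (\<sigma> * \<psi>)" using w(3) by simp
      ultimately show ?thesis using \<psi> by linarith
    qed
    then show ?thesis using w l by (intro exI[of _ "e - 2 * w"]) (auto simp: e_def)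
  qed
  then obtain z where z: "a \<le> z" "z + w < e" "\<And>x. x \<in> {z..z + w} \<Longrightarrow> \<bar>\<phi> x\<bar> < \<psi>" by blast
  show ?thesis
  proof (rule that[of z])
    show "z + \<sigma> * (\<psi> / b ^ n) < a + 1 / b ^ n" using z(2) by (simp add: w_def e_def l_def)
    fix x assume "x \<in> {z..z + \<sigma> * (\<psi> / b ^ n)}"
    then have x: "x \<in> {z..z + w}" by (simp add: w_def)
    then have "x \<in> {a..<e}" using z by auto
    then show "\<bar>(beta_map b ^^ n) x - h x\<bar> < \<psi>" using z(3)[OF x] \<phi> by simp
  qed (rule z(1))
qed

end

section \<open>Limsup sets of ubiquitous systems\<close>

lemma ennreal_le_suminf: "f i \<le> (\<Sum>i. f i)" for f :: "nat \<Rightarrow> ennreal"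
  using sum_le_suminf[of f "{i}"] by (simp add: summableI)

text \<open>Only the geometry of the full cylinders survives here. \<open>D\<close> is so large
  against \<open>c\<close> that the boundary losses from all coarser levels together are at most a
  quarter of \<open>c\<close>; \<open>r_len\<close> keeps each weight small against its cylinder;
  \<open>r_\<sigma>\<close> lets the weight dominate the length of the piece.\<close>

locale ubiquitous_system =
  fixes len :: "nat \<Rightarrow> real" and F :: "nat \<Rightarrow> real set" and r :: "nat \<Rightarrow> real"
    and E :: "nat \<Rightarrow> real set" and g :: "real \<Rightarrow> real" and D c \<sigma> :: real
  assumes len_pos: "0 < len l" and len_Suc: "len (Suc l) = len l / D"
    and D: "1 < D" "2 / (D - 1) \<le> c / 4" and c: "0 < c" "c \<le> 1" and \<sigma>: "0 < \<sigma>" "\<sigma> \<le> 1"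
    and F_disjoint: "a \<in> F l \<Longrightarrow> a' \<in> F l \<Longrightarrow> a \<noteq> a' \<Longrightarrow> {a..<a + len l} \<inter> {a'..<a' + len l} = {}"
    and F_finite: "finite (F l)"
    and F_dense: "0 \<le> u \<Longrightarrow> u < v \<Longrightarrow> v \<le> 1 \<Longrightarrow>
      \<exists>l0. \<forall>l\<ge>l0. c * (v - u) \<le> len l * real (card {a \<in> F l. u \<le> a \<and> a + len l \<le> v})"
    and g_pos: "0 < x \<Longrightarrow> 0 < g x" and g_mono: "0 < x \<Longrightarrow> x \<le> y \<Longrightarrow> g x \<le> g y"
    and g_ratio: "0 < x \<Longrightarrow> x \<le> y \<Longrightarrow> g y / y \<le> g x / x"
    and r_pos: "0 < r l" and r_len: "g (r l) \<le> c / 8 * len l" and r_\<sigma>: "\<sigma> * r l \<le> g (r l)"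
    and diverges: "\<not> summable (\<lambda>l. g (r l) / len l)"
    and target: "a \<in> F l \<Longrightarrow> \<exists>z. a \<le> z \<and> z + \<sigma> * r l \<le> a + len l \<and> {z..z + \<sigma> * r l} \<subseteq> E l"
begin

definition core :: "nat \<times> real \<Rightarrow> real" where
  "core j = (SOME z. snd j \<le> z \<and> z + \<sigma> * r (fst j) \<le> snd j + len (fst j)
     \<and> {z..z + \<sigma> * r (fst j)} \<subseteq> E (fst j))"

definition weight :: "nat \<times> real \<Rightarrow> real" where "weight j = g (r (fst j))"

text \<open>The left end of an interval of length \<open>weight j\<close> that ends with the core,
  unless it would leave the cylinder on the left; then it starts with the cylinder.\<close>

definition halo :: "nat \<times> real \<Rightarrow> real" where
  "halo j = max (snd j) (core j + \<sigma> * r (fst j) - weight j)"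

lemma core:
  assumes "snd j \<in> F (fst j)"
  shows "snd j \<le> core j" "core j + \<sigma> * r (fst j) \<le> snd j + len (fst j)"
    "{core j..core j + \<sigma> * r (fst j)} \<subseteq> E (fst j)"
  using someI_ex[OF target[OF assms]] unfolding core_def by auto

lemma weight_pos: "0 < weight j"
  by (simp add: weight_def g_pos r_pos)

lemma weight_le_len: "weight j \<le> len (fst j)"
proof -
  have "weight j \<le> c / 8 * len (fst j)" unfolding weight_def by (rule r_len)
  also have "\<dots> \<le> 1 * len (fst j)" using c len_pos[of "fst j"] by (intro mult_right_mono) auto
  finally show ?thesis by simp
qed

lemma halo:
  assumes "snd j \<in> F (fst j)"
  shows "snd j \<le> halo j" "halo j + weight j \<le> snd j + len (fst j)"
    "halo j \<le> core j" "core j + \<sigma> * r (fst j) \<le> halo j + weight j"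
  using core[OF assms] weight_le_len[of j] weight_pos[of j] r_\<sigma>[of "fst j"]
  by (auto simp: halo_def weight_def)

lemma sum_inverse_len: "(\<Sum>k<n. 1 / len k) \<le> 1 / (len n * (D - 1))"
proof (induction n)
  case 0
  then show ?case using len_pos D by (simp add: less_imp_le)
next
  case (Suc n)
  have "(\<Sum>k<Suc n. 1 / len k) \<le> 1 / (len n * (D - 1)) + 1 / len n" using Suc by simp
  also have "\<dots> = D / (len n * (D - 1))"
    using len_pos[of n] D by (simp add: divide_simps)
  also have "\<dots> = 1 / (len (Suc n) * (D - 1))"
    using D by (simp add: len_Suc)
  finally show ?case .
qed

lemma len_eq: "len l = len 0 / D ^ l"
  by (induction l) (auto simp: len_Suc)

lemma len_small:
  assumes "0 < \<eta>" obtains N where "\<And>l. N \<le> l \<Longrightarrow> len l < \<eta>"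
proof -
  obtain N where N: "len 0 / \<eta> < D ^ N" using real_arch_pow[OF D(1)] by blast
  have "len l < \<eta>" if "N \<le> l" for l
  proof -
    have "D ^ N \<le> D ^ l" using D that by (intro power_increasing) auto
    then have "len 0 / \<eta> < D ^ l" using N by simp
    then show ?thesis using assms D by (subst len_eq) (simp add: field_simps)
  qed
  then show ?thesis using that by blast
qed

definition cyls_in :: "real \<Rightarrow> real \<Rightarrow> nat \<Rightarrow> real set" where
  "cyls_in u v l = {a \<in> F l. u \<le> a \<and> a + len l \<le> v}"

lemma card_packed:
  assumes "G \<subseteq> F l" "u \<le> v" "\<And>a. a \<in> G \<Longrightarrow> u \<le> a \<and> a + len l \<le> v"
  shows "real (card G) * len l \<le> v - u"
proof -
  have "(\<Sum>a\<in>G. len l) \<le> v - u"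
  proof (rule sum_lengths_le_of_disjoint[where p = "\<lambda>a. a"])
    show "finite G" using assms(1) F_finite finite_subset by blast
    show "disjoint_family_on (\<lambda>a. {a..<a + len l}) G"
      unfolding disjoint_family_on_def using F_disjoint assms(1) by blast
    show "\<And>j. j \<in> G \<Longrightarrow> {j..<j + len l} \<subseteq> {u..v}" using assms(3) by force
  qed (use len_pos assms in \<open>auto intro: less_imp_le\<close>)
  then show ?thesis by simp
qed

text \<open>The cylinders are chosen level by level, discarding those that meet the halo of a cylinder
  chosen before. Since consecutive lengths differ by the large factor \<open>D\<close> and the total weight is
  small, at least half of the cylinders survive at each level.\<close>

lemma greedy_selection:
  assumes uv: "0 \<le> u" "u < v" "v \<le> 1"
    and l0: "\<And>l. l0 \<le> l \<Longrightarrow> c * (v - u) \<le> len l * real (card (cyls_in u v l))"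
    and small: "(\<Sum>l\<in>{l0..<l0 + m}. g (r l) / len l) \<le> c / 4"
  shows "\<exists>S. S \<subseteq> (SIGMA l:{l0..<l0 + m}. cyls_in u v l) \<and>
    disjoint_family_on (\<lambda>j. {halo j..<halo j + weight j}) S \<and>
    c / 2 * (v - u) * (\<Sum>l\<in>{l0..<l0 + m}. g (r l) / len l) \<le> (\<Sum>j\<in>S. weight j)"
  using small
proof (induction m)
  case 0
  then show ?case by (intro exI[of _ "{}"]) (auto simp: disjoint_family_on_def)
next
  case (Suc m)
  define n where "n = l0 + m"
  define \<phi> where "\<phi> = (\<lambda>l. g (r l) / len l)"
  have \<phi>: "0 < \<phi> l" for l using g_pos r_pos len_pos by (simp add: \<phi>_def)
  have fin: "finite (cyls_in u v l)" for l using F_finite by (simp add: cyls_in_def)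
  have S': "{l0..<l0 + Suc m} = insert n {l0..<n}" "n \<notin> {l0..<n}" by (auto simp: n_def)
  have sum_n: "sum \<phi> {l0..<l0 + Suc m} = \<phi> n + sum \<phi> {l0..<n}" unfolding S' by (subst sum.insert) auto
  then have small_n: "sum \<phi> {l0..<n} \<le> c / 4" using Suc.prems \<phi>[of n] by (simp add: \<phi>_def)
  then obtain S where S: "S \<subseteq> (SIGMA l:{l0..<n}. cyls_in u v l)"
    "disjoint_family_on (\<lambda>j. {halo j..<halo j + weight j}) S"
    "c / 2 * (v - u) * sum \<phi> {l0..<n} \<le> sum weight S"
    using Suc.IH unfolding \<phi>_def n_def by auto
  have finS: "finite S" using S(1) fin finite_subset by (metis finite_SigmaI finite_atLeastLessThan)
  define R where "R j = {a \<in> cyls_in u v n. {a..<a + len n} \<inter> {halo j..<halo j + weight j} \<noteq> {}}" for j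
  define C where "C = cyls_in u v n - (\<Union>j\<in>S. R j)"
  \<comment> \<open>Cylinders of level \<open>n\<close> that meet a halo lie in the halo enlarged by
    \<open>len n\<close> on either side.\<close>
  have cardR: "real (card (R j)) * len n \<le> weight j + 2 * len n" for j
  proof -
    have "real (card (R j)) * len n \<le> (halo j + weight j + len n) - (halo j - len n)"
      by (rule card_packed) (use weight_pos[of j] len_pos[of n] in \<open>auto simp: R_def cyls_in_def\<close>)
    then show ?thesis by simp
  qed
  have cardin: "real (card (cyls_in u v l)) * len l \<le> v - u" for l
    by (rule card_packed) (use uv in \<open>auto simp: cyls_in_def\<close>)
  \<comment> \<open>The halos themselves remove at most the proportion c / 4 of the length, their
    boundaries at most \<open>2 / (D - 1)\<close>, which is again at most c / 4.\<close>
  have "real (card (\<Union>j\<in>S. R j)) * len n \<le> (\<Sum>j\<in>S. real (card (R j))) * len n"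
    using card_UN_le[OF finS, of R] len_pos[of n] by (intro mult_right_mono) (simp_all flip: of_nat_sum)
  also have "\<dots> \<le> (\<Sum>j\<in>S. weight j + 2 * len n)"
    unfolding sum_distrib_right by (intro sum_mono cardR)
  also have "\<dots> \<le> (\<Sum>j\<in>(SIGMA l:{l0..<n}. cyls_in u v l). weight j + 2 * len n)"
    using S(1) fin weight_pos len_pos by (intro sum_mono2) (auto intro!: less_imp_le[OF add_pos_pos])
  also have "\<dots> = (\<Sum>l\<in>{l0..<n}. \<Sum>a\<in>cyls_in u v l. g (r l) + 2 * len n)"
    using fin by (subst sum.Sigma) (auto simp: weight_def split_beta)
  also have "\<dots> = (\<Sum>l\<in>{l0..<n}. (real (card (cyls_in u v l)) * len l) * (\<phi> l + 2 * len n / len l))"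
  proof (intro sum.cong refl)
    fix l
    have "g (r l) + 2 * len n = len l * (\<phi> l + 2 * len n / len l)"
      using len_pos[of l] by (simp add: \<phi>_def field_simps)
    then show "(\<Sum>a\<in>cyls_in u v l. g (r l) + 2 * len n)
        = real (card (cyls_in u v l)) * len l * (\<phi> l + 2 * len n / len l)" by simp
  qed
  also have "\<dots> \<le> (\<Sum>l\<in>{l0..<n}. (v - u) * (\<phi> l + 2 * len n / len l))"
    using \<phi> len_pos
    by (intro sum_mono mult_right_mono cardin) (auto intro!: less_imp_le[OF add_pos_pos])
  also have "\<dots> = (v - u) * (sum \<phi> {l0..<n} + 2 * len n * (\<Sum>l\<in>{l0..<n}. 1 / len l))"
    by (simp add: sum_distrib_left sum.distrib distrib_left)
  also have "\<dots> \<le> (v - u) * (c / 4 + 2 * len n * (1 / (len n * (D - 1))))"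
  proof -
    have "(\<Sum>l\<in>{l0..<n}. 1 / len l) \<le> (\<Sum>l<n. 1 / len l)"
      using len_pos by (intro sum_mono2) (auto intro: less_imp_le)
    then have "(\<Sum>l\<in>{l0..<n}. 1 / len l) \<le> 1 / (len n * (D - 1))" using sum_inverse_len[of n] by linarith
    then show ?thesis using small_n uv len_pos[of n] by (intro mult_left_mono add_mono) auto
  qed
  also have "\<dots> = (v - u) * (c / 4 + 2 / (D - 1))" using len_pos[of n] by simp
  also have "\<dots> \<le> (v - u) * (c / 2)" using D uv by (intro mult_left_mono) auto
  finally have removed: "real (card (\<Union>j\<in>S. R j)) * len n \<le> (v - u) * (c / 2)" .
  have "card (cyls_in u v n) - card (\<Union>j\<in>S. R j) \<le> card C"
    unfolding C_def using finS fin by (intro diff_card_le_card_Diff finite_UN_I) (auto simp: R_def)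
  then have "real (card (cyls_in u v n)) \<le> real (card C) + real (card (\<Union>j\<in>S. R j))" by linarith
  then have "real (card (cyls_in u v n)) * len n \<le> (real (card C) + real (card (\<Union>j\<in>S. R j))) * len n"
    using len_pos[of n] by (intro mult_right_mono) auto
  moreover have "c * (v - u) \<le> real (card (cyls_in u v n)) * len n"
    using l0[of n] by (simp add: n_def mult.commute)
  ultimately have cardC: "c / 2 * (v - u) \<le> real (card C) * len n"
    using removed by (simp add: algebra_simps)
  have CF: "C \<subseteq> F n" by (auto simp: C_def cyls_in_def)
  have haloC: "{halo (n, a)..<halo (n, a) + weight (n, a)} \<subseteq> {a..<a + len n}" if "a \<in> C" for a
    using halo[of "(n, a)"] that CF by auto
  let ?S = "S \<union> Pair n ` C"
  show ?case
  proof (intro exI[of _ ?S] conjI)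
    show "?S \<subseteq> (SIGMA l:{l0..<l0 + Suc m}. cyls_in u v l)"
      using S(1) unfolding S' by (auto simp: C_def)
    show "disjoint_family_on (\<lambda>j. {halo j..<halo j + weight j}) ?S"
      unfolding disjoint_family_on_def
    proof (intro ballI impI)
      fix j j' assume j: "j \<in> ?S" "j' \<in> ?S" "j \<noteq> j'"
      have mixed: "{halo i..<halo i + weight i} \<inter> {halo (n, a)..<halo (n, a) + weight (n, a)} = {}"
        if "i \<in> S" "a \<in> C" for i a
      proof -
        have "a \<notin> R i" using that by (auto simp: C_def)
        moreover have "a \<in> cyls_in u v n" using that by (auto simp: C_def)
        ultimately have "{a..<a + len n} \<inter> {halo i..<halo i + weight i} = {}" by (auto simp: R_def)
        then show ?thesis using haloC[OF that(2)] by blast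
      qed
      consider "j \<in> S" "j' \<in> S" | a where "j \<in> S" "j' = (n, a)" "a \<in> C"
        | a where "j' \<in> S" "j = (n, a)" "a \<in> C" | a a' where "j = (n, a)" "j' = (n, a')" "a \<in> C" "a' \<in> C"
        using j by blast
      then show "{halo j..<halo j + weight j} \<inter> {halo j'..<halo j' + weight j'} = {}"
      proof cases
        case 1
        then show ?thesis using S(2) j(3) unfolding disjoint_family_on_def by blast
      next
        case 2
        then show ?thesis using mixed by blast
      next
        case 3
        then show ?thesis using mixed by blast
      next
        case 4
        then have "{a..<a + len n} \<inter> {a'..<a' + len n} = {}" using j(3) CF by (intro F_disjoint) auto
        then show ?thesis using haloC 4 by blast
      qed
    qed
    have "sum weight ?S = sum weight S + sum weight (Pair n ` C)"
    proof (rule sum.union_disjoint)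
      show "S \<inter> Pair n ` C = {}" using S(1) by auto
      show "finite (Pair n ` C)" using CF F_finite finite_subset by blast
    qed (rule finS)
    also have "sum weight (Pair n ` C) = real (card C) * len n * \<phi> n"
      using len_pos[of n] by (subst sum.reindex) (auto simp: inj_on_def weight_def \<phi>_def)
    also have "sum weight S + \<dots> \<ge> c / 2 * (v - u) * sum \<phi> {l0..<n} + c / 2 * (v - u) * \<phi> n"
      using S(3) cardC \<phi>[of n] by (intro add_mono mult_right_mono) auto
    finally show "c / 2 * (v - u) * (\<Sum>l\<in>{l0..<l0 + Suc m}. g (r l) / len l) \<le> sum weight ?S"
      using sum_n unfolding \<phi>_def by (simp add: distrib_left)
  qed
qed

text \<open>The levels stop as soon as the partial sum exceeds c / 8. Every term is at most c / 8,
  so the sum is then at most c / 4, as the greedy choice requires; c / 2 times c / 8 is the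
  proportion obtained.\<close>

lemma selection:
  assumes uv: "0 \<le> u" "u < v" "v \<le> 1"
  obtains S where "finite S"
    "\<And>l a. (l, a) \<in> S \<Longrightarrow> N \<le> l \<and> a \<in> F l \<and> u \<le> a \<and> a + len l \<le> v"
    "disjoint_family_on (\<lambda>j. {halo j..<halo j + weight j}) S"
    "c\<^sup>2 / 16 * (v - u) \<le> (\<Sum>j\<in>S. weight j)"
proof -
  define \<phi> where "\<phi> = (\<lambda>l. g (r l) / len l)"
  have \<phi>: "0 < \<phi> l" "\<phi> l \<le> c / 8" for l
    using g_pos r_pos len_pos[of l] r_len[of l] by (auto simp: \<phi>_def field_simps)
  obtain l1 where l1: "\<And>l. l1 \<le> l \<Longrightarrow> c * (v - u) \<le> len l * real (card (cyls_in u v l))"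
    using F_dense[OF uv] unfolding cyls_in_def by blast
  define l0 where "l0 = max N l1"
  have "\<not> summable (\<lambda>l. \<phi> (l + l0))" using diverges unfolding \<phi>_def by (subst summable_iff_shift)
  then have "\<not> (\<forall>m. (\<Sum>l<m. \<phi> (l + l0)) \<le> c / 8)"
    using summableI_nonneg_bounded[of "\<lambda>l. \<phi> (l + l0)" "c / 8"] \<phi> by (auto intro: less_imp_le)
  moreover have shift: "(\<Sum>l<m. \<phi> (l + l0)) = sum \<phi> {l0..<l0 + m}" for m
    using sum.shift_bounds_nat_ivl[of \<phi> 0 l0 m] by (simp add: atLeast0LessThan add.commute)
  ultimately have ex: "\<exists>m. sum \<phi> {l0..<l0 + m} > c / 8" by (auto simp: not_le)
  define m where "m = (LEAST m. sum \<phi> {l0..<l0 + m} > c / 8)"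
  have m: "sum \<phi> {l0..<l0 + m} > c / 8" unfolding m_def using ex by (rule LeastI_ex)
  then obtain k where k: "m = Suc k" using c by (cases m) auto
  have "sum \<phi> {l0..<l0 + k} \<le> c / 8"
    using not_less_Least[of k "\<lambda>m. sum \<phi> {l0..<l0 + m} > c / 8"] k by (simp add: m_def not_less)
  then have le: "sum \<phi> {l0..<l0 + m} \<le> c / 4" using \<phi>(2)[of "l0 + k"] by (simp add: k)
  obtain S where S: "S \<subseteq> (SIGMA l:{l0..<l0 + m}. cyls_in u v l)"
    "disjoint_family_on (\<lambda>j. {halo j..<halo j + weight j}) S"
    "c / 2 * (v - u) * sum \<phi> {l0..<l0 + m} \<le> sum weight S"
    using greedy_selection[OF uv, of l0 m] l1 le unfolding \<phi>_def l0_def by auto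
  have "c\<^sup>2 / 16 * (v - u) = c / 2 * (v - u) * (c / 8)" by (simp add: power2_eq_square)
  also have "\<dots> \<le> c / 2 * (v - u) * sum \<phi> {l0..<l0 + m}"
    using m c uv by (intro mult_left_mono) auto
  finally have "c\<^sup>2 / 16 * (v - u) \<le> sum weight S" using S(3) by linarith
  moreover have "finite (SIGMA l:{l0..<l0 + m}. cyls_in u v l)" using F_finite by (auto simp: cyls_in_def)
  then have "finite S" using S(1) finite_subset by blast
  moreover have "N \<le> l \<and> a \<in> F l \<and> u \<le> a \<and> a + len l \<le> v" if "(l, a) \<in> S" for l a
  proof -
    have "l0 \<le> l" "a \<in> cyls_in u v l" using S(1) that by auto
    then show ?thesis by (simp add: cyls_in_def l0_def)
  qed
  ultimately show ?thesis using that[of S] S(2) by metis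
qed

section \<open>Averaging over the selected intervals\<close>

text \<open>Each halo contains a subinterval of length \<open>min (weight j) (2 * s)\<close> that
  lies in the threefold enlargement of the ball, and these subintervals are disjoint. Truncation is
  necessary because a small ball may meet a long halo.\<close>

lemma sum_min_weight_le:
  assumes S: "finite S" "disjoint_family_on (\<lambda>j. {halo j..<halo j + weight j}) S"
    and "0 < s" and meet: "\<And>j. j \<in> S \<Longrightarrow> {halo j..halo j + weight j} \<inter> {x - s<..<x + s} \<noteq> {}"
  shows "(\<Sum>j\<in>S. min (weight j) (2 * s)) \<le> 3 * (2 * s)"
proof -
  have "\<forall>j\<in>S. \<exists>q. halo j \<le> q \<and> q + min (weight j) (2 * s) \<le> halo j + weight j \<and>
      x - 3 * s \<le> q \<and> q + min (weight j) (2 * s) \<le> x + 3 * s"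
  proof
    fix j assume "j \<in> S"
    then obtain y where "y \<in> {halo j..halo j + weight j}" "y \<in> {x - s<..<x + s}"
      using meet by blast
    then show "\<exists>q. halo j \<le> q \<and> q + min (weight j) (2 * s) \<le> halo j + weight j \<and>
      x - 3 * s \<le> q \<and> q + min (weight j) (2 * s) \<le> x + 3 * s"
      using assms(3) weight_pos[of j]
      by (intro exI[of _ "if weight j \<le> 2 * s then halo j else max (halo j) (y - 2 * s)"]) auto
  qed
  then obtain q where q: "\<And>j. j \<in> S \<Longrightarrow> halo j \<le> q j \<and> q j + min (weight j) (2 * s) \<le> halo j + weight j \<and>
      x - 3 * s \<le> q j \<and> q j + min (weight j) (2 * s) \<le> x + 3 * s" by metis
  have "(\<Sum>j\<in>S. min (weight j) (2 * s)) \<le> (x + 3 * s) - (x - 3 * s)"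
  proof (rule sum_lengths_le_of_disjoint[where p = q])
    show "disjoint_family_on (\<lambda>j. {q j..<q j + min (weight j) (2 * s)}) S"
      unfolding disjoint_family_on_def
    proof (intro ballI impI)
      fix i j assume ij: "i \<in> S" "j \<in> S" "i \<noteq> j"
      have "{q k..<q k + min (weight k) (2 * s)} \<subseteq> {halo k..<halo k + weight k}" if "k \<in> S" for k
        using q[OF that] by auto
      then show "{q i..<q i + min (weight i) (2 * s)} \<inter> {q j..<q j + min (weight j) (2 * s)} = {}"
        using S(2) ij unfolding disjoint_family_on_def by blast
    qed
    show "{q j..<q j + min (weight j) (2 * s)} \<subseteq> {x - 3 * s..x + 3 * s}" if "j \<in> S" for j
      using q[OF that] by auto
    show "0 \<le> min (weight j) (2 * s)" for j using weight_pos[of j] assms(3) by simp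
  qed (use S assms(3) in auto)
  then show ?thesis by simp
qed

definition meets :: "real \<Rightarrow> real \<Rightarrow> real \<Rightarrow> real \<Rightarrow> bool" where
  "meets x s u v \<longleftrightarrow> {u..v} \<inter> {x - s<..<x + s} \<noteq> {}"

text \<open>One sixth of the proportion c^2 / 16 from \<open>selection\<close>: the factor 3 of
  \<open>sum_min_weight_le\<close> then uses up half of the total weight, which leaves room for the
  small balls.\<close>

definition \<epsilon> :: real where "\<epsilon> = c\<^sup>2 / 96"

lemma \<epsilon>: "0 < \<epsilon>" "\<epsilon> \<le> 1"
  using c power_le_one[of c 2] by (auto simp: \<epsilon>_def)

text \<open>All but a tail of the convergent series belongs to finitely many balls, and a small
  \<open>\<eta>\<close> excludes these.\<close>

lemma small_balls_negligible:
  assumes "\<And>i. 0 < s i" "(\<Sum>i. ennreal (g (2 * s i))) < \<infinity>" "0 < \<tau>"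
  obtains \<eta> where "0 < \<eta>" "(\<Sum>i. if 2 * s i \<le> \<eta> then ennreal (g (2 * s i)) else 0) \<le> ennreal \<tau>"
proof -
  have gp: "0 < g (2 * s i)" for i using assms(1) by (intro g_pos) auto
  have summable: "summable (\<lambda>i. g (2 * s i))"
    using assms(2) gp by (intro summable_suminf_not_top) (auto intro: less_imp_le)
  obtain m where m: "\<And>n. m \<le> n \<Longrightarrow> norm (\<Sum>i. g (2 * s (i + n))) < \<tau>"
    using suminf_exist_split[OF assms(3) summable] by blast
  define \<eta> where "\<eta> = Min (insert 1 (s ` {..<m}))"
  have \<eta>: "0 < \<eta>" using assms(1) by (auto simp: \<eta>_def)
  have big: "\<not> 2 * s i \<le> \<eta>" if "i < m" for i
  proof -
    have "\<eta> \<le> s i" unfolding \<eta>_def by (rule Min_le) (use that in auto)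
    then show ?thesis using assms(1)[of i] by linarith
  qed
  define f where "f i = (if 2 * s i \<le> \<eta> then g (2 * s i) else 0)" for i
  have f: "0 \<le> f i" "f i \<le> g (2 * s i)" for i using gp[of i] by (auto simp: f_def)
  have sf: "summable f" by (rule summable_comparison_test'[OF summable, of 0]) (use f in auto)
  have "(\<Sum>i. if 2 * s i \<le> \<eta> then ennreal (g (2 * s i)) else 0) = (\<Sum>i. ennreal (f i))"
    by (intro arg_cong[of _ _ suminf] ext) (auto simp: f_def)
  also have "\<dots> = ennreal (suminf f)" using f sf by (intro suminf_ennreal2) auto
  also have "suminf f = (\<Sum>i. f (i + m)) + sum f {..<m}" by (rule suminf_split_initial_segment[OF sf])
  also have "sum f {..<m} = 0" using big by (intro sum.neutral) (auto simp: f_def)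
  also have "(\<Sum>i. f (i + m)) + 0 \<le> (\<Sum>i. g (2 * s (i + m)))"
    using f summable_ignore_initial_segment[OF sf] summable_ignore_initial_segment[OF summable]
    by (simp add: suminf_le)
  also have "\<dots> \<le> \<tau>" using m[of m] by simp
  finally show ?thesis using that \<eta> by (auto intro: ennreal_leI)
qed

text \<open>Instead of constructing a measure on the limsup set, we average over the selected
  intervals: if each of them were crowded by balls, then summing the weights of the crowded
  intervals over the balls would exceed the total weight of the selection.\<close>

lemma uncrowded_interval:
  assumes uv: "0 \<le> u" "u < v" "v \<le> 1"
    and s: "\<And>i. 0 < s i" and g_sum: "(\<Sum>i. ennreal (g (2 * s i))) < \<infinity>"
    and crowd: "(\<Sum>i. if meets (x i) (s i) u v then ennreal (2 * s i) else 0) \<le> ennreal (\<epsilon> * (v - u))"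
  obtains l z w where "N \<le> l" "u \<le> z" "z < w" "w \<le> v" "w - z \<le> len l" "{z..w} \<subseteq> E l"
    "(\<Sum>i. if meets (x i) (s i) z w then ennreal (2 * s i) else 0) \<le> ennreal (\<epsilon> * (w - z))"
proof -
  define \<kappa> where "\<kappa> = c\<^sup>2 / 16 * (v - u)"
  have \<kappa>: "0 < \<kappa>" "\<kappa> = 6 * \<epsilon> * (v - u)" using c uv by (auto simp: \<kappa>_def \<epsilon>_def)
  define K where "K = 3 / (\<epsilon> * \<sigma>)"
  have K: "0 < K" using \<epsilon> \<sigma> by (simp add: K_def)
  obtain \<eta> where \<eta>: "0 < \<eta>"
    "(\<Sum>i. if 2 * s i \<le> \<eta> then ennreal (g (2 * s i)) else 0) \<le> ennreal (\<kappa> / (4 * K))"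
    using small_balls_negligible[OF s g_sum, of "\<kappa> / (4 * K)"] \<kappa> K by auto
  \<comment> \<open>Selected cylinders, hence weights, are below \<open>\<eta>\<close>. A ball no
    longer than the weight of an interval it hits is therefore among the small balls.\<close>
  obtain N' where N': "\<And>l. N' \<le> l \<Longrightarrow> len l < \<eta>" using len_small[OF \<eta>(1)] by blast
  obtain S where S: "finite S"
    "\<And>l a. (l, a) \<in> S \<Longrightarrow> max N N' \<le> l \<and> a \<in> F l \<and> u \<le> a \<and> a + len l \<le> v"
    "disjoint_family_on (\<lambda>j. {halo j..<halo j + weight j}) S"
    "\<kappa> \<le> (\<Sum>j\<in>S. weight j)"
    using selection[OF uv, of "max N N'"] unfolding \<kappa>_def by blast
  have SF: "snd j \<in> F (fst j)" "max N N' \<le> fst j" "u \<le> snd j" "snd j + len (fst j) \<le> v"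
    if "j \<in> S" for j using S(2)[of "fst j" "snd j"] that by auto
  define top_end where "top_end j = core j + \<sigma> * r (fst j)" for j
  define hit where "hit i j \<longleftrightarrow> meets (x i) (s i) (core j) (top_end j)" for i j
  define crowded where "crowded j \<longleftrightarrow> ennreal (\<epsilon> * (\<sigma> * r (fst j)))
      < (\<Sum>i. if hit i j then ennreal (2 * s i) else 0)" for j
  \<comment> \<open>The charge of interval \<open>j\<close> to ball \<open>i\<close>. A ball long
    enough to crowd the core alone takes the whole weight; a shorter one takes a share that, by
    \<open>g_ratio\<close>, is at least the weight times its length relative to the crowding
    threshold.\<close>
  define \<theta> where "\<theta> i j = (if hit i j then
      (if \<epsilon> * (\<sigma> * r (fst j)) < 2 * s i then weight j else g (2 * s i) / (\<epsilon> * \<sigma>)) else 0)" for i j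
  have gp: "0 < g (2 * s i)" for i using s by (intro g_pos) auto
  have \<theta>0: "0 \<le> \<theta> i j" for i j
    using weight_pos[of j] gp[of i] \<epsilon> \<sigma> by (auto simp: \<theta>_def intro: less_imp_le)
  have crowded_le: "ennreal (weight j) \<le> (\<Sum>i. ennreal (\<theta> i j))" if "crowded j" for j
  proof (cases "\<exists>i. hit i j \<and> \<epsilon> * (\<sigma> * r (fst j)) < 2 * s i")
    case True
    then obtain i where "hit i j" "\<epsilon> * (\<sigma> * r (fst j)) < 2 * s i" by blast
    then have "\<theta> i j = weight j" by (simp add: \<theta>_def)
    then show ?thesis using ennreal_le_suminf[of "\<lambda>i. ennreal (\<theta> i j)" i] by simp
  next
    case False
    define R where "R = \<epsilon> * (\<sigma> * r (fst j))"
    have R: "0 < R" using \<epsilon> \<sigma> r_pos by (simp add: R_def)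
    have "ennreal (weight j) = ennreal (weight j / R) * ennreal R"
      using R weight_pos[of j] by (simp flip: ennreal_mult)
    also have "\<dots> \<le> ennreal (weight j / R) * (\<Sum>i. if hit i j then ennreal (2 * s i) else 0)"
      using that unfolding crowded_def R_def by (intro mult_left_mono) (auto intro: less_imp_le)
    also have "\<dots> = (\<Sum>i. ennreal (weight j / R) * (if hit i j then ennreal (2 * s i) else 0))"
      by (rule ennreal_suminf_cmult[symmetric])
    also have "\<dots> \<le> (\<Sum>i. ennreal (\<theta> i j))"
    proof (intro suminf_le summableI)
      fix i
      show "ennreal (weight j / R) * (if hit i j then ennreal (2 * s i) else 0) \<le> ennreal (\<theta> i j)"
      proof (cases "hit i j")
        case True
        then have le: "2 * s i \<le> R" using False by (auto simp: R_def)
        have "R \<le> 1 * (1 * r (fst j))" unfolding R_def using \<epsilon> \<sigma> r_pos[of "fst j"]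
          by (intro mult_mono) auto
        then have "weight j / r (fst j) \<le> g (2 * s i) / (2 * s i)"
          unfolding weight_def using s le by (intro g_ratio) auto
        then have "weight j * (2 * s i) \<le> g (2 * s i) * r (fst j)"
          using s[of i] r_pos[of "fst j"] by (simp add: divide_simps mult.commute)
        then have "weight j / R * (2 * s i) \<le> g (2 * s i) / (\<epsilon> * \<sigma>)"
          using \<epsilon> \<sigma> r_pos[of "fst j"] by (simp add: R_def divide_simps mult.commute mult.left_commute)
        then have "ennreal (weight j / R * (2 * s i)) \<le> ennreal (\<theta> i j)"
          using True le by (intro ennreal_leI) (simp add: \<theta>_def R_def)
        moreover have "ennreal (weight j / R) * ennreal (2 * s i) = ennreal (weight j / R * (2 * s i))"
          using R weight_pos[of j] s[of i] by (intro ennreal_mult[symmetric]) (auto intro: less_imp_le)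
        ultimately show ?thesis using True by (simp only: if_True)
      qed simp
    qed
    finally show ?thesis .
  qed
  define bd where "bd i = (if meets (x i) (s i) u v then 3 * (2 * s i) else 0)
      + (if 2 * s i \<le> \<eta> then K * g (2 * s i) else 0)" for i
  have bound: "(\<Sum>j\<in>S. \<theta> i j) \<le> bd i" for i
  proof -
    define \<delta> where "\<delta> = 2 * s i"
    define J where "J = {j \<in> S. hit i j}"
    have \<delta>: "0 < \<delta>" using s by (simp add: \<delta>_def)
    have bd0: "0 \<le> bd i" using s[of i] gp[of i] K by (auto simp: bd_def)
    \<comment> \<open>Charges are compared with truncated weights: either the charge is the weight
      itself and the ball is at least as long, or the ball is at most as long as the weight, hence
      at most \<open>\<eta>\<close>, and the second summand times \<open>\<delta>\<close> pays for
      the charge.\<close>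
    define q where "q = 1 + (if \<delta> \<le> \<eta> then g \<delta> / (\<epsilon> * \<sigma> * \<delta>) else 0)"
    have q1: "1 \<le> q" using \<epsilon> \<sigma> \<delta> g_pos[OF \<delta>] by (simp add: q_def)
    have "(\<Sum>j\<in>S. \<theta> i j) = (\<Sum>j\<in>J. \<theta> i j)"
      unfolding J_def using S(1) by (intro sum.mono_neutral_right) (auto simp: \<theta>_def)
    also have "\<dots> \<le> (\<Sum>j\<in>J. q * min (weight j) \<delta>)"
    proof (rule sum_mono)
      fix j assume j: "j \<in> J"
      then have jS: "j \<in> S" "hit i j" by (auto simp: J_def)
      have w\<eta>: "weight j \<le> \<eta>" using weight_le_len[of j] N'[of "fst j"] SF(2)[OF jS(1)] by simp
      have r\<sigma>: "\<sigma> * r (fst j) \<le> weight j" unfolding weight_def by (rule r_\<sigma>)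
      show "\<theta> i j \<le> q * min (weight j) \<delta>"
      proof (cases "\<epsilon> * (\<sigma> * r (fst j)) < \<delta> \<and> weight j \<le> \<delta>")
        case True
        then have "\<theta> i j = weight j" "min (weight j) \<delta> = weight j" using jS by (auto simp: \<theta>_def \<delta>_def)
        then show ?thesis using q1 weight_pos[of j] by simp
      next
        case False
        have min: "\<delta> \<le> weight j"
        proof (cases "\<epsilon> * (\<sigma> * r (fst j)) < \<delta>")
          case True
          then show ?thesis using False by auto
        next
          case False
          moreover have "\<epsilon> * (\<sigma> * r (fst j)) \<le> 1 * (\<sigma> * r (fst j))"
            using \<epsilon> \<sigma> r_pos[of "fst j"] by (intro mult_right_mono) auto
          ultimately show ?thesis using r\<sigma> by simp
        qed
        \<comment> \<open>If the ball alone crowds the core, \<open>r (fst j)\<close> is below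
          \<open>\<delta> / (\<epsilon> * \<sigma>)\<close>, and by \<open>g_ratio\<close> the value
          of \<open>g\<close> at this multiple of \<open>\<delta>\<close> is at most the same
          multiple of \<open>g \<delta>\<close>.\<close>
        have "\<theta> i j \<le> g \<delta> / (\<epsilon> * \<sigma>)"
        proof (cases "\<epsilon> * (\<sigma> * r (fst j)) < \<delta>")
          case True
          have es: "0 < \<epsilon> * \<sigma>" "\<epsilon> * \<sigma> \<le> 1" using \<epsilon> \<sigma> by (auto intro: mult_le_one)
          have "weight j \<le> g (\<delta> / (\<epsilon> * \<sigma>))"
            unfolding weight_def using True r_pos es by (intro g_mono) (auto simp: field_simps)
          moreover have "g (\<delta> / (\<epsilon> * \<sigma>)) / (\<delta> / (\<epsilon> * \<sigma>)) \<le> g \<delta> / \<delta>"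
            using es \<delta> by (intro g_ratio) (auto simp: field_simps)
          then have "g (\<delta> / (\<epsilon> * \<sigma>)) \<le> g \<delta> / (\<epsilon> * \<sigma>)"
            using es \<delta> by (simp add: field_simps)
          ultimately show ?thesis using True jS by (simp add: \<theta>_def \<delta>_def)
        qed (use jS in \<open>simp add: \<theta>_def \<delta>_def\<close>)
        also have "\<dots> = g \<delta> / (\<epsilon> * \<sigma> * \<delta>) * \<delta>" using \<delta> by simp
        also have "\<dots> \<le> q * \<delta>" using min w\<eta> \<delta> by (intro mult_right_mono) (auto simp: q_def)
        finally show ?thesis using min by (simp add: min_def)
      qed
    qed
    also have "\<dots> = q * (\<Sum>j\<in>J. min (weight j) \<delta>)" by (simp add: sum_distrib_left)
    also have "\<dots> \<le> bd i"
    proof (cases "J = {}")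
      case False
      have "(\<Sum>j\<in>J. min (weight j) (2 * s i)) \<le> 3 * (2 * s i)"
      proof (rule sum_min_weight_le)
        show "finite J" using S(1) by (simp add: J_def)
        show "disjoint_family_on (\<lambda>j. {halo j..<halo j + weight j}) J"
          by (rule disjoint_family_on_mono[OF _ S(3)]) (auto simp: J_def)
        fix j assume "j \<in> J"
        then have j: "j \<in> S" "hit i j" by (auto simp: J_def)
        then have "{core j..top_end j} \<subseteq> {halo j..halo j + weight j}"
          using halo[OF SF(1)] unfolding top_end_def by auto
        then show "{halo j..halo j + weight j} \<inter> {x i - s i<..<x i + s i} \<noteq> {}"
          using j unfolding hit_def meets_def by blast
      qed (rule s)
      then have "q * (\<Sum>j\<in>J. min (weight j) \<delta>) \<le> q * (3 * \<delta>)"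
        using q1 unfolding \<delta>_def by (intro mult_left_mono) auto
      also have "\<dots> = 3 * \<delta> + (if \<delta> \<le> \<eta> then K * g \<delta> else 0)"
        using \<delta> by (simp add: q_def K_def field_simps)
      also have "meets (x i) (s i) u v"
      proof -
        obtain j where j: "j \<in> S" "hit i j" using False by (auto simp: J_def)
        then have "{core j..top_end j} \<subseteq> {u..v}"
          using core(1,2)[OF SF(1)[OF j(1)]] SF(3,4)[OF j(1)] unfolding top_end_def by auto
        then show ?thesis using j unfolding hit_def meets_def by blast
      qed
      then have "3 * \<delta> + (if \<delta> \<le> \<eta> then K * g \<delta> else 0) = bd i" by (simp add: bd_def \<delta>_def)
      finally show ?thesis .
    qed (use bd0 in simp)
    finally show ?thesis .
  qed
  \<comment> \<open>Otherwise the charges would pay for the whole weight \<open>\<kappa>\<close>,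
    but they sum to at most \<open>\<kappa> / 2\<close> from the crowding bound plus
    \<open>\<kappa> / 4\<close> from the small balls.\<close>
  have "\<exists>j\<in>S. \<not> crowded j"
  proof (rule ccontr)
    assume "\<not> (\<exists>j\<in>S. \<not> crowded j)"
    then have all: "crowded j" if "j \<in> S" for j using that by blast
    have "ennreal \<kappa> \<le> ennreal (\<Sum>j\<in>S. weight j)" using S(4) by (rule ennreal_leI)
    also have "\<dots> = (\<Sum>j\<in>S. ennreal (weight j))"
      using weight_pos by (intro sum_ennreal[symmetric]) (auto intro: less_imp_le)
    also have "\<dots> \<le> (\<Sum>j\<in>S. \<Sum>i. ennreal (\<theta> i j))" using all by (intro sum_mono crowded_le)
    also have "\<dots> = (\<Sum>i. \<Sum>j\<in>S. ennreal (\<theta> i j))" by (rule suminf_sum[symmetric]) (rule summableI)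
    also have "\<dots> = (\<Sum>i. ennreal (\<Sum>j\<in>S. \<theta> i j))" using \<theta>0 by (simp add: sum_ennreal)
    also have "\<dots> \<le> (\<Sum>i. ennreal 3 * (if meets (x i) (s i) u v then ennreal (2 * s i) else 0)
        + ennreal K * (if 2 * s i \<le> \<eta> then ennreal (g (2 * s i)) else 0))"
    proof (intro suminf_le summableI)
      fix i
      have "ennreal (\<Sum>j\<in>S. \<theta> i j) \<le> ennreal (bd i)" using bound by (rule ennreal_leI)
      also have "\<dots> = ennreal 3 * (if meets (x i) (s i) u v then ennreal (2 * s i) else 0)
        + ennreal K * (if 2 * s i \<le> \<eta> then ennreal (g (2 * s i)) else 0)"
        using s[of i] gp[of i] K unfolding bd_def
        by (subst ennreal_plus) (auto simp del: ennreal_numeral simp flip: ennreal_mult)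
      finally show "ennreal (\<Sum>j\<in>S. \<theta> i j) \<le> \<dots>" .
    qed
    also have "\<dots> = ennreal 3 * (\<Sum>i. if meets (x i) (s i) u v then ennreal (2 * s i) else 0)
        + ennreal K * (\<Sum>i. if 2 * s i \<le> \<eta> then ennreal (g (2 * s i)) else 0)"
      by (simp only: suminf_add[OF summableI summableI, symmetric] ennreal_suminf_cmult)
    also have "\<dots> \<le> ennreal 3 * ennreal (\<epsilon> * (v - u)) + ennreal K * ennreal (\<kappa> / (4 * K))"
      using crowd \<eta>(2) by (intro add_mono mult_left_mono) auto
    also have "\<dots> = ennreal (3 * (\<epsilon> * (v - u)) + K * (\<kappa> / (4 * K)))"
      using \<epsilon> uv K \<kappa> by (simp del: ennreal_numeral flip: ennreal_mult ennreal_plus)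
    also have "3 * (\<epsilon> * (v - u)) + K * (\<kappa> / (4 * K)) = \<kappa> / 2 + \<kappa> / 4" using K \<kappa>(2) by simp
    finally have "\<kappa> \<le> \<kappa> / 2 + \<kappa> / 4" using \<kappa> by (subst (asm) ennreal_le_iff) auto
    then show False using \<kappa>(1) by simp
  qed
  then obtain j where j: "j \<in> S" "\<not> crowded j" by blast
  show ?thesis
  proof (rule that[of "fst j" "core j" "top_end j"])
    have jF: "snd j \<in> F (fst j)" using SF j by blast
    show "N \<le> fst j" using SF(2)[OF j(1)] by simp
    show "u \<le> core j" using core(1)[OF jF] SF(3)[OF j(1)] by simp
    show "core j < top_end j" using \<sigma> r_pos by (simp add: top_end_def)
    show "top_end j \<le> v" using core(2)[OF jF] SF(4)[OF j(1)] by (simp add: top_end_def)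
    show "top_end j - core j \<le> len (fst j)" using core(1,2)[OF jF] by (simp add: top_end_def)
    show "{core j..top_end j} \<subseteq> E (fst j)" using core(3)[OF jF] by (simp add: top_end_def)
    show "(\<Sum>i. if meets (x i) (s i) (core j) (top_end j) then ennreal (2 * s i) else 0)
        \<le> ennreal (\<epsilon> * (top_end j - core j))"
      using j(2) unfolding crowded_def hit_def by (simp add: top_end_def not_less)
  qed
qed

text \<open>The crowding bound is passed on along nested intervals. A ball containing their common
  point would meet all of them, so its diameter would be at most \<open>\<epsilon>\<close> times
  lengths that tend to 0.\<close>

theorem cover_misses_limsup:
  assumes uv: "0 \<le> u" "u < v" "v \<le> 1"
    and s: "\<And>i. 0 < s i" and g_sum: "(\<Sum>i. ennreal (g (2 * s i))) < \<infinity>"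
    and sum: "(\<Sum>i. ennreal (2 * s i)) \<le> ennreal (c\<^sup>2 / 96 * (v - u))"
  obtains y where "y \<in> {u..v}" "infinite {l. y \<in> E l}" "\<And>i. y \<notin> {x i - s i<..<x i + s i}"
proof -
  define P where "P n = (\<lambda>(l, z, w). n \<le> l \<and> 0 \<le> z \<and> u \<le> z \<and> z < w \<and> w \<le> v \<and>
      (\<Sum>i. if meets (x i) (s i) z w then ennreal (2 * s i) else 0) \<le> ennreal (\<epsilon> * (w - z)))" for n :: nat
  define Q where "Q = (\<lambda>(l :: nat, z, w) (l', z', w'). z \<le> z' \<and> w' \<le> w \<and> w' - z' \<le> len l' \<and> {z'..w'} \<subseteq> E l')"
  have "\<exists>f. \<forall>n. P n (f n) \<and> Q (f n) (f (Suc n))"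
  proof (rule dependent_nat_choice)
    have "(\<Sum>i. if meets (x i) (s i) u v then ennreal (2 * s i) else 0) \<le> (\<Sum>i. ennreal (2 * s i))"
      by (intro suminf_le summableI) auto
    also have "\<dots> \<le> ennreal (\<epsilon> * (v - u))" using sum by (simp add: \<epsilon>_def)
    \<comment> \<open>The level 0 of the starting triple is a placeholder; inclusion in
      \<open>E\<close> is demanded of the later triples only.\<close>
    finally show "\<exists>t. P 0 t" using uv unfolding P_def by (intro exI[of _ "(0, u, v)"]) auto
  next
    fix t n assume "P n t"
    obtain l z w where t: "t = (l, z, w)" by (cases t) auto
    from \<open>P n t\<close> have p: "n \<le> l" "0 \<le> z" "u \<le> z" "z < w" "w \<le> v"
      "(\<Sum>i. if meets (x i) (s i) z w then ennreal (2 * s i) else 0) \<le> ennreal (\<epsilon> * (w - z))"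
      by (auto simp: P_def t)
    have w1: "w \<le> 1" using p uv by simp
    obtain l' z' w' where "Suc n \<le> l'" "z \<le> z'" "z' < w'" "w' \<le> w" "w' - z' \<le> len l'" "{z'..w'} \<subseteq> E l'"
      "(\<Sum>i. if meets (x i) (s i) z' w' then ennreal (2 * s i) else 0) \<le> ennreal (\<epsilon> * (w' - z'))"
      using uncrowded_interval[OF p(2,4) w1 s g_sum p(6), of "Suc n"] by blast
    then show "\<exists>t'. P (Suc n) t' \<and> Q t t'"
      using p unfolding P_def Q_def t by (intro exI[of _ "(l', z', w')"]) auto
  qed
  then obtain f where f: "\<And>n. P n (f n)" "\<And>n. Q (f n) (f (Suc n))" by blast
  define l z w where "l n = fst (f n)" and "z n = fst (snd (f n))" and "w n = snd (snd (f n))" for n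
  have fn: "f n = (l n, z n, w n)" for n by (simp add: l_def z_def w_def)
  have lzw: "n \<le> l n" "u \<le> z n" "z n < w n" "w n \<le> v"
    "(\<Sum>i. if meets (x i) (s i) (z n) (w n) then ennreal (2 * s i) else 0) \<le> ennreal (\<epsilon> * (w n - z n))" for n
    using f(1)[of n] unfolding fn P_def by auto
  have nest: "z n \<le> z (Suc n)" "w (Suc n) \<le> w n" "w (Suc n) - z (Suc n) \<le> len (l (Suc n))"
    "{z (Suc n)..w (Suc n)} \<subseteq> E (l (Suc n))" for n
    using f(2)[of n] unfolding fn Q_def by auto
  have "(\<Inter>n. {z n..w n}) \<noteq> {}"
  proof (rule compact_nest)
    show "compact {z n..w n}" "{z n..w n} \<noteq> {}" for n using lzw(3)[of n] by auto
    show "{z n..w n} \<subseteq> {z m..w m}" if "m \<le> n" for m n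
      using lift_Suc_mono_le[of z, OF nest(1) that] lift_Suc_antimono_le[of w, OF nest(2) that] by auto
  qed
  then obtain y where y: "\<And>n. y \<in> {z n..w n}" by blast
  show ?thesis
  proof (rule that)
    show "y \<in> {u..v}" using y[of 0] lzw(2,4)[of 0] by auto
    show "infinite {l. y \<in> E l}"
      unfolding infinite_nat_iff_unbounded_le
    proof
      fix m
      have "y \<in> E (l (Suc m))" using nest(4) y by blast
      moreover have "m \<le> l (Suc m)" using lzw(1)[of "Suc m"] by simp
      ultimately show "\<exists>n\<ge>m. n \<in> {l. y \<in> E l}" by blast
    qed
    fix i show "y \<notin> {x i - s i<..<x i + s i}"
    proof
      assume yi: "y \<in> {x i - s i<..<x i + s i}"
      obtain N where N: "\<And>k. N \<le> k \<Longrightarrow> len k < 2 * s i" using len_small[of "2 * s i"] s[of i] by auto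
      define n where "n = Suc N"
      have "meets (x i) (s i) (z n) (w n)" using y[of n] yi by (auto simp: meets_def)
      then have "ennreal (2 * s i) \<le> ennreal (\<epsilon> * (w n - z n))"
        using ennreal_le_suminf[of "\<lambda>i. if meets (x i) (s i) (z n) (w n) then ennreal (2 * s i) else 0" i]
          lzw(5)[of n] by simp
      then have "2 * s i \<le> \<epsilon> * (w n - z n)"
        using \<epsilon> lzw(3)[of n] by (subst (asm) ennreal_le_iff) auto
      also have "\<dots> \<le> 1 * (w n - z n)" using \<epsilon> lzw(3)[of n] by (intro mult_right_mono) auto
      also have "\<dots> \<le> len (l n)" using nest(3)[of N] by (simp add: n_def)
      also have "\<dots> < 2 * s i" using N lzw(1)[of n] by (simp add: n_def)
      finally show False by simp
    qed
  qed
qed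

end

section \<open>Shrinking targets on the line\<close>

text \<open>A truncated sequence that tends to 0 eventually agrees with the original one. This keeps
  the divergence when radii are cut down.\<close>

lemma not_summable_min:
  fixes f :: "nat \<Rightarrow> real"
  assumes "\<not> summable f" "\<kappa> > 0"
  shows "\<not> summable (\<lambda>n. min (f n) \<kappa>)"
proof
  assume s: "summable (\<lambda>n. min (f n) \<kappa>)"
  have "(\<lambda>n. min (f n) \<kappa>) \<longlonglongrightarrow> 0" using s by (rule summable_LIMSEQ_zero)
  then have "eventually (\<lambda>n. min (f n) \<kappa> < \<kappa>) sequentially" using assms(2) by (rule order_tendstoD)
  then have "eventually (\<lambda>n. min (f n) \<kappa> = f n) sequentially" by eventually_elim auto
  then have "summable (\<lambda>n. min (f n) \<kappa>) = summable f" by (rule summable_cong)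
  then show False using s assms(1) by simp
qed

text \<open>Restricting the orders to one residue class makes consecutive cylinder lengths differ by
  the factor \<open>b ^ q\<close>; some class keeps the divergence.\<close>

lemma not_summable_residue_class:
  fixes f :: "nat \<Rightarrow> real"
  assumes "\<not> summable f" "\<And>n. 0 \<le> f n" "0 < q"
  obtains i where "i < q" "\<not> summable (\<lambda>l. f (i + q * l))"
proof -
  have "\<exists>i<q. \<not> summable (\<lambda>l. f (i + q * l))"
  proof (rule ccontr)
    assume "\<not> ?thesis"
    then have s: "summable (\<lambda>l. f (i + q * l))" if "i < q" for i using that by blast
    have "summable f"
    proof (rule summableI_nonneg_bounded[where x = "\<Sum>i<q. \<Sum>m. f (i + q * m)"])
      fix N
      have "sum f {..<N} \<le> sum f {..<N * q}"
        using assms(2,3) by (intro sum_mono2) (auto intro: less_le_trans)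
      also have "\<dots> = (\<Sum>m<N. sum f {m * q..<m * q + q})" by (rule sum.nat_group[symmetric])
      also have "\<dots> = (\<Sum>m<N. \<Sum>i<q. f (i + q * m))"
      proof (rule sum.cong[OF refl])
        fix m show "sum f {m * q..<m * q + q} = (\<Sum>i<q. f (i + q * m))"
          using sum.shift_bounds_nat_ivl[of f 0 "m * q" q]
          by (simp add: atLeast0LessThan add.commute mult.commute)
      qed
      also have "\<dots> = (\<Sum>i<q. \<Sum>m<N. f (i + q * m))" by (rule sum.swap)
      also have "\<dots> \<le> (\<Sum>i<q. \<Sum>m. f (i + q * m))"
        using s assms(2) by (intro sum_mono sum_le_suminf) auto
      finally show "sum f {..<N} \<le> (\<Sum>i<q. \<Sum>m. f (i + q * m))" .
    qed (rule assms(2))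
    then show False using assms(1) by simp
  qed
  then show ?thesis using that by blast
qed

text \<open>By continuity a gauge value can be truncated by shrinking the radius, which only makes
  the target smaller.\<close>

lemma shrink_gauge_argument:
  fixes g :: "real \<Rightarrow> real"
  assumes "continuous_on {0..} g" "g 0 = 0" "\<And>x. 0 < x \<Longrightarrow> 0 < g x" "0 < r" "0 < t"
  obtains r' where "0 < r'" "r' \<le> r" "g r' = min (g r) t"
proof -
  have "continuous_on {0..r} g" using assms(1) by (rule continuous_on_subset) auto
  moreover have pos: "0 < min (g r) t" using assms(3-5) by simp
  ultimately obtain r' where r': "0 \<le> r'" "r' \<le> r" "g r' = min (g r) t"
    using IVT'[of g 0 "min (g r) t" r] assms(2,4) by (auto simp: less_imp_le)
  have "r' \<noteq> 0"
  proof
    assume "r' = 0"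
    then show False using r'(3) assms(2) pos by simp
  qed
  then show ?thesis using that[OF _ r'(2,3)] r'(1) by simp
qed

definition shrinking_targets :: "real \<Rightarrow> (nat \<Rightarrow> real) \<Rightarrow> (real \<Rightarrow> real) \<Rightarrow> real set" where
  "shrinking_targets b \<psi> h =
     {x \<in> {0..<1}. infinite {n. n \<ge> 1 \<and> \<bar>(beta_map b ^^ n) x - h x\<bar> < \<psi> n}}"

text \<open>The common interface of both divergence cases. The two sums do different work: a finite
  gauge cost makes balls of small size negligible, while the small total length starts the nested
  construction in \<open>{u..v}\<close>.\<close>

definition escapes_covers :: "(real \<Rightarrow> real) \<Rightarrow> real \<Rightarrow> real set \<Rightarrow> bool" where
  "escapes_covers g \<epsilon> T \<longleftrightarrow> (\<forall>u v x s. 0 \<le> u \<longrightarrow> u < v \<longrightarrow> v \<le> 1 \<longrightarrow> (\<forall>i. 0 < s i) \<longrightarrow>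
      (\<Sum>i. ennreal (g (2 * s i))) < \<infinity> \<longrightarrow> (\<Sum>i. ennreal (2 * s i)) \<le> ennreal (\<epsilon> * (v - u)) \<longrightarrow>
      (\<exists>y\<in>{u..v} \<inter> T. \<forall>i :: nat. y \<notin> {x i - s i<..<x i + s i}))"

lemma shrinking_targets_escape_covers:
  fixes b :: real
  assumes b: "1 < b" and \<psi>: "\<And>n. 1 \<le> n \<Longrightarrow> 0 < \<psi> n"
    and lip: "\<exists>L. L-lipschitz_on {0..<1} h" and h: "h \<in> {0..<1} \<rightarrow> {0..1}"
    and g: "continuous_on {0..} g" "g 0 = 0" "\<And>x. 0 < x \<Longrightarrow> 0 < g x"
      "\<And>x y. 0 < x \<Longrightarrow> x \<le> y \<Longrightarrow> g x \<le> g y" "\<And>x y. 0 < x \<Longrightarrow> x \<le> y \<Longrightarrow> g y / y \<le> g x / x"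
    and diverges: "\<not> summable (\<lambda>n. b ^ Suc n * g (\<psi> (Suc n) / b ^ Suc n))"
  shows "\<exists>\<epsilon>>0. \<epsilon> \<le> 1 \<and> escapes_covers g \<epsilon> (shrinking_targets b \<psi> h)"
proof -
  obtain L where L: "L-lipschitz_on {0..<1} h" using lip by blast
  have L0: "0 \<le> L" using L by (rule lipschitz_on_nonneg)
  obtain c0 where c0: "0 < c0"
    "\<And>u v. 0 \<le> u \<Longrightarrow> u < v \<Longrightarrow> v \<le> 1 \<Longrightarrow> \<exists>n0. \<forall>n\<ge>n0.
       c0 * (v - u) * b ^ n \<le> real (card {a. full_cylinder b n a \<and> u \<le> a \<and> a + 1 / b ^ n \<le> v})"
    by (rule card_full_cylinders_in_interval[OF b]) (rule that)
  define c where "c = min c0 1"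
  have c: "0 < c" "c \<le> 1" "c \<le> c0" using c0 by (auto simp: c_def)
  \<comment> \<open>The bound c / 8 is demanded by \<open>r_len\<close>; staying below
    \<open>g 1\<close> forces \<open>\<rho> n\<close> below the length of the cylinder.\<close>
  define \<kappa> where "\<kappa> = min (c / 8) (g 1 / 2)"
  have g1: "0 < g 1" using g(3) by simp
  have \<kappa>: "0 < \<kappa>" "\<kappa> \<le> c / 8" "\<kappa> < g 1" using c g1 by (auto simp: \<kappa>_def)
  have bn: "0 < b ^ n" "1 \<le> b ^ n" for n using b by auto
  have "\<exists>r. 0 < r \<and> r \<le> \<psi> n / b ^ n \<and> g r = min (g (\<psi> n / b ^ n)) (\<kappa> / b ^ n)" if "1 \<le> n" for n
    using shrink_gauge_argument[OF g(1-3), of "\<psi> n / b ^ n" "\<kappa> / b ^ n"] \<psi>[OF that] bn \<kappa> by fastforce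
  then obtain \<rho> where \<rho>: "\<And>n. 1 \<le> n \<Longrightarrow> 0 < \<rho> n" "\<And>n. 1 \<le> n \<Longrightarrow> \<rho> n \<le> \<psi> n / b ^ n"
    "\<And>n. 1 \<le> n \<Longrightarrow> g (\<rho> n) = min (g (\<psi> n / b ^ n)) (\<kappa> / b ^ n)" by metis
  have \<rho>_small: "\<rho> n < 1 / b ^ n" if "1 \<le> n" for n
  proof (rule ccontr)
    assume "\<not> \<rho> n < 1 / b ^ n"
    then have "g (1 / b ^ n) \<le> g (\<rho> n)" using bn by (intro g(4)) auto
    moreover have "g 1 / b ^ n \<le> g (1 / b ^ n)"
      using g(5)[of "1 / b ^ n" 1] bn[of n] by (simp add: field_simps)
    moreover have "\<kappa> / b ^ n < g 1 / b ^ n" using \<kappa> bn by (intro divide_strict_right_mono) auto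
    ultimately show False using \<rho>(3)[OF that] by simp
  qed
  \<comment> \<open>The first two bounds serve \<open>full_cylinder_target\<close>; the third gives
    \<open>\<sigma> * x \<le> g x\<close> for 0 < x <= 1, because g(x) / x is at least
    \<open>g 1\<close> there.\<close>
  define \<sigma> where "\<sigma> = min (1 / 4) (min (1 / (2 * (1 + L))) (g 1))"
  have \<sigma>: "0 < \<sigma>" "\<sigma> \<le> 1 / 4" "\<sigma> \<le> g 1" using L0 g1 by (auto simp: \<sigma>_def)
  have "\<sigma> * (1 + L) \<le> 1 / (2 * (1 + L)) * (1 + L)"
    using L0 by (intro mult_right_mono) (auto simp: \<sigma>_def)
  also have "\<dots> = 1 / 2" using L0 by (simp add: field_simps)
  finally have \<sigma>L: "\<sigma> * (1 + L) < 1" by simp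
  \<comment> \<open>With D = \<open>b ^ q\<close> this says 2 / (D - 1) < c / 4.\<close>
  obtain q where q: "1 + 8 / c < b ^ q" using real_arch_pow[OF b] by blast
  have q0: "0 < q" using q c by (cases q) auto
  define f where "f n = b ^ Suc n * g (\<rho> (Suc n))" for n
  have f_eq: "f n = min (b ^ Suc n * g (\<psi> (Suc n) / b ^ Suc n)) \<kappa>" for n
    using b by (simp add: f_def \<rho>(3) min_mult_distrib_left)
  have f0: "0 \<le> f n" for n using g(3)[OF \<rho>(1)[of "Suc n"]] b by (simp add: f_def)
  have "\<not> summable f" using not_summable_min[OF diverges \<kappa>(1)] unfolding f_eq .
  then obtain i where "i < q" and i: "\<not> summable (\<lambda>l. f (i + q * l))"
    by (rule not_summable_residue_class[OF _ f0 q0]) (rule that)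
  define N where "N l = Suc (i + q * l)" for l
  have N1: "1 \<le> N l" for l by (simp add: N_def)
  have Nl: "l \<le> N l" for l using q0 by (simp add: N_def le_SucI trans_le_add2)
  interpret ubiquitous_system "\<lambda>l. 1 / b ^ N l" "\<lambda>l. {a. full_cylinder b (N l) a}" "\<lambda>l. \<rho> (N l)"
    "\<lambda>l. {x \<in> {0..<1}. \<bar>(beta_map b ^^ N l) x - h x\<bar> < \<psi> (N l)}" g "b ^ q" c \<sigma>
  proof
    fix l
    show "0 < 1 / b ^ N l" using bn by simp
    show "1 / b ^ N (Suc l) = 1 / b ^ N l / b ^ q" by (simp add: N_def power_add)
    have "0 < 8 / c" using c by simp
    then show D1: "1 < b ^ q" using q by linarith
    have "8 < c * (b ^ q - 1)" using q c by (simp add: field_simps)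
    then show "2 / (b ^ q - 1) \<le> c / 4" using D1 by (simp add: pos_divide_le_eq)
    show "finite {a. full_cylinder b (N l) a}" using card_full_cylinders_le[OF b] by blast
    show "0 < \<rho> (N l)" using \<rho>(1) N1 by blast
    have "g (\<rho> (N l)) \<le> \<kappa> / b ^ N l" using \<rho>(3)[OF N1] by simp
    also have "\<dots> \<le> (c / 8) / b ^ N l" using \<kappa> b by (intro divide_right_mono) auto
    finally show "g (\<rho> (N l)) \<le> c / 8 * (1 / b ^ N l)" by simp
    have "1 / b ^ N l \<le> 1" using b by simp
    then have "\<rho> (N l) \<le> 1" using \<rho>_small[OF N1[of l]] by linarith
    then have "g 1 * \<rho> (N l) \<le> g (\<rho> (N l))"
      using g(5)[of "\<rho> (N l)" 1] \<rho>(1)[OF N1[of l]] by (simp add: field_simps)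
    moreover have "\<sigma> * \<rho> (N l) \<le> g 1 * \<rho> (N l)"
      using \<sigma> \<rho>(1)[OF N1[of l]] by (intro mult_right_mono) auto
    ultimately show "\<sigma> * \<rho> (N l) \<le> g (\<rho> (N l))" by linarith
    show "\<not> summable (\<lambda>l. g (\<rho> (N l)) / (1 / b ^ N l))"
      using i by (simp add: f_def N_def mult.commute)
  next
    fix a l a' assume "a \<in> {a. full_cylinder b (N l) a}" "a' \<in> {a. full_cylinder b (N l) a}" "a \<noteq> a'"
    then show "{a..<a + 1 / b ^ N l} \<inter> {a'..<a' + 1 / b ^ N l} = {}"
      using full_cylinder_separated[OF b] by blast
  next
    fix u v :: real assume uv: "0 \<le> u" "u < v" "v \<le> 1"
    obtain n0 where n0: "\<And>n. n0 \<le> n \<Longrightarrow>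
       c0 * (v - u) * b ^ n \<le> real (card {a. full_cylinder b n a \<and> u \<le> a \<and> a + 1 / b ^ n \<le> v})"
      using c0(2)[OF uv] by blast
    have "c * (v - u) \<le> 1 / b ^ N l * real (card {a \<in> {a. full_cylinder b (N l) a}. u \<le> a \<and> a + 1 / b ^ N l \<le> v})"
      if "n0 \<le> l" for l
    proof -
      have "c * (v - u) * b ^ N l \<le> c0 * (v - u) * b ^ N l"
        using c uv b by (intro mult_right_mono) auto
      also have "\<dots> \<le> real (card {a. full_cylinder b (N l) a \<and> u \<le> a \<and> a + 1 / b ^ N l \<le> v})"
        using n0[of "N l"] Nl[of l] that by linarith
      finally have "c * (v - u) \<le> real (card {a. full_cylinder b (N l) a \<and> u \<le> a \<and> a + 1 / b ^ N l \<le> v}) / b ^ N l"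
        using b by (subst pos_le_divide_eq) auto
      then show ?thesis by simp
    qed
    then show "\<exists>l0. \<forall>l\<ge>l0. c * (v - u)
        \<le> 1 / b ^ N l * real (card {a \<in> {a. full_cylinder b (N l) a}. u \<le> a \<and> a + 1 / b ^ N l \<le> v})"
      by blast
  next
    fix a l assume "a \<in> {a. full_cylinder b (N l) a}"
    then have full: "full_cylinder b (N l) a" by simp
    \<comment> \<open>The threshold that belongs to the shortened radius: at most 1, as the target
      lemma wants, and at most \<open>\<psi> (N l)\<close>, so that its target is inside the given
      one.\<close>
    define p where "p = \<rho> (N l) * b ^ N l"
    have p: "0 < p" "p \<le> 1" "p \<le> \<psi> (N l)" "p / b ^ N l = \<rho> (N l)"
      using \<rho>(1,2)[OF N1[of l]] \<rho>_small[OF N1[of l]] bn(1)[of "N l"] b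
      unfolding p_def by (simp_all add: pos_less_divide_eq pos_le_divide_eq del: zero_less_power_eq)
    obtain z where z: "a \<le> z" "z + \<sigma> * \<rho> (N l) < a + 1 / b ^ N l"
      "\<And>x. x \<in> {z..z + \<sigma> * \<rho> (N l)} \<Longrightarrow> \<bar>(beta_map b ^^ N l) x - h x\<bar> < p"
      using full_cylinder_target[OF b L h full p(1,2) \<sigma>(1,2) \<sigma>L] unfolding p(4) by blast
    have "{z..z + \<sigma> * \<rho> (N l)} \<subseteq> {0..<1}"
      using z(1,2) full by (auto simp: full_cylinder_def)
    then show "\<exists>z\<ge>a. z + \<sigma> * \<rho> (N l) \<le> a + 1 / b ^ N l \<and>
        {z..z + \<sigma> * \<rho> (N l)} \<subseteq> {x \<in> {0..<1}. \<bar>(beta_map b ^^ N l) x - h x\<bar> < \<psi> (N l)}"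
      using z p(3) by (intro exI[of _ z]) fastforce
  qed (use c \<sigma> g in auto)
  have "c\<^sup>2 \<le> 1" using c by (simp add: power_le_one)
  then have \<epsilon>: "0 < c\<^sup>2 / 96" "c\<^sup>2 / 96 \<le> 1" using c by auto
  show ?thesis
    unfolding escapes_covers_def
  proof (intro exI[of _ "c\<^sup>2 / 96"] conjI \<epsilon> allI impI)
    fix u v :: real and x s :: "nat \<Rightarrow> real"
    assume uv: "0 \<le> u" "u < v" "v \<le> 1" and s0: "\<forall>i. 0 < s i"
    assume sums:
      "(\<Sum>i. ennreal (g (2 * s i))) < \<infinity>" "(\<Sum>i. ennreal (2 * s i)) \<le> ennreal (c\<^sup>2 / 96 * (v - u))"
    obtain y where y: "y \<in> {u..v}" "\<And>i. y \<notin> {x i - s i<..<x i + s i}"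
      "infinite {l. y \<in> {x \<in> {0..<1}. \<bar>(beta_map b ^^ N l) x - h x\<bar> < \<psi> (N l)}}"
      by (rule cover_misses_limsup[OF uv s0[rule_format] sums, of x]) (rule that)
    have inj: "inj N" using q0 by (auto simp: inj_def N_def)
    have "infinite (N ` {l. y \<in> {x \<in> {0..<1}. \<bar>(beta_map b ^^ N l) x - h x\<bar> < \<psi> (N l)}})"
      using y(3) finite_imageD inj_on_subset[OF inj] by blast
    moreover have "N ` {l. y \<in> {x \<in> {0..<1}. \<bar>(beta_map b ^^ N l) x - h x\<bar> < \<psi> (N l)}}
        \<subseteq> {n. n \<ge> 1 \<and> \<bar>(beta_map b ^^ n) y - h y\<bar> < \<psi> n}" using N1 by auto
    ultimately have "infinite {n. n \<ge> 1 \<and> \<bar>(beta_map b ^^ n) y - h y\<bar> < \<psi> n}"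
      using finite_subset by blast
    moreover have "y \<in> {0..<1}" using y(3) not_finite_existsD by blast
    ultimately have "y \<in> shrinking_targets b \<psi> h" by (simp add: shrinking_targets_def)
    then show "\<exists>y\<in>{u..v} \<inter> shrinking_targets b \<psi> h. \<forall>i. y \<notin> {x i - s i<..<x i + s i}"
      using y(1,2) by blast
  qed
qed

section \<open>From the line to higher dimension\<close>

lemma vec_box_measure:
  fixes l u :: "real ^ 'n"
  assumes "\<And>j. l $ j \<le> u $ j"
  shows "emeasure lborel (cbox l u) = ennreal (\<Prod>j\<in>UNIV. u $ j - l $ j)"
proof -
  have "cbox l u \<noteq> {}" using assms by (simp add: interval_ne_empty_cart)
  then have "measure lborel (cbox l u) = (\<Prod>j\<in>UNIV. u $ j - l $ j)" by (rule content_cbox_cart)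
  moreover have "emeasure lborel (cbox l u) = ennreal (measure lborel (cbox l u))"
    using emeasure_lborel_cbox_finite[of l u] by (intro emeasure_eq_ennreal_measure) auto
  ultimately show ?thesis by simp
qed

text \<open>The lines in direction \<open>i0\<close> that meet a ball of radius r form a set of
  measure (2r)^(d-1). Hence the integral of the sliced costs for \<open>g\<close> is at most the
  total cost of the cover, and some line does no worse than the average.\<close>

lemma slice_of_cover:
  fixes c :: "nat \<Rightarrow> real ^ 'n" and r :: "nat \<Rightarrow> real"
  assumes r: "\<And>i. 0 < r i" and g: "\<And>x. 0 < x \<Longrightarrow> 0 < g x"
    and total: "(\<Sum>i. ennreal (g (2 * r i) * (2 * r i) ^ (CARD('n) - 1))) < of_nat M"
  shows "\<exists>y :: real ^ 'n. (\<forall>j. y $ j \<in> {0..<1}) \<and>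
    (\<Sum>i. if \<forall>j. j \<noteq> i0 \<longrightarrow> \<bar>y $ j - c i $ j\<bar> \<le> r i then ennreal (g (2 * r i)) else 0)
       \<le> of_nat M * 2 ^ CARD('n)"
proof -
  let ?d = "CARD('n)"
  \<comment> \<open>The coordinate \<open>i0\<close> gets unit length, so that the measure of the
    box is that of the cross-section.\<close>
  define Q where "Q i = cbox (\<chi> j. if j = i0 then 0 else c i $ j - r i) (\<chi> j. if j = i0 then 1 else c i $ j + r i)" for i
  \<comment> \<open>Half the unit cube keeps all coordinates below 1; its measure accounts for the
    factor \<open>2 ^ CARD('n)\<close>.\<close>
  define C where "C = cbox (0 :: real ^ 'n) (\<chi> j. 1 / 2)"
  define S where "S y = (\<Sum>i. ennreal (g (2 * r i)) * indicator (Q i) y)" for y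
  have eQ: "emeasure lborel (Q i) = ennreal ((2 * r i) ^ (?d - 1))" for i
  proof -
    have "emeasure lborel (Q i) = ennreal (\<Prod>j\<in>UNIV. (if j = i0 then 1 else 2 * r i))"
      unfolding Q_def using r[of i] by (subst vec_box_measure) (auto intro!: arg_cong[of _ _ ennreal] prod.cong)
    also have "(\<Prod>j\<in>UNIV. (if j = i0 then 1 else 2 * r i)) = (\<Prod>j\<in>UNIV - {i0}. 2 * r i)"
      by (subst prod.remove[of _ i0]) (auto intro!: prod.cong)
    finally show ?thesis by (simp add: card_Diff_singleton)
  qed
  have eC: "emeasure lborel C = ennreal ((1 / 2) ^ ?d)"
    unfolding C_def by (subst vec_box_measure) auto
  have "\<exists>y\<in>C. S y \<le> of_nat M * 2 ^ ?d"
  proof (rule ccontr)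
    assume "\<not> ?thesis"
    then have *: "of_nat M * 2 ^ ?d \<le> S y" if "y \<in> C" for y using that by (auto simp: not_le intro: less_imp_le)
    have "(of_nat M :: ennreal) = of_nat M * 2 ^ ?d * emeasure lborel C"
    proof -
      have "(2 :: ennreal) ^ ?d * ennreal ((1 / 2) ^ ?d) = ennreal (2 ^ ?d * (1 / 2) ^ ?d)"
        by (simp add: ennreal_mult flip: ennreal_power)
      also have "(2 :: real) ^ ?d * (1 / 2) ^ ?d = 1" by (simp flip: power_mult_distrib)
      finally show ?thesis by (simp add: eC mult.assoc)
    qed
    also have "\<dots> = (\<integral>\<^sup>+ y. of_nat M * 2 ^ ?d * indicator C y \<partial>lborel)"
      by (subst nn_integral_cmult_indicator) (auto simp: C_def)
    also have "\<dots> \<le> (\<integral>\<^sup>+ y. S y \<partial>lborel)"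
      by (rule nn_integral_mono) (use * in \<open>auto split: split_indicator\<close>)
    also have "\<dots> = (\<Sum>i. \<integral>\<^sup>+ y. ennreal (g (2 * r i)) * indicator (Q i) y \<partial>lborel)"
      unfolding S_def by (rule nn_integral_suminf) (auto simp: Q_def)
    also have "\<dots> = (\<Sum>i. ennreal (g (2 * r i) * (2 * r i) ^ (?d - 1)))"
    proof (intro arg_cong[of _ _ suminf] ext)
      fix i
      have "0 \<le> g (2 * r i)" "0 \<le> (2 * r i) ^ (?d - 1)" using r[of i] g[of "2 * r i"] by auto
      then show "(\<integral>\<^sup>+ y. ennreal (g (2 * r i)) * indicator (Q i) y \<partial>lborel)
          = ennreal (g (2 * r i) * (2 * r i) ^ (?d - 1))"
        by (subst nn_integral_cmult_indicator) (simp_all add: eQ ennreal_mult, simp add: Q_def)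
    qed
    finally show False using total by simp
  qed
  then obtain y where y: "y \<in> C" "S y \<le> of_nat M * 2 ^ ?d" by blast
  have y01: "y $ j \<in> {0..1 / 2}" for j using y(1) by (simp add: C_def mem_box_cart)
  show ?thesis
  proof (intro exI[of _ y] conjI allI)
    show "y $ j \<in> {0..<1}" for j using y01[of j] by auto
    have "(\<Sum>i. if \<forall>j. j \<noteq> i0 \<longrightarrow> \<bar>y $ j - c i $ j\<bar> \<le> r i then ennreal (g (2 * r i)) else 0) \<le> S y"
      unfolding S_def
    proof (intro suminf_le summableI)
      fix i
      have "y \<in> Q i" if "\<forall>j. j \<noteq> i0 \<longrightarrow> \<bar>y $ j - c i $ j\<bar> \<le> r i"
        unfolding Q_def mem_box_cart
      proof
        fix j show "(\<chi> j. if j = i0 then 0 else c i $ j - r i) $ j \<le> y $ j \<and>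
            y $ j \<le> (\<chi> j. if j = i0 then 1 else c i $ j + r i) $ j"
          using that[rule_format, of j] y01[of j] by (auto simp: abs_le_iff)
      qed
      then show "(if \<forall>j. j \<noteq> i0 \<longrightarrow> \<bar>y $ j - c i $ j\<bar> \<le> r i then ennreal (g (2 * r i)) else 0)
          \<le> ennreal (g (2 * r i)) * indicator (Q i) y" by auto
    qed
    then show "(\<Sum>i. if \<forall>j. j \<noteq> i0 \<longrightarrow> \<bar>y $ j - c i $ j\<bar> \<le> r i then ennreal (g (2 * r i)) else 0)
       \<le> of_nat M * 2 ^ ?d" using y(2) by (rule order_trans)
  qed
qed

text \<open>All factors are at most 1, so one small factor makes the product small.\<close>

lemma mem_W_mult_of_coordinate:
  fixes y :: "real ^ 'n"
  assumes "\<And>j. y $ j \<in> {0..<1}" "\<And>i. h i \<in> {0..<1} \<rightarrow> {0..1}"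
    and "y $ i0 \<in> shrinking_targets (\<beta> i0) \<psi> (h i0)" "\<And>i. 1 < \<beta> i"
  shows "y \<in> W_mult \<beta> \<psi> h"
proof -
  let ?u = "\<lambda>n i. \<bar>(beta_map (\<beta> i) ^^ n) (y $ i) - h i (y $ i)\<bar>"
  have le1: "?u n i \<le> 1" for n i
    using beta_iterate_bounds[OF assms(4) assms(1), of n i i] assms(1)[of i] assms(2)[of i] by (force simp: Pi_iff)
  have "{n. n \<ge> 1 \<and> ?u n i0 < \<psi> n} \<subseteq> {n. n \<ge> 1 \<and> (\<Prod>i\<in>UNIV. ?u n i) < \<psi> n}"
  proof (rule subsetI)
    fix n assume "n \<in> {n. n \<ge> 1 \<and> ?u n i0 < \<psi> n}"
    then have n: "1 \<le> n" "?u n i0 < \<psi> n" by auto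
    have "(\<Prod>i\<in>UNIV. ?u n i) = ?u n i0 * (\<Prod>i\<in>UNIV - {i0}. ?u n i)"
      by (rule prod.remove) auto
    also have "\<dots> \<le> ?u n i0 * 1" using le1 by (intro mult_left_mono prod_le_1) auto
    finally show "n \<in> {n. n \<ge> 1 \<and> (\<Prod>i\<in>UNIV. ?u n i) < \<psi> n}" using n by simp
  qed
  then have "infinite {n. n \<ge> 1 \<and> (\<Prod>i\<in>UNIV. ?u n i) < \<psi> n}"
    using assms(3) infinite_super unfolding shrinking_targets_def by blast
  then show ?thesis using assms(1) by (simp add: W_mult_def)
qed

section \<open>Divergence with infinite measure\<close>

text \<open>As g(r) / r tends to infinity at 0, small balls have total length at most a small
  multiple of their gauge cost. A cover of cost below \<open>M\<close> thus has a slice short enough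
  in total for \<open>escapes_covers\<close>, and the point missed on the line lifts to a missed
  point of the set.\<close>

lemma hausdorff_measure_W_mult_top:
  fixes f g :: "real \<Rightarrow> real" and \<beta> :: "'n::finite \<Rightarrow> real" and i0 :: 'n
  assumes f_eq: "\<And>x. 0 < x \<Longrightarrow> f x = g x * x ^ (CARD('n) - 1)"
    and \<beta>: "\<And>i. 1 < \<beta> i" and \<psi>: "\<And>n. 1 \<le> n \<Longrightarrow> 0 < \<psi> n"
    and lip: "\<And>i. \<exists>L. L-lipschitz_on {0..<1} (h i)" and h: "\<And>i. h i \<in> {0..<1} \<rightarrow> {0..1}"
    and g: "dimension_function g" "\<And>x y. 0 < x \<Longrightarrow> x \<le> y \<Longrightarrow> g y / y \<le> g x / x"
    and large: "\<And>K. 0 < K \<Longrightarrow> \<exists>e>0. \<forall>x. 0 < x \<longrightarrow> x < e \<longrightarrow> K * x \<le> g x"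
    and diverges: "\<not> summable (\<lambda>n. \<beta> i0 ^ Suc n * g (\<psi> (Suc n) / \<beta> i0 ^ Suc n))"
  shows "hausdorff_measure f (W_mult \<beta> \<psi> h) = top"
proof (rule hausdorff_measure_eq_top)
  fix M :: nat
  have gc: "continuous_on {0..} g" "g 0 = 0" "\<And>x. 0 < x \<Longrightarrow> 0 < g x"
    "\<And>x y. 0 < x \<Longrightarrow> x \<le> y \<Longrightarrow> g x \<le> g y"
    using g(1) by (auto simp: dimension_function_def mono_on_def)
  have "\<exists>\<epsilon>>0. \<epsilon> \<le> 1 \<and> escapes_covers g \<epsilon> (shrinking_targets (\<beta> i0) \<psi> (h i0))"
    by (rule shrinking_targets_escape_covers) (fact \<beta> \<psi> lip h gc g(2) diverges)+
  then obtain \<epsilon> where \<epsilon>: "0 < \<epsilon>"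
    and escape: "escapes_covers g \<epsilon> (shrinking_targets (\<beta> i0) \<psi> (h i0))" by blast
  note escape = escape[unfolded escapes_covers_def]
  define M' where "M' = real M * 2 ^ CARD('n)"
  have M': "0 \<le> M'" "of_nat M * 2 ^ CARD('n) = ennreal M'"
    by (auto simp: M'_def ennreal_mult ennreal_of_nat_eq_real_of_nat simp flip: ennreal_power)
  \<comment> \<open>Makes the total length on the slice at most \<open>\<epsilon> / 2\<close>; the
    other half is left to the fillers.\<close>
  define K where "K = 2 * (M' + 1) / \<epsilon>"
  have K: "0 < K" using M' \<epsilon> by (simp add: K_def add_nonneg_pos)
  obtain e where e: "e > 0" "\<And>x. 0 < x \<Longrightarrow> x < e \<Longrightarrow> K * x \<le> g x" using large[OF K] by blast
  have "of_nat M \<le> hausdorff_pre f \<eta> (W_mult \<beta> \<psi> h)" if \<eta>: "0 < \<eta>" "\<eta> < e" for \<eta>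
  proof (rule ccontr)
    assume "\<not> of_nat M \<le> hausdorff_pre f \<eta> (W_mult \<beta> \<psi> h)"
    then have "hausdorff_pre f \<eta> (W_mult \<beta> \<psi> h) < of_nat M" by simp
    then obtain B where B: "B \<in> ball_covers \<eta> (W_mult \<beta> \<psi> h)"
      "(\<Sum>i. ennreal (f (max_diameter (B i)))) < of_nat M"
      unfolding hausdorff_pre_def INF_less_iff by blast
    obtain c r where cr: "\<And>i. 0 < r i" "\<And>i. 2 * r i \<le> \<eta>"
      "W_mult \<beta> \<psi> h \<subseteq> (\<Union>i. max_ball (c i) (r i))" "\<And>i. max_diameter (B i) = 2 * r i"
      by (rule ball_coversE[OF B(1)]) (rule that)
    have fg: "f (2 * r i) = g (2 * r i) * (2 * r i) ^ (CARD('n) - 1)" for i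
      using cr(1)[of i] by (intro f_eq) simp
    have tot: "(\<Sum>i. ennreal (g (2 * r i) * (2 * r i) ^ (CARD('n) - 1))) < of_nat M"
      using B(2) by (simp add: cr(4) fg)
    have "\<exists>y :: real ^ 'n. (\<forall>j. y $ j \<in> {0..<1}) \<and>
      (\<Sum>i. if \<forall>j. j \<noteq> i0 \<longrightarrow> \<bar>y $ j - c i $ j\<bar> \<le> r i then ennreal (g (2 * r i)) else 0)
       \<le> of_nat M * 2 ^ CARD('n)"
      by (rule slice_of_cover) (fact cr(1) gc(3) tot)+
    then obtain y :: "real ^ 'n" where y: "\<And>j. y $ j \<in> {0..<1}"
      "(\<Sum>i. if \<forall>j. j \<noteq> i0 \<longrightarrow> \<bar>y $ j - c i $ j\<bar> \<le> r i then ennreal (g (2 * r i)) else 0)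
       \<le> of_nat M * 2 ^ CARD('n)" by blast
    define good where "good i \<longleftrightarrow> (\<forall>j. j \<noteq> i0 \<longrightarrow> \<bar>y $ j - c i $ j\<bar> \<le> r i)" for i
    \<comment> \<open>Fillers for the indices of balls that miss the slice, since every index needs
      a positive radius.\<close>
    have "\<exists>t. 0 < t \<and> 2 * t \<le> \<epsilon> / 2 * (1 / 2) ^ Suc i \<and> g (2 * t) < 1 * (1 / 2) ^ Suc i" for i
      using dimension_function_small[OF g(1), of "1 * (1 / 2) ^ Suc i" "\<epsilon> / 2 * (1 / 2) ^ Suc i"] \<epsilon> by fastforce
    then obtain t where t: "\<And>i. 0 < t i" "\<And>i. 2 * t i \<le> \<epsilon> / 2 * (1 / 2) ^ Suc i"
      "\<And>i. g (2 * t i) < 1 * (1 / 2) ^ Suc i" by metis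
    define s where "s i = (if good i then r i else t i)" for i
    have s: "0 < s i" for i using cr(1) t(1) by (simp add: s_def)
    define G where "G = (\<Sum>i. if good i then ennreal (g (2 * r i)) else 0)"
    have G: "G \<le> ennreal M'" using y(2) unfolding G_def good_def M'(2) .
    have "(\<Sum>i. ennreal (g (2 * s i))) \<le> (\<Sum>i. (if good i then ennreal (g (2 * r i)) else 0) + ennreal (1 * (1 / 2) ^ Suc i))"
    proof (intro suminf_le summableI)
      fix i show "ennreal (g (2 * s i)) \<le> (if good i then ennreal (g (2 * r i)) else 0) + ennreal (1 * (1 / 2) ^ Suc i)"
        using t(3)[of i] by (auto simp: s_def intro!: ennreal_leI)
    qed
    also have "\<dots> = G + ennreal 1"
      unfolding G_def
      by (simp only: suminf_add[OF summableI summableI, symmetric] suminf_half_powers_ennreal[OF zero_le_one])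
    also have "\<dots> < \<infinity>" using G by (auto simp: top_unique less_top[symmetric])
    finally have 1: "(\<Sum>i. ennreal (g (2 * s i))) < \<infinity>" .
    have "(\<Sum>i. ennreal (2 * s i)) \<le> (\<Sum>i. ennreal (1 / K) * (if good i then ennreal (g (2 * r i)) else 0)
        + ennreal (\<epsilon> / 2 * (1 / 2) ^ Suc i))"
    proof (intro suminf_le summableI)
      fix i
      have "2 * r i < e" using cr(2)[of i] \<eta> by linarith
      then have "K * (2 * r i) \<le> g (2 * r i)" using cr(1)[of i] by (intro e(2)) auto
      then have "2 * r i \<le> 1 / K * g (2 * r i)" using K by (simp add: field_simps)
      then have "ennreal (2 * r i) \<le> ennreal (1 / K) * ennreal (g (2 * r i))"
        using K cr(1)[of i] gc(3)[of "2 * r i"] by (subst ennreal_mult[symmetric]) (auto intro!: ennreal_leI)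
      moreover have "ennreal (2 * t i) \<le> ennreal (\<epsilon> / 2 * (1 / 2) ^ Suc i)" using t(2) by (rule ennreal_leI)
      ultimately show "ennreal (2 * s i) \<le> ennreal (1 / K) * (if good i then ennreal (g (2 * r i)) else 0)
        + ennreal (\<epsilon> / 2 * (1 / 2) ^ Suc i)"
        by (auto simp: s_def intro: add_increasing2 simp del: power_Suc)
    qed
    also have "\<dots> = ennreal (1 / K) * G + ennreal (\<epsilon> / 2)"
      unfolding G_def using \<epsilon>
      by (subst suminf_half_powers_ennreal[symmetric])
        (simp_all only: suminf_add[OF summableI summableI, symmetric] ennreal_suminf_cmult)
    also have "\<dots> \<le> ennreal (1 / K) * ennreal M' + ennreal (\<epsilon> / 2)"
      using G by (intro add_mono mult_left_mono) auto
    also have "\<dots> = ennreal (1 / K * M' + \<epsilon> / 2)"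
      using K M'(1) \<epsilon> by (simp flip: ennreal_mult ennreal_plus)
    also have "\<dots> \<le> ennreal (\<epsilon> * (1 - 0))"
    proof (rule ennreal_leI)
      have "1 / K * M' = \<epsilon> / 2 * (M' / (M' + 1))" using M'(1) \<epsilon> by (simp add: K_def)
      also have "\<dots> \<le> \<epsilon> / 2 * 1" using M'(1) \<epsilon> by (intro mult_left_mono) auto
      finally have le: "1 / K * M' \<le> \<epsilon> / 2 * 1" .
      have "a + \<epsilon> / 2 \<le> \<epsilon> * (1 - 0)" if "a \<le> \<epsilon> / 2 * 1" for a using that by simp
      from this[OF le] show "1 / K * M' + \<epsilon> / 2 \<le> \<epsilon> * (1 - 0)" .
    qed
    finally have 2: "(\<Sum>i. ennreal (2 * s i)) \<le> ennreal (\<epsilon> * (1 - 0))" .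
    have "\<exists>y\<in>{0..1} \<inter> shrinking_targets (\<beta> i0) \<psi> (h i0). \<forall>i. y \<notin> {c i $ i0 - s i<..<c i $ i0 + s i}"
      by (rule escape[rule_format]) (simp_all only: zero_less_one order_refl s 1 2)
    then obtain y0 where y0: "y0 \<in> shrinking_targets (\<beta> i0) \<psi> (h i0)"
      "\<And>i. y0 \<notin> {c i $ i0 - s i<..<c i $ i0 + s i}"
      by blast
    define p where "p = (\<chi> j. if j = i0 then y0 else y $ j)"
    have "p \<in> W_mult \<beta> \<psi> h"
      using y0(1) y(1) h \<beta> by (intro mem_W_mult_of_coordinate[of p h i0 \<beta> \<psi>]) (auto simp: p_def shrinking_targets_def)
    then obtain i where "p \<in> max_ball (c i) (r i)" using cr(3) by blast
    then have i: "\<bar>p $ j - c i $ j\<bar> < r i" for j by (simp add: mem_max_ball_iff)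
    have "good i" unfolding good_def
    proof (intro allI impI)
      fix j assume "j \<noteq> i0"
      then show "\<bar>y $ j - c i $ j\<bar> \<le> r i" using i[of j] by (simp add: p_def)
    qed
    then have "y0 \<in> {c i $ i0 - s i<..<c i $ i0 + s i}" using i[of i0] by (auto simp: p_def s_def)
    then show False using y0(2) by blast
  qed
  then show "\<exists>e>0. \<forall>\<eta>. 0 < \<eta> \<longrightarrow> \<eta> < e \<longrightarrow> of_nat M \<le> hausdorff_pre f \<eta> (W_mult \<beta> \<psi> h)"
    using e(1) by blast
qed

section \<open>Open covers and measurability on the line\<close>

text \<open>Outer regularity by nonoverlapping closed intervals, turned into a sequence of open
  ones: indices outside the enumeration get the degenerate interval at 0, and a summable slack opens
  every interval.\<close>

lemma outer_interval_cover:
  fixes S :: "real set"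
  assumes S: "S \<in> lmeasurable" "S \<subseteq> {0..1}" and e: "0 < e"
  shows "\<exists>x s :: nat \<Rightarrow> real. (\<forall>i. 0 < s i) \<and> S \<subseteq> (\<Union>i. {x i - s i<..<x i + s i}) \<and>
    (\<Sum>i. ennreal (2 * s i)) \<le> ennreal (measure lebesgue S + e)"
proof -
  obtain \<D> where \<D>: "countable \<D>" "\<And>K. K \<in> \<D> \<Longrightarrow> K \<subseteq> cbox 0 1 \<and> K \<noteq> {} \<and> (\<exists>c d. K = cbox c d)"
    "pairwise (\<lambda>A B. interior A \<inter> interior B = {}) \<D>" "S \<subseteq> \<Union>\<D>" "\<Union>\<D> \<in> lmeasurable"
    "measure lebesgue (\<Union>\<D>) \<le> measure lebesgue S + e / 2"
    using measurable_outer_intervals_bounded[of S 0 1 "e / 2"] S e by (metis box_real(2) half_gt_zero)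
  define J where "J = to_nat_on \<D> ` \<D>"
  define k where "k n = (if n \<in> J then from_nat_into \<D> n else {0..0})" for n
  have kD: "k n \<in> \<D>" if "n \<in> J" for n using that \<D>(1) by (auto simp: k_def J_def)
  have "\<exists>p q. p \<le> q \<and> k n = {p..q}" for n
  proof (cases "n \<in> J")
    case True
    then show ?thesis using \<D>(2)[OF kD[OF True]] by (metis atLeastatMost_empty_iff box_real(2))
  next
    case False
    then show ?thesis by (intro exI[of _ 0]) (auto simp: k_def)
  qed
  then obtain p q where pq: "\<And>n. p n \<le> q n" "\<And>n. k n = {p n..q n}" by metis
  have bound: "(\<Sum>n<N. q n - p n) \<le> measure lebesgue S + e / 2" for N
  proof -
    have "(\<Sum>n<N. q n - p n) = (\<Sum>n\<in>{..<N} \<inter> J. q n - p n)"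
    proof (rule sum.mono_neutral_right)
      show "\<forall>i\<in>{..<N} - {..<N} \<inter> J. q i - p i = 0"
      proof
        fix i assume "i \<in> {..<N} - {..<N} \<inter> J"
        then have "{p i..q i} = {0..0}" using pq(2)[of i] by (simp add: k_def)
        then show "q i - p i = 0" using pq(1)[of i] by (simp add: atLeastAtMost_singleton_iff)
      qed
    qed auto
    also have "\<dots> = (\<Sum>n\<in>{..<N} \<inter> J. measure lebesgue (k n))"
      by (rule sum.cong) (use pq in auto)
    also have "\<dots> = measure lebesgue (\<Union>(k ` ({..<N} \<inter> J)))"
    proof (rule measure_negligible_finite_Union_image[symmetric])
      show "pairwise (\<lambda>x y. negligible (k x \<inter> k y)) ({..<N} \<inter> J)"
        unfolding pairwise_def
      proof (intro ballI impI)
        fix m n assume mn: "m \<in> {..<N} \<inter> J" "n \<in> {..<N} \<inter> J" "m \<noteq> n"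
        then have "k m \<noteq> k n" using \<D>(1) by (auto simp: k_def J_def)
        then have "interior (k m) \<inter> interior (k n) = {}"
          using \<D>(3) kD mn unfolding pairwise_def by blast
        moreover have "convex (k m \<inter> k n)" by (auto simp: pq(2) intro: convex_Int)
        ultimately show "negligible (k m \<inter> k n)" by (simp add: negligible_convex_interior)
      qed
    qed (auto simp: pq(2))
    also have "\<dots> \<le> measure lebesgue (\<Union>\<D>)"
      using kD \<D>(5) by (intro measure_mono_fmeasurable) (auto simp: pq(2) intro!: sets.finite_UN)
    finally show ?thesis using \<D>(6) by simp
  qed
  define x where "x n = (p n + q n) / 2" for n
  define s where "s n = (q n - p n + e / 2 * (1 / 2) ^ Suc n) / 2" for n
  show ?thesis
  proof (rule exI[of _ x], rule exI[of _ s], intro conjI allI)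
    show "0 < s n" for n using pq(1)[of n] e by (simp add: s_def add_nonneg_pos)
    have sub: "k n \<subseteq> {x n - s n<..<x n + s n}" for n
    proof -
      define t where "t = e / 2 * (1 / 2) ^ Suc n"
      have "0 < t" using e by (simp add: t_def)
      then show ?thesis unfolding pq(2) x_def s_def t_def[symmetric] by (auto simp: field_simps)
    qed
    show "S \<subseteq> (\<Union>n. {x n - s n<..<x n + s n})"
    proof
      fix y assume "y \<in> S"
      then obtain K where K: "K \<in> \<D>" "y \<in> K" using \<D>(4) by blast
      then have "k (to_nat_on \<D> K) = K" using \<D>(1) by (simp add: k_def J_def)
      then show "y \<in> (\<Union>n. {x n - s n<..<x n + s n})" using sub K by blast
    qed
    have "(\<Sum>n. ennreal (2 * s n)) = (\<Sum>n. ennreal (q n - p n) + ennreal (e / 2 * (1 / 2) ^ Suc n))"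
    proof (intro arg_cong[of _ _ suminf] ext)
      fix n
      have "2 * s n = (q n - p n) + e / 2 * (1 / 2) ^ Suc n" by (simp add: s_def)
      moreover have "0 \<le> q n - p n" "0 \<le> e / 2 * (1 / 2) ^ Suc n" using pq(1)[of n] e by auto
      ultimately show "ennreal (2 * s n) = ennreal (q n - p n) + ennreal (e / 2 * (1 / 2) ^ Suc n)"
        by (simp only: ennreal_plus)
    qed
    also have "\<dots> = (\<Sum>n. ennreal (q n - p n)) + ennreal (e / 2)"
      using e by (subst suminf_half_powers_ennreal[symmetric])
        (simp_all only: suminf_add[OF summableI summableI, symmetric])
    also have "(\<Sum>n. ennreal (q n - p n)) \<le> ennreal (measure lebesgue S + e / 2)"
    proof (rule suminf_le_const[OF summableI])
      fix N
      have "(\<Sum>n<N. ennreal (q n - p n)) = ennreal (\<Sum>n<N. q n - p n)"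
        using pq(1) by (intro sum_ennreal) auto
      also have "\<dots> \<le> ennreal (measure lebesgue S + e / 2)" using bound by (rule ennreal_leI)
      finally show "(\<Sum>n<N. ennreal (q n - p n)) \<le> \<dots>" .
    qed
    also have "ennreal (measure lebesgue S + e / 2) + ennreal (e / 2) = ennreal (measure lebesgue S + e)"
      using e by (subst ennreal_plus[symmetric]) (auto intro: add_nonneg_nonneg)
    finally show "(\<Sum>n. ennreal (2 * s n)) \<le> ennreal (measure lebesgue S + e)" by (simp add: add_right_mono)
  qed
qed

lemma shrinking_targets_measurable:
  assumes "L-lipschitz_on {0..<1} h"
  shows "shrinking_targets b \<psi> h \<in> sets borel"
proof -
  \<comment> \<open>Extended by 0, the function is Borel on the whole line and agrees with
    \<open>h\<close> on [0,1).\<close>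
  define h' where "h' = (\<lambda>x. indicator {0..<1} x *\<^sub>R h x)"
  have [measurable]: "h' \<in> borel_measurable borel"
    unfolding h'_def using lipschitz_on_continuous_on[OF assms]
    by (intro borel_measurable_continuous_on_indicator) auto
  have T[measurable]: "beta_map b \<in> borel_measurable borel"
    unfolding beta_map_def[abs_def] frac_def by measurable
  have [measurable]: "(beta_map b ^^ n) \<in> borel_measurable borel" for n
    by (induction n) (auto intro: measurable_comp[OF _ T])
  have "shrinking_targets b \<psi> h
      = {0..<1} \<inter> (\<Inter>m. \<Union>n\<in>{max 1 m..}. {x. \<bar>(beta_map b ^^ n) x - h' x\<bar> < \<psi> n})"
  proof (rule set_eqI)
    fix x
    have "infinite {n. n \<ge> 1 \<and> \<bar>(beta_map b ^^ n) x - h x\<bar> < \<psi> n}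
        \<longleftrightarrow> (\<forall>m. \<exists>n\<in>{max 1 m..}. \<bar>(beta_map b ^^ n) x - h x\<bar> < \<psi> n)"
      unfolding infinite_nat_iff_unbounded_le by (simp add: Bex_def conj_ac)
    moreover have "h' x = h x" if "x \<in> {0..<1}" using that by (simp add: h'_def)
    ultimately show "x \<in> shrinking_targets b \<psi> h \<longleftrightarrow>
        x \<in> {0..<1} \<inter> (\<Inter>m. \<Union>n\<in>{max 1 m..}. {x. \<bar>(beta_map b ^^ n) x - h' x\<bar> < \<psi> n})"
      unfolding shrinking_targets_def by auto
  qed
  also have "\<dots> \<in> sets borel" by measurable
  finally show ?thesis .
qed

section \<open>Divergence with finite measure\<close>

text \<open>With \<open>g\<close> at most linear, a cover of finite length has finite gauge cost, so
  \<open>escapes_covers\<close> gives the target set measure at least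
  \<open>\<epsilon> * (v - u)\<close> in every interval. A complement of positive measure would then
  be too thin in each interval of an economical cover of itself.\<close>

lemma shrinking_targets_full_measure:
  fixes b :: real
  assumes b: "1 < b" and \<psi>: "\<And>n. 1 \<le> n \<Longrightarrow> 0 < \<psi> n"
    and lip: "\<exists>L. L-lipschitz_on {0..<1} h" and h: "h \<in> {0..<1} \<rightarrow> {0..1}"
    and g: "continuous_on {0..} g" "g 0 = 0" "\<And>x. 0 < x \<Longrightarrow> 0 < g x"
      "\<And>x y. 0 < x \<Longrightarrow> x \<le> y \<Longrightarrow> g x \<le> g y" "\<And>x y. 0 < x \<Longrightarrow> x \<le> y \<Longrightarrow> g y / y \<le> g x / x"
    and diverges: "\<not> summable (\<lambda>n. b ^ Suc n * g (\<psi> (Suc n) / b ^ Suc n))"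
    and C: "0 < C" "\<And>x. 0 < x \<Longrightarrow> g x \<le> C * x"
  shows "measure lebesgue ({0..1} - shrinking_targets b \<psi> h) = 0"
proof -
  define T where "T = shrinking_targets b \<psi> h"
  obtain L where L: "L-lipschitz_on {0..<1} h" using lip by blast
  have Tm: "T \<in> sets borel" unfolding T_def using L by (rule shrinking_targets_measurable)
  have T01: "T \<subseteq> {0..<1}" by (auto simp: T_def shrinking_targets_def)
  have Tl: "T \<inter> {u..v} \<in> lmeasurable" for u v :: real
    using Tm by (intro bounded_set_imp_lmeasurable) (auto intro: bounded_subset[OF bounded_closed_interval])
  define A where "A = {0..1} - T"
  have Al: "A \<in> lmeasurable"
    using Tm by (intro bounded_set_imp_lmeasurable) (auto simp: A_def intro: bounded_subset[OF bounded_closed_interval])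
  have "\<exists>\<epsilon>>0. \<epsilon> \<le> 1 \<and> escapes_covers g \<epsilon> T"
    unfolding T_def by (rule shrinking_targets_escape_covers) (fact b \<psi> lip h g diverges)+
  then obtain \<epsilon> where \<epsilon>: "0 < \<epsilon>" "\<epsilon> \<le> 1" and escape: "escapes_covers g \<epsilon> T" by blast
  note escape = escape[unfolded escapes_covers_def]
  have density: "\<epsilon> * (v - u) \<le> measure lebesgue (T \<inter> {u..v})" if uv: "0 \<le> u" "u < v" "v \<le> 1" for u v
  proof (rule ccontr)
    define m where "m = measure lebesgue (T \<inter> {u..v})"
    assume "\<not> ?thesis"
    then have e: "0 < \<epsilon> * (v - u) - m" by (simp add: m_def)
    have sub: "T \<inter> {u..v} \<subseteq> {0..1}" using T01 by auto
    obtain x s where xs: "\<forall>i. 0 < s i" "T \<inter> {u..v} \<subseteq> (\<Union>i. {x i - s i<..<x i + s i})"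
      "(\<Sum>i. ennreal (2 * s i)) \<le> ennreal (m + (\<epsilon> * (v - u) - m))"
      using outer_interval_cover[OF Tl sub e] unfolding m_def[symmetric] by (elim exE conjE)
    note xs(1)[rule_format] xs(2,3)
    note xs = this
    have le: "(\<Sum>i. ennreal (2 * s i)) \<le> ennreal (\<epsilon> * (v - u))" using xs(3) by simp
    have "(\<Sum>i. ennreal (g (2 * s i))) \<le> (\<Sum>i. ennreal C * ennreal (2 * s i))"
    proof (intro suminf_le summableI)
      fix i show "ennreal (g (2 * s i)) \<le> ennreal C * ennreal (2 * s i)"
        using C xs(1)[of i] by (subst ennreal_mult[symmetric]) (auto intro!: ennreal_leI)
    qed
    also have "\<dots> \<le> ennreal C * ennreal (\<epsilon> * (v - u))"
      unfolding ennreal_suminf_cmult using le by (rule mult_left_mono) simp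
    also have "\<dots> < \<infinity>" by (simp add: ennreal_mult_less_top)
    finally have "\<exists>y\<in>{u..v} \<inter> T. \<forall>i. y \<notin> {x i - s i<..<x i + s i}"
      by (intro escape[rule_format, OF uv xs(1) _ le])
    then show False using xs(2) by blast
  qed
  \<comment> \<open>The density is known inside [0,1] only, so the interval is first
    clipped.\<close>
  have part: "measure lebesgue (A \<inter> {x - s<..<x + s}) \<le> (1 - \<epsilon>) * (2 * s)" if s: "0 < s" for x s
  proof -
    define u v where "u = max 0 (x - s)" and "v = min 1 (x + s)"
    have sub: "A \<inter> {x - s<..<x + s} \<subseteq> A \<inter> {u..v}" by (auto simp: A_def u_def v_def)
    have Auv: "A \<inter> {u..v} \<in> lmeasurable" using Al by (intro fmeasurable.Int) auto
    have le: "measure lebesgue (A \<inter> {x - s<..<x + s}) \<le> measure lebesgue (A \<inter> {u..v})"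
      using sub Auv Al by (intro measure_mono_fmeasurable) auto
    show ?thesis
    proof (cases "u < v")
      case True
      have uv: "0 \<le> u" "v \<le> 1" by (auto simp: u_def v_def)
      have "A \<inter> {u..v} = {u..v} - (T \<inter> {u..v})" using uv by (auto simp: A_def)
      then have "measure lebesgue (A \<inter> {u..v}) = measure lebesgue {u..v} - measure lebesgue (T \<inter> {u..v})"
        using Tl by (simp add: measurable_measure_Diff fmeasurableD)
      also have "\<dots> \<le> (1 - \<epsilon>) * (v - u)" using density[OF uv(1) True uv(2)] True by (simp add: algebra_simps)
      also have "\<dots> \<le> (1 - \<epsilon>) * (2 * s)" using \<epsilon> by (intro mult_left_mono) (auto simp: u_def v_def)
      finally show ?thesis using le by simp
    next
      case False
      have "measure lebesgue (A \<inter> {u..v}) \<le> measure lebesgue {u..v}"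
        using Auv by (intro measure_mono_fmeasurable) auto
      also have "\<dots> = 0" using False by simp
      also have "0 \<le> (1 - \<epsilon>) * (2 * s)" using \<epsilon> s by simp
      finally show ?thesis using le by simp
    qed
  qed
  have "measure lebesgue A = 0"
  proof (rule ccontr)
    define m where "m = measure lebesgue A"
    assume "\<not> ?thesis"
    then have m: "0 < m" using measure_nonneg[of lebesgue A] unfolding m_def by linarith
    \<comment> \<open>This slack leads to a contradiction because (1 - \<epsilon>)(1 + \<epsilon> /
      2) < 1.\<close>
    have e: "0 < m * \<epsilon> / 2" using m \<epsilon> by simp
    have A01: "A \<subseteq> {0..1}" by (auto simp: A_def)
    obtain x s where xs: "\<forall>i. 0 < s i" "A \<subseteq> (\<Union>i. {x i - s i<..<x i + s i})"
      "(\<Sum>i. ennreal (2 * s i)) \<le> ennreal (m + m * \<epsilon> / 2)"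
      using outer_interval_cover[OF Al A01 e] unfolding m_def[symmetric] by (elim exE conjE)
    note xs(1)[rule_format] xs(2,3)
    note xs = this
    have "ennreal m = emeasure lebesgue A"
      unfolding m_def using Al by (simp add: emeasure_eq_measure2)
    also have "\<dots> \<le> emeasure lebesgue (\<Union>i. A \<inter> {x i - s i<..<x i + s i})"
      using xs(2) Al by (intro emeasure_mono) auto
    also have "\<dots> \<le> (\<Sum>i. emeasure lebesgue (A \<inter> {x i - s i<..<x i + s i}))"
      using Al by (intro emeasure_subadditive_countably) auto
    also have "\<dots> \<le> (\<Sum>i. ennreal (1 - \<epsilon>) * ennreal (2 * s i))"
    proof (intro suminf_le summableI)
      fix i
      have "A \<inter> {x i - s i<..<x i + s i} \<in> lmeasurable" using Al by (intro fmeasurable_Int_fmeasurable) auto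
      then have "emeasure lebesgue (A \<inter> {x i - s i<..<x i + s i})
          = ennreal (measure lebesgue (A \<inter> {x i - s i<..<x i + s i}))"
        by (simp add: emeasure_eq_measure2)
      also have "\<dots> \<le> ennreal ((1 - \<epsilon>) * (2 * s i))" using part[OF xs(1)] by (rule ennreal_leI)
      also have "\<dots> = ennreal (1 - \<epsilon>) * ennreal (2 * s i)" using \<epsilon> xs(1)[of i] by (intro ennreal_mult) auto
      finally show "emeasure lebesgue (A \<inter> {x i - s i<..<x i + s i}) \<le> \<dots>" .
    qed
    also have "\<dots> \<le> ennreal (1 - \<epsilon>) * ennreal (m + m * \<epsilon> / 2)"
      unfolding ennreal_suminf_cmult using xs(3) by (rule mult_left_mono) simp
    also have "\<dots> = ennreal ((1 - \<epsilon>) * (m + m * \<epsilon> / 2))" using \<epsilon> m by (intro ennreal_mult[symmetric]) auto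
    finally have "m \<le> (1 - \<epsilon>) * (m + m * \<epsilon> / 2)" using \<epsilon> m by (subst (asm) ennreal_le_iff) auto
    also have "\<dots> = m - m * \<epsilon> / 2 - m * \<epsilon> * \<epsilon> / 2" by (simp add: field_simps)
    finally have "m * \<epsilon> / 2 + m * \<epsilon> * \<epsilon> / 2 \<le> 0" by linarith
    moreover have "0 < m * \<epsilon> * \<epsilon> / 2" using m \<epsilon> by simp
    ultimately show False using e by linarith
  qed
  then show ?thesis by (simp add: A_def T_def)
qed

text \<open>When \<open>g\<close> is at most linear, a Lebesgue null set has gauge cost 0 at every
  scale, so removing it leaves the measure of the unit interval unchanged, whatever its
  value.\<close>

lemma hausdorff_measure_W_mult_full:
  fixes g :: "real \<Rightarrow> real" and \<beta> :: "'n::finite \<Rightarrow> real" and i0 :: 'n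
  assumes card: "CARD('n) = 1"
    and \<beta>: "\<And>i. 1 < \<beta> i" and \<psi>: "\<And>n. 1 \<le> n \<Longrightarrow> 0 < \<psi> n"
    and lip: "\<And>i. \<exists>L. L-lipschitz_on {0..<1} (h i)" and h: "\<And>i. h i \<in> {0..<1} \<rightarrow> {0..1}"
    and g: "dimension_function g" "\<And>x y. 0 < x \<Longrightarrow> x \<le> y \<Longrightarrow> g y / y \<le> g x / x"
    and diverges: "\<not> summable (\<lambda>n. \<beta> i0 ^ Suc n * g (\<psi> (Suc n) / \<beta> i0 ^ Suc n))"
    and C: "0 < C" "\<And>x. 0 < x \<Longrightarrow> g x \<le> C * x"
  shows "hausdorff_measure g (W_mult \<beta> \<psi> h) = hausdorff_measure g {x :: real ^ 'n. \<forall>i. x $ i \<in> {0..1}}"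
proof (rule antisym)
  let ?Q = "{x :: real ^ 'n. \<forall>i. x $ i \<in> {0..1}}"
  have single: "i = i0" for i :: 'n using card by (metis (full_types) UNIV_I card_1_singletonE singletonD)
  have "W_mult \<beta> \<psi> h \<subseteq> ?Q" by (auto simp: W_mult_def less_imp_le)
  then show "hausdorff_measure g (W_mult \<beta> \<psi> h) \<le> hausdorff_measure g ?Q"
    by (intro hausdorff_measure_le hausdorff_pre_mono)
  have gc: "continuous_on {0..} g" "g 0 = 0" "\<And>x. 0 < x \<Longrightarrow> 0 < g x"
    "\<And>x y. 0 < x \<Longrightarrow> x \<le> y \<Longrightarrow> g x \<le> g y"
    using g(1) by (auto simp: dimension_function_def mono_on_def)
  define T where "T = shrinking_targets (\<beta> i0) \<psi> (h i0)"
  define A where "A = {0..1} - T"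
  obtain L where L: "L-lipschitz_on {0..<1} (h i0)" using lip by blast
  have Tm: "T \<in> sets borel" unfolding T_def using L by (rule shrinking_targets_measurable)
  have Al: "A \<in> lmeasurable" "A \<subseteq> {0..1}"
    using Tm by (auto simp: A_def intro!: bounded_set_imp_lmeasurable intro: bounded_subset[OF bounded_closed_interval])
  have A0: "measure lebesgue A = 0"
    unfolding A_def T_def
    by (rule shrinking_targets_full_measure) (fact \<beta> \<psi> lip h gc g(2) diverges C)+
  show "hausdorff_measure g ?Q \<le> hausdorff_measure g (W_mult \<beta> \<psi> h)"
  proof (rule hausdorff_measure_le)
    fix \<eta> :: real assume \<eta>: "0 < \<eta>"
    define N where "N = ?Q - W_mult \<beta> \<psi> h"
    have N0: "hausdorff_pre g \<eta> N \<le> 0 + ennreal e" if e: "0 < e" for e :: real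
    proof -
      \<comment> \<open>A total length of at most \<open>\<eta>\<close> also bounds each single
        diameter by \<open>\<eta>\<close>; \<open>e / C\<close> bounds the cost.\<close>
      define e' where "e' = min \<eta> (e / C)"
      have e': "0 < e'" using \<eta> e C by (simp add: e'_def)
      obtain x s :: "nat \<Rightarrow> real" where xs: "\<forall>i. 0 < s i" "A \<subseteq> (\<Union>i. {x i - s i<..<x i + s i})"
        "(\<Sum>i. ennreal (2 * s i)) \<le> ennreal e'"
        using outer_interval_cover[OF Al e'] unfolding A0 add_0 by (elim exE conjE)
      note xs(1)[rule_format] xs(2,3)
      note xs = this
      have small: "2 * s i \<le> e'" for i
      proof -
        have "ennreal (2 * s i) \<le> ennreal e'"
          using ennreal_le_suminf[of "\<lambda>i. ennreal (2 * s i)" i] xs(3) by (rule order_trans)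
        then show ?thesis using e' by (subst (asm) ennreal_le_iff) auto
      qed
      have "N \<subseteq> (\<Union>i. max_ball (\<chi> j. x i) (s i))"
      proof
        fix y assume y: "y \<in> N"
        have eq: "y $ i = y $ i0" for i using single by metis
        have y01: "y $ i0 \<in> {0..1}" using y by (auto simp: N_def)
        have "y $ i0 \<notin> T"
        proof
          assume t: "y $ i0 \<in> T"
          have "y \<in> W_mult \<beta> \<psi> h"
          proof (rule mem_W_mult_of_coordinate)
            show "y $ i0 \<in> shrinking_targets (\<beta> i0) \<psi> (h i0)" using t by (simp add: T_def)
            then show "y $ j \<in> {0..<1}" for j using eq[of j] by (simp add: shrinking_targets_def)
          qed (fact h \<beta>)+
          then show False using y by (simp add: N_def)
        qed
        then have "y $ i0 \<in> A" using y01 by (simp add: A_def)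
        then obtain i where "y $ i0 \<in> {x i - s i<..<x i + s i}" using xs(2) by blast
        then have "\<bar>y $ j - (\<chi> j. x i) $ j\<bar> < s i" for j
          using eq[of j] by (auto simp: abs_less_iff)
        then have "y \<in> max_ball (\<chi> j. x i) (s i)" unfolding mem_max_ball_iff by blast
        then show "y \<in> (\<Union>i. max_ball (\<chi> j. x i) (s i))" by blast
      qed
      then have "(\<lambda>i. max_ball (\<chi> j. x i) (s i)) \<in> ball_covers \<eta> N"
        using xs(1) small by (intro mem_ball_coversI) (auto simp: e'_def intro: order_trans)
      then have "hausdorff_pre g \<eta> N \<le> (\<Sum>i. ennreal (g (max_diameter (max_ball (\<chi> j. x i) (s i) :: (real ^ 'n) set))))"
        unfolding hausdorff_pre_def by (rule INF_lower)
      also have "\<dots> \<le> (\<Sum>i. ennreal C * ennreal (2 * s i))"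
      proof (intro suminf_le summableI)
        fix i show "ennreal (g (max_diameter (max_ball (\<chi> j. x i) (s i) :: (real ^ 'n) set))) \<le> ennreal C * ennreal (2 * s i)"
          using C xs(1)[of i] by (subst ennreal_mult[symmetric]) (auto intro!: ennreal_leI simp: max_diameter_max_ball)
      qed
      also have "\<dots> \<le> ennreal C * ennreal e'"
        unfolding ennreal_suminf_cmult using xs(3) by (rule mult_left_mono) simp
      also have "\<dots> = ennreal (C * e')" using C e' by (intro ennreal_mult[symmetric]) auto
      also have "\<dots> \<le> ennreal e" using C by (intro ennreal_leI) (simp add: e'_def min_def field_simps)
      finally show ?thesis by simp
    qed
    then have N0: "hausdorff_pre g \<eta> N = 0" by (metis ennreal_le_epsilon le_zero_eq)
    define X where "X = (\<lambda>n::nat. if n = 0 then W_mult \<beta> \<psi> h else if n = 1 then N else {})"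
    have "?Q \<subseteq> (\<Union>n. X n)"
    proof
      fix y assume "y \<in> ?Q"
      then have "y \<in> X 0 \<or> y \<in> X 1" by (auto simp: X_def N_def)
      then show "y \<in> (\<Union>n. X n)" by blast
    qed
    then have "hausdorff_pre g \<eta> ?Q \<le> hausdorff_pre g \<eta> (\<Union>n. X n)" by (rule hausdorff_pre_mono)
    also have "\<dots> \<le> (\<Sum>n. hausdorff_pre g \<eta> (X n))" by (rule hausdorff_pre_Union_le)
    also have "\<dots> = (\<Sum>n\<in>{0}. hausdorff_pre g \<eta> (X n))"
      by (rule suminf_finite) (auto simp: X_def N0 hausdorff_pre_empty[OF g(1) \<eta>])
    finally show "hausdorff_pre g \<eta> ?Q \<le> hausdorff_pre g \<eta> (W_mult \<beta> \<psi> h)" by (simp add: X_def)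
  qed
qed

section \<open>Covering the hyperbolic regions\<close>

lemma dyadic_above:
  fixes v :: real
  assumes "0 < v" "v \<le> 1"
  obtains k :: nat where "v \<le> (1 / 2) ^ k" "(1 / 2) ^ k < 2 * v"
proof -
  have ex: "\<exists>k::nat. (1 / 2) ^ k < v" using real_arch_pow_inv[OF assms(1), of "1 / 2"] by auto
  define m :: nat where "m = (LEAST k. (1 / 2) ^ k < v)"
  have m: "(1 / 2) ^ m < v" unfolding m_def using ex by (rule LeastI_ex)
  then obtain k where k: "m = Suc k" using assms by (cases m) auto
  have "v \<le> (1 / 2) ^ k"
    using not_less_Least[of k "\<lambda>k. (1 / 2) ^ k < v"] k by (simp add: m_def not_less)
  moreover have "(1 / 2) ^ k < 2 * v" using m by (simp add: k)
  ultimately show ?thesis by (rule that)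
qed

text \<open>Raising all factors below a common level \<open>t\<close> makes the product exactly
  \<open>p\<close> for some \<open>t\<close>, by continuity. No factor is 0 any more, so every
  coordinate gets a dyadic exponent, and finitely many boxes suffice.\<close>

lemma raise_to_product:
  fixes u :: "'n::finite \<Rightarrow> real"
  assumes u: "\<And>i. 0 \<le> u i" "\<And>i. u i \<le> 1" and p: "(\<Prod>i\<in>UNIV. u i) < p" "p \<le> 1"
  obtains v where "\<And>i. u i \<le> v i" "\<And>i. v i \<le> 1" "(\<Prod>i\<in>UNIV. v i) = p"
proof -
  define P where "P t = (\<Prod>i\<in>UNIV. max (u i) t)" for t
  have "P 0 = (\<Prod>i\<in>UNIV. u i)" using u by (simp add: P_def max_absorb1)
  moreover have "P 1 = 1" using u by (simp add: P_def max_absorb2)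
  moreover have "continuous_on {0..1} P" unfolding P_def by (intro continuous_intros)
  ultimately obtain t where t: "0 \<le> t" "t \<le> 1" "P t = p"
    using IVT'[of P 0 p 1] p by auto
  show ?thesis
    by (rule that[of "\<lambda>i. max (u i) t"]) (use t u in \<open>auto simp: P_def\<close>)
qed

text \<open>Each covering interval of length \<open>4 * \<tau> / b ^ n\<close> is walked through in
  steps of \<open>\<delta>\<close>. With Q = \<open>\<tau> / b ^ n / \<delta>\<close> this takes at
  most 4 Q + 1 points, and Q is at least 1; hence the factor 5.\<close>

lemma small_distance_grid:
  assumes b: "1 < b" and lip: "L-lipschitz_on {0..<1} h" and n: "2 * L \<le> b ^ n"
    and \<delta>: "0 < \<delta>" "\<delta> \<le> \<tau> / b ^ n"
  shows "\<exists>Z. finite Z \<and> real (card Z) \<le> 5 * (b / (b - 1)) * (\<tau> / \<delta>) \<and>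
    {x \<in> {0..<1}. \<bar>(beta_map b ^^ n) x - h x\<bar> \<le> \<tau>} \<subseteq> (\<Union>z\<in>Z. {z - \<delta><..<z + \<delta>})"
proof -
  have bn: "0 < b ^ n" using b by simp
  have \<tau>: "0 < \<tau>"
  proof -
    have "\<delta> * b ^ n \<le> \<tau>" using \<delta>(2) bn by (simp only: pos_le_divide_eq)
    moreover have "0 < \<delta> * b ^ n" using \<delta>(1) bn by (rule mult_pos_pos)
    ultimately show ?thesis by linarith
  qed
  obtain Y where Y: "finite Y" "real (card Y) \<le> b / (b - 1) * b ^ n"
    "{x \<in> {0..<1}. \<bar>(beta_map b ^^ n) x - h x\<bar> \<le> \<tau>} \<subseteq> (\<Union>y\<in>Y. {y..y + 4 * \<tau> / b ^ n})"
    using small_distance_set_cover[OF b lip n less_imp_le[OF \<tau>]] by blast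
  define m where "m = nat \<lfloor>4 * \<tau> / b ^ n / \<delta>\<rfloor>"
  define Z where "Z = (\<Union>y\<in>Y. (\<lambda>j. y + real j * \<delta>) ` {..m})"
  define Q where "Q = \<tau> / b ^ n / \<delta>"
  have q: "1 \<le> Q" unfolding Q_def using \<delta> by (subst pos_le_divide_eq) auto
  have m: "real m + 1 \<le> 5 * Q"
  proof -
    have "0 \<le> 4 * \<tau> / b ^ n / \<delta>" using \<tau> bn \<delta> by simp
    then have "real m \<le> 4 * \<tau> / b ^ n / \<delta>" unfolding m_def by linarith
    also have "\<dots> = 4 * Q" by (simp add: Q_def)
    finally show ?thesis using q by linarith
  qed
  show ?thesis
  proof (intro exI[of _ Z] conjI)
    show "finite Z" using Y(1) by (simp add: Z_def)
    have "card Z \<le> (\<Sum>y\<in>Y. card ((\<lambda>j. y + real j * \<delta>) ` {..m}))"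
      unfolding Z_def using Y(1) by (rule card_UN_le)
    also have "\<dots> \<le> (\<Sum>y\<in>Y. Suc m)"
      by (intro sum_mono order_trans[OF card_image_le]) auto
    finally have "card Z \<le> card Y * Suc m" by simp
    then have "real (card Z) \<le> real (card Y * Suc m)" by (simp only: of_nat_le_iff)
    also have "\<dots> = real (card Y) * (real m + 1)" by (simp add: algebra_simps)
    also have "\<dots> \<le> (b / (b - 1) * b ^ n) * (5 * Q)"
      using Y(2) m b by (intro mult_mono) auto
    also have "\<dots> = 5 * (b / (b - 1)) * (\<tau> / \<delta>)" using b by (simp add: Q_def)
    finally show "real (card Z) \<le> 5 * (b / (b - 1)) * (\<tau> / \<delta>)" .
    show "{x \<in> {0..<1}. \<bar>(beta_map b ^^ n) x - h x\<bar> \<le> \<tau>} \<subseteq> (\<Union>z\<in>Z. {z - \<delta><..<z + \<delta>})"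
    proof
      fix x assume "x \<in> {x \<in> {0..<1}. \<bar>(beta_map b ^^ n) x - h x\<bar> \<le> \<tau>}"
      then obtain y where y: "y \<in> Y" "y \<le> x" "x \<le> y + 4 * \<tau> / b ^ n" using Y(3) by auto
      define j where "j = nat \<lfloor>(x - y) / \<delta>\<rfloor>"
      have nn: "0 \<le> (x - y) / \<delta>" using y \<delta> by simp
      have "(x - y) / \<delta> \<le> 4 * \<tau> / b ^ n / \<delta>" using y \<delta> by (intro divide_right_mono) auto
      then have "j \<le> m" unfolding j_def m_def by (intro nat_mono floor_mono)
      then have "y + real j * \<delta> \<in> Z" using y(1) by (auto simp: Z_def)
      moreover have "real j \<le> (x - y) / \<delta>" "(x - y) / \<delta> < real j + 1"
        using nn unfolding j_def by linarith+
      then have "real j * \<delta> \<le> x - y" "x - y < (real j + 1) * \<delta>"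
        using \<delta> by (auto simp: pos_le_divide_eq pos_divide_less_eq)
      then have "x \<in> {y + real j * \<delta> - \<delta><..<y + real j * \<delta> + \<delta>}"
        using \<delta> by (auto simp: algebra_simps)
      ultimately show "x \<in> (\<Union>z\<in>Z. {z - \<delta><..<z + \<delta>})" by blast
    qed
  qed
qed

lemma hausdorff_pre_grid_le:
  fixes S :: "'n::finite \<Rightarrow> real set"
  assumes f: "dimension_function f" and \<delta>: "0 < \<delta>" "2 * \<delta> \<le> \<eta>"
    and Z: "\<And>i. finite (Z i)" "\<And>i. S i \<subseteq> (\<Union>z\<in>Z i. {z - \<delta><..<z + \<delta>})"
    and card: "\<And>i. real (card (Z i)) \<le> C i"
  shows "hausdorff_pre f \<eta> {x :: real ^ 'n. \<forall>i. x $ i \<in> S i} \<le> ennreal ((\<Prod>i\<in>UNIV. C i) * f (2 * \<delta>))"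
proof -
  define P where "P = PiE (UNIV :: 'n set) Z"
  have fP: "finite P" unfolding P_def using Z(1) by (intro finite_PiE) auto
  have "0 < f (2 * \<delta>)" using f \<delta>(1) by (simp add: dimension_function_def)
  then have f0: "0 \<le> f (2 * \<delta>)" by simp
  have "{x :: real ^ 'n. \<forall>i. x $ i \<in> S i} \<subseteq> (\<Union>p\<in>P. max_ball (\<chi> i. p i) \<delta>)"
  proof
    fix x :: "real ^ 'n" assume "x \<in> {x. \<forall>i. x $ i \<in> S i}"
    then have x: "x $ i \<in> S i" for i by simp
    have "\<exists>z. z \<in> Z i \<and> \<bar>x $ i - z\<bar> < \<delta>" for i
    proof -
      obtain z where "z \<in> Z i" "x $ i \<in> {z - \<delta><..<z + \<delta>}" using Z(2)[of i] x[of i] by blast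
      then show ?thesis by (intro exI[of _ z]) (simp add: abs_less_iff)
    qed
    then have "\<exists>p. \<forall>i. p i \<in> Z i \<and> \<bar>x $ i - p i\<bar> < \<delta>" by (intro choice allI)
    then obtain p where p: "\<And>i. p i \<in> Z i" "\<And>i. \<bar>x $ i - p i\<bar> < \<delta>" by blast
    have "x \<in> max_ball (\<chi> i. p i) \<delta>" using p(2) by (simp add: mem_max_ball_iff)
    moreover have "p \<in> P" using p(1) by (simp add: P_def PiE_UNIV_domain)
    ultimately show "x \<in> (\<Union>p\<in>P. max_ball (\<chi> i. p i) \<delta>)" by blast
  qed
  then have "hausdorff_pre f \<eta> {x :: real ^ 'n. \<forall>i. x $ i \<in> S i} \<le> (\<Sum>p\<in>P. ennreal (f (2 * \<delta>)))"
    using \<delta> by (intro hausdorff_pre_finite_cover[OF f fP]) auto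
  also have "\<dots> = ennreal (\<Sum>p\<in>P. f (2 * \<delta>))" using f0 by (rule sum_ennreal)
  also have "(\<Sum>p\<in>P. f (2 * \<delta>)) = real (card P) * f (2 * \<delta>)" by simp
  also have "real (card P) = (\<Prod>i\<in>UNIV. real (card (Z i)))"
    unfolding P_def by (subst card_PiE) auto
  also have "(\<Prod>i\<in>UNIV. real (card (Z i))) * f (2 * \<delta>) \<le> (\<Prod>i\<in>UNIV. C i) * f (2 * \<delta>)"
    using card f0 by (intro mult_right_mono prod_mono) auto
  finally show ?thesis by (simp add: ennreal_leI)
qed

text \<open>Given the exponents of all coordinates but \<open>i\<close>, the product condition leaves at most
  \<open>CARD('n)\<close> choices for the exponent of \<open>i\<close>.\<close>

lemma sum_over_dyadic_boxes:
  fixes q p :: real and i :: "'n::finite"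
  assumes q: "0 \<le> q" "q < 1 \<or> CARD('n) = 1" and p: "0 < p"
    and \<K>: "finite \<K>" "\<And>k. k \<in> \<K> \<Longrightarrow> p \<le> (\<Prod>j\<in>UNIV. (1 / 2) ^ k j) \<and> (\<Prod>j\<in>UNIV. (1 / 2) ^ k j) < 2 ^ CARD('n) * p"
  shows "(\<Sum>k\<in>\<K>. \<Prod>j\<in>UNIV - {i}. q ^ k j) \<le> CARD('n) * (1 / (1 - q)) ^ (CARD('n) - 1)"
proof -
  let ?d = "CARD('n)" and ?U = "UNIV - {i}"
  obtain N where N: "\<And>k j. k \<in> \<K> \<Longrightarrow> k j < N"
  proof (rule that[of "Suc (Max (insert 0 (\<Union>k\<in>\<K>. range k)))"])
    fix k j assume "k \<in> \<K>"
    then show "k j < Suc (Max (insert 0 (\<Union>k\<in>\<K>. range k)))"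
      using \<K>(1) by (auto simp: less_Suc_eq_le intro!: Max_ge)
  qed
  define R where "R = PiE ?U (\<lambda>_. {..<N})"
  have fR: "finite R" by (auto simp: R_def intro: finite_PiE)
  have "(\<Sum>k\<in>\<K>. \<Prod>j\<in>?U. q ^ k j) = (\<Sum>\<rho>\<in>R. \<Sum>k\<in>{k \<in> \<K>. restrict k ?U = \<rho>}. \<Prod>j\<in>?U. q ^ k j)"
    using N by (intro sum.group[symmetric] \<K>(1) fR) (simp add: R_def image_subset_iff restrict_PiE_iff)
  also have "\<dots> \<le> (\<Sum>\<rho>\<in>R. real ?d * (\<Prod>j\<in>?U. q ^ \<rho> j))"
  proof (rule sum_mono)
    fix \<rho> assume "\<rho> \<in> R"
    define A where "A = {k \<in> \<K>. restrict k ?U = \<rho>}"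
    have A_eq: "k j = \<rho> j" if "k \<in> A" "j \<noteq> i" for k j
      using that by (auto simp: A_def)
    have inj: "inj_on (\<lambda>k. k i) A"
    proof (rule inj_onI)
      fix k k' assume k: "k \<in> A" "k' \<in> A" "k i = k' i"
      show "k = k'"
      proof
        fix j show "k j = k' j" using k(3) A_eq[OF k(1)] A_eq[OF k(2)] by (cases "j = i") auto
      qed
    qed
    define c where "c = (\<Prod>j\<in>?U. (1 / 2 :: real) ^ \<rho> j)"
    have prod_A: "(\<Prod>j\<in>UNIV. (1 / 2 :: real) ^ k j) = (1 / 2) ^ k i * c" if "k \<in> A" for k
    proof -
      have "(\<Prod>j\<in>UNIV. (1 / 2 :: real) ^ k j) = (1 / 2) ^ k i * (\<Prod>j\<in>?U. (1 / 2) ^ k j)"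
        by (rule prod.remove) auto
      also have "(\<Prod>j\<in>?U. (1 / 2 :: real) ^ k j) = c"
        unfolding c_def using A_eq[OF that] by (intro prod.cong) auto
      finally show ?thesis .
    qed
    \<comment> \<open>The two products agree off \<open>i\<close> and differ by less than the factor
      \<open>2 ^ ?d\<close>.\<close>
    have close: "k' i < k i + ?d" if "k \<in> A" "k' \<in> A" for k k'
    proof (rule ccontr)
      assume "\<not> ?thesis"
      then obtain m where m: "k' i = k i + ?d + m" by (metis le_Suc_ex not_less)
      have "p \<le> (1 / 2) ^ k' i * c" using \<K>(2)[of k'] prod_A[OF that(2)] that by (simp add: A_def)
      also have "\<dots> = (1 / 2) ^ k i * c * (1 / 2) ^ ?d * (1 / 2) ^ m" by (simp add: m power_add)
      also have "\<dots> \<le> (1 / 2) ^ k i * c * (1 / 2) ^ ?d * 1"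
        by (intro mult_left_mono power_le_one) (auto simp: c_def intro!: mult_nonneg_nonneg prod_nonneg)
      also have "\<dots> < 2 ^ ?d * p * (1 / 2) ^ ?d"
        using \<K>(2)[of k] prod_A[OF that(1)] that by (simp add: A_def)
      also have "\<dots> = p" by (simp add: power_divide)
      finally show False by simp
    qed
    have "card A \<le> ?d"
    proof (cases "A = {}")
      case False
      then obtain k0 where k0: "k0 \<in> A" "\<And>k. k \<in> A \<Longrightarrow> k0 i \<le> k i"
        using ex_has_least_nat[of "\<lambda>k. k \<in> A" _ "\<lambda>k. k i"] by blast
      have "(\<lambda>k. k i) ` A \<subseteq> {k0 i..<k0 i + ?d}" using k0 close by auto
      then have "card ((\<lambda>k. k i) ` A) \<le> card {k0 i..<k0 i + ?d}" by (intro card_mono) auto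
      then show ?thesis using inj by (simp add: card_image)
    qed simp
    then have "real (card A) * (\<Prod>j\<in>?U. q ^ \<rho> j) \<le> real ?d * (\<Prod>j\<in>?U. q ^ \<rho> j)"
      using q by (intro mult_right_mono prod_nonneg) auto
    moreover have "(\<Sum>k\<in>A. \<Prod>j\<in>?U. q ^ k j) = (\<Sum>k\<in>A. \<Prod>j\<in>?U. q ^ \<rho> j)"
      using A_eq by (intro sum.cong prod.cong) auto
    ultimately show "(\<Sum>k\<in>{k \<in> \<K>. restrict k ?U = \<rho>}. \<Prod>j\<in>?U. q ^ k j) \<le> real ?d * (\<Prod>j\<in>?U. q ^ \<rho> j)"
      by (simp add: A_def)
  qed
  also have "\<dots> = real ?d * (\<Sum>\<rho>\<in>R. \<Prod>j\<in>?U. q ^ \<rho> j)" by (simp add: sum_distrib_left)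
  also have "(\<Sum>\<rho>\<in>R. \<Prod>j\<in>?U. q ^ \<rho> j) = (\<Prod>j\<in>?U. \<Sum>m<N. q ^ m)"
    unfolding R_def by (rule prod_sum_PiE[symmetric]) auto
  also have "\<dots> = (\<Sum>m<N. q ^ m) ^ (?d - 1)" by (simp add: card_Diff_singleton)
  also have "\<dots> \<le> (1 / (1 - q)) ^ (?d - 1)"
  \<comment> \<open>If q is at least 1, there is a single coordinate and both powers have exponent
    0.\<close>
  proof (cases "q < 1")
    case True
    have "(\<Sum>m<N. q ^ m) = (1 - q ^ N) / (1 - q)" using True by (simp add: sum_gp_strict)
    also have "\<dots> \<le> 1 / (1 - q)" using True q by (intro divide_right_mono) auto
    finally show ?thesis using q by (intro power_mono sum_nonneg) auto
  qed (use q in auto)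
  finally show ?thesis by (simp add: mult_left_mono)
qed

text \<open>The cost per volume f(x) / x^d is f(x) / x^s times x^(s - d), and the first factor
  decreases. Passing from r to a larger \<delta> thus gains the power d - s of r / \<delta>, the
  source of the geometric series over the boxes.\<close>

lemma gauge_le_power_of_ratio:
  fixes f :: "real \<Rightarrow> real"
  assumes ratio: "\<And>x y. 0 < x \<Longrightarrow> x \<le> y \<Longrightarrow> f y / y powr s \<le> f x / x powr s"
    and f: "\<And>x. 0 < x \<Longrightarrow> 0 < f x" and r: "0 < r" "r \<le> \<delta>" and q: "r / \<delta> \<le> q" and s: "s \<le> real d"
  shows "f \<delta> / \<delta> ^ d \<le> f r / r ^ d * q powr (real d - s)"
proof -
  have \<delta>: "0 < \<delta>" using r by linarith
  have pw: "x ^ d = x powr s * x powr (real d - s)" if "0 < x" for x :: real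
    using that by (simp flip: powr_add powr_realpow)
  have "f \<delta> / \<delta> ^ d = f \<delta> / \<delta> powr s / \<delta> powr (real d - s)" by (simp add: pw[OF \<delta>])
  also have "\<dots> \<le> f r / r powr s / \<delta> powr (real d - s)"
    using ratio[OF r] by (intro divide_right_mono) auto
  also have "\<dots> = f r / r ^ d * (r powr (real d - s) / \<delta> powr (real d - s))"
    using r(1) by (simp add: pw[OF r(1)])
  also have "r powr (real d - s) / \<delta> powr (real d - s) = (r / \<delta>) powr (real d - s)"
    using r(1) \<delta> by (simp add: powr_divide)
  also have "f r / r ^ d * \<dots> \<le> f r / r ^ d * q powr (real d - s)"
    using q r(1) \<delta> s f[OF r(1)] by (intro mult_left_mono powr_mono2) auto
  finally show ?thesis .
qed

text \<open>The points of one box have neighbourhoods of volume of order p, so about p / \<delta>^d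
  cubes of its shortest side \<delta> suffice. Measured against r =
  \<open>p / \<beta> i0 ^ n\<close>, the cost gains a power of the product of the other \<tau>_j,
  which is summable over the boxes. \<open>G\<close> is that geometric sum; its exponent is 0 for a
  single coordinate.\<close>

lemma hausdorff_pre_level_le:
  fixes \<beta> L :: "'n::finite \<Rightarrow> real" and i0 :: 'n and f :: "real \<Rightarrow> real" and s :: real
  defines "d \<equiv> CARD('n)"
  defines "G \<equiv> 1 / (1 - (1 / 2) powr (real d - s))"
  assumes f: "dimension_function f"
    and s: "s \<le> real d" "s < real d \<or> d = 1"
    and ratio: "\<And>x y. 0 < x \<Longrightarrow> x \<le> y \<Longrightarrow> f y / y powr s \<le> f x / x powr s"
    and \<beta>: "\<And>i. 1 < \<beta> i" "\<And>i. \<beta> i \<le> \<beta> i0"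
    and lip: "\<And>i. (L i)-lipschitz_on {0..<1} (h i)" and h: "\<And>i. h i \<in> {0..<1} \<rightarrow> {0..1}"
    and n: "\<And>i. 2 * L i \<le> \<beta> i ^ n" "\<And>i. 2 / \<beta> i ^ n \<le> \<eta>" and p: "0 < p" "p < 1"
  shows "hausdorff_pre f \<eta> {x :: real ^ 'n. (\<forall>i. x $ i \<in> {0..<1}) \<and>
      (\<Prod>i\<in>UNIV. \<bar>(beta_map (\<beta> i) ^^ n) (x $ i) - h i (x $ i)\<bar>) < p}
    \<le> ennreal ((\<Prod>i\<in>UNIV. 5 * (\<beta> i / (\<beta> i - 1))) * 4 ^ d * (d * (d * G ^ (d - 1))) *
        (p * (f (p / \<beta> i0 ^ n) / (p / \<beta> i0 ^ n) ^ d)))"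
proof -
  let ?u = "\<lambda>i t. \<bar>(beta_map (\<beta> i) ^^ n) t - h i t\<bar>"
  let ?E = "{x :: real ^ 'n. (\<forall>i. x $ i \<in> {0..<1}) \<and> (\<Prod>i\<in>UNIV. ?u i (x $ i)) < p}"
  define q where "q = (1 / 2 :: real) powr (real d - s)"
  define \<tau> where "\<tau> k i = (1 / 2 :: real) ^ k i" for k :: "'n \<Rightarrow> nat" and i
  define \<delta> where "\<delta> k = Min (range (\<lambda>i. \<tau> k i / \<beta> i ^ n))" for k
  define \<K> where "\<K> = {k :: 'n \<Rightarrow> nat. p \<le> (\<Prod>j\<in>UNIV. (1 / 2) ^ k j) \<and> (\<Prod>j\<in>UNIV. (1 / 2) ^ k j) < 2 ^ CARD('n) * p}"
  define Box where "Box k = {x :: real ^ 'n. \<forall>i. x $ i \<in> {t \<in> {0..<1}. ?u i t \<le> \<tau> k i}}" for k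
  define C where "C i = 5 * (\<beta> i / (\<beta> i - 1))" for i
  define r where "r = p / \<beta> i0 ^ n"
  have \<beta>n: "0 < \<beta> i ^ n" "1 \<le> \<beta> i ^ n" for i using \<beta>(1)[of i] by auto
  have r: "0 < r" using p \<beta>n by (simp add: r_def)
  have C: "0 \<le> C i" for i using \<beta>(1)[of i] by (simp add: C_def)
  have \<tau>: "0 < \<tau> k i" "\<tau> k i \<le> 1" for k i by (auto simp: \<tau>_def power_le_one)
  have fp: "0 < f x" if "0 < x" for x using f that by (simp add: dimension_function_def)
  have finK: "finite \<K>"
  proof -
    obtain N where N: "(1 / 2 :: real) ^ N < p" using real_arch_pow_inv[OF p(1), of "1 / 2"] by auto
    have "k i < N" if "k \<in> \<K>" for k i
    proof (rule ccontr)
      assume "\<not> k i < N"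
      then have "(1 / 2 :: real) ^ k i \<le> (1 / 2) ^ N" by (intro power_decreasing) auto
      moreover have "(\<Prod>j\<in>UNIV. (1 / 2 :: real) ^ k j) \<le> (1 / 2) ^ k i"
      proof -
        have "(\<Prod>j\<in>UNIV. (1 / 2 :: real) ^ k j) = (1 / 2) ^ k i * (\<Prod>j\<in>UNIV - {i}. (1 / 2) ^ k j)"
          by (rule prod.remove) auto
        also have "\<dots> \<le> (1 / 2) ^ k i * 1" by (intro mult_left_mono prod_le_1) (auto simp: power_le_one)
        finally show ?thesis by simp
      qed
      moreover have "p \<le> (\<Prod>j\<in>UNIV. (1 / 2) ^ k j)" using that by (simp add: \<K>_def)
      ultimately show False using N by linarith
    qed
    then have "\<K> \<subseteq> PiE UNIV (\<lambda>_. {..<N})" by auto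
    then show ?thesis by (rule finite_subset) (intro finite_PiE, auto)
  qed
  have cover: "?E \<subseteq> (\<Union>k\<in>\<K>. Box k)"
  proof
    fix x assume x: "x \<in> ?E"
    have u: "0 \<le> ?u i (x $ i)" "?u i (x $ i) \<le> 1" for i
    proof -
      have xi: "x $ i \<in> {0..<1}" using x by auto
      then have "(beta_map (\<beta> i) ^^ n) (x $ i) \<in> {0..<1}" by (rule beta_iterate_bounds[OF \<beta>(1)])
      moreover have "h i (x $ i) \<in> {0..1}" using h[of i] xi by blast
      ultimately show "?u i (x $ i) \<le> 1" by auto
    qed simp
    have "(\<Prod>i\<in>UNIV. ?u i (x $ i)) < p" using x by simp
    then obtain v where v: "\<And>i. ?u i (x $ i) \<le> v i" "\<And>i. v i \<le> 1" "(\<Prod>i\<in>UNIV. v i) = p"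
      using raise_to_product[of "\<lambda>i. ?u i (x $ i)" p] u p by auto
    have v0: "0 < v i" for i
    proof -
      have "0 \<le> v i" using u(1)[of i] v(1)[of i] by linarith
      moreover have "v i \<noteq> 0" using v(3) p(1) by (metis UNIV_I finite less_irrefl prod_zero)
      ultimately show ?thesis by simp
    qed
    have "\<exists>k::nat. v i \<le> (1 / 2) ^ k \<and> (1 / 2) ^ k < 2 * v i" for i
      using dyadic_above[OF v0 v(2)] by blast
    then obtain k :: "'n \<Rightarrow> nat" where k: "\<And>i. v i \<le> (1 / 2) ^ k i" "\<And>i. (1 / 2) ^ k i < 2 * v i" by metis
    have "p \<le> (\<Prod>j\<in>UNIV. (1 / 2) ^ k j)"
      unfolding v(3)[symmetric] using v0 k(1) by (intro prod_mono) (auto intro: less_imp_le)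
    moreover have "(\<Prod>j\<in>UNIV. (1 / 2) ^ k j) < (\<Prod>j\<in>UNIV. 2 * v j)"
      using k(2) v0 by (intro prod_mono_strict) (auto intro: less_imp_le)
    then have "(\<Prod>j\<in>UNIV. (1 / 2) ^ k j) < 2 ^ CARD('n) * p"
      by (simp add: prod.distrib v(3))
    ultimately have "k \<in> \<K>" by (simp add: \<K>_def)
    moreover have "?u i (x $ i) \<le> \<tau> k i" for i unfolding \<tau>_def using v(1)[of i] k(1)[of i] by linarith
    then have "x \<in> Box k" using x by (auto simp: Box_def)
    ultimately show "x \<in> (\<Union>k\<in>\<K>. Box k)" by blast
  qed
  have \<eta>: "0 < \<eta>" using n(2)[of i0] \<beta>n(1)[of i0] by (smt (verit) divide_pos_pos)
  define B where "B = (\<Prod>i\<in>UNIV. C i) * 4 ^ d"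
  define t where "t = p * (f r / r ^ d)"
  have B0: "0 \<le> B" unfolding B_def using C by (intro mult_nonneg_nonneg prod_nonneg) auto
  have t0: "0 \<le> t" using p r fp[OF r] by (simp add: t_def)
  have q0: "0 \<le> q" by (simp add: q_def)
  have box: "hausdorff_pre f \<eta> (Box k) \<le> ennreal (B * t * (\<Sum>i\<in>UNIV. \<Prod>j\<in>UNIV - {i}. q ^ k j))"
    if k: "k \<in> \<K>" for k
  proof -
    have kp: "p \<le> (\<Prod>j\<in>UNIV. \<tau> k j)" "(\<Prod>j\<in>UNIV. \<tau> k j) < 2 ^ d * p"
      using k by (auto simp: \<K>_def \<tau>_def d_def)
    have \<delta>le: "\<delta> k \<le> \<tau> k i / \<beta> i ^ n" for i unfolding \<delta>_def by (rule Min_le) auto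
    have "\<delta> k \<in> range (\<lambda>i. \<tau> k i / \<beta> i ^ n)" unfolding \<delta>_def by (rule Min_in) auto
    then obtain i where i: "\<delta> k = \<tau> k i / \<beta> i ^ n" by auto
    have \<delta>0: "0 < \<delta> k" unfolding i using \<tau>(1) \<beta>n(1) by (intro divide_pos_pos)
    have \<delta>\<eta>: "2 * \<delta> k \<le> \<eta>"
    proof -
      have "2 * \<delta> k = 2 * \<tau> k i / \<beta> i ^ n" by (simp add: i)
      also have "\<dots> \<le> 2 / \<beta> i ^ n" using \<tau>(2)[of k i] \<beta>n(1)[of i] by (intro divide_right_mono) auto
      finally show ?thesis using n(2)[of i] by simp
    qed
    have "\<exists>Z. finite Z \<and> real (card Z) \<le> C j * (\<tau> k j / \<delta> k) \<and>
        {t \<in> {0..<1}. ?u j t \<le> \<tau> k j} \<subseteq> (\<Union>z\<in>Z. {z - \<delta> k<..<z + \<delta> k})" for j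
      unfolding C_def by (rule small_distance_grid[OF \<beta>(1) lip n(1) \<delta>0 \<delta>le])
    then have "\<exists>Z. \<forall>j. finite (Z j) \<and> real (card (Z j)) \<le> C j * (\<tau> k j / \<delta> k) \<and>
        {t \<in> {0..<1}. ?u j t \<le> \<tau> k j} \<subseteq> (\<Union>z\<in>Z j. {z - \<delta> k<..<z + \<delta> k})" by (intro choice allI)
    then obtain Z where Z: "\<forall>j. finite (Z j) \<and> real (card (Z j)) \<le> C j * (\<tau> k j / \<delta> k) \<and>
        {t \<in> {0..<1}. ?u j t \<le> \<tau> k j} \<subseteq> (\<Union>z\<in>Z j. {z - \<delta> k<..<z + \<delta> k})" ..
    have "hausdorff_pre f \<eta> (Box k) \<le> ennreal ((\<Prod>j\<in>UNIV. C j * (\<tau> k j / \<delta> k)) * f (2 * \<delta> k))"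
      unfolding Box_def using Z by (intro hausdorff_pre_grid_le[OF f \<delta>0 \<delta>\<eta>, of Z]) simp_all
    also have "\<dots> \<le> ennreal (B * t * (\<Sum>i\<in>UNIV. \<Prod>j\<in>UNIV - {i}. q ^ k j))"
    proof (rule ennreal_leI)
      define \<rho> where "\<rho> = (\<Prod>j\<in>UNIV - {i}. \<tau> k j)"
      have \<rho>0: "0 < \<rho>" unfolding \<rho>_def using \<tau>(1) by (intro prod_pos) auto
      have \<rho>1: "\<rho> \<le> 1" unfolding \<rho>_def using \<tau> by (intro prod_le_1) (auto intro: less_imp_le)
      have "p \<le> \<tau> k i * \<rho>" using kp(1) unfolding \<rho>_def by (subst (asm) prod.remove[of _ i]) auto
      then have "p / \<tau> k i \<le> \<rho>" using \<tau>(1)[of k i] by (simp add: pos_divide_le_eq mult.commute)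
      moreover have "r / \<delta> k \<le> p / \<tau> k i"
      proof -
        \<comment> \<open>Here the largest base enters: the shortest side may belong to any
          coordinate \<open>i\<close>.\<close>
        have "\<beta> i ^ n \<le> \<beta> i0 ^ n" using \<beta>(1)[of i] \<beta>(2)[of i] by (intro power_mono) auto
        then have "\<beta> i ^ n / \<beta> i0 ^ n \<le> 1" using \<beta>n(1)[of i0] by simp
        then have "p / \<tau> k i * (\<beta> i ^ n / \<beta> i0 ^ n) \<le> p / \<tau> k i * 1"
          using p(1) \<tau>(1)[of k i] by (intro mult_left_mono) auto
        then show ?thesis by (simp add: r_def i mult.commute)
      qed
      ultimately have rd: "r / \<delta> k \<le> \<rho>" by linarith
      then have "r / \<delta> k \<le> 1" using \<rho>1 by linarith
      then have r\<delta>: "r \<le> \<delta> k" using \<delta>0 by (simp add: pos_divide_le_eq)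
      have \<rho>q: "\<rho> powr (real d - s) = (\<Prod>j\<in>UNIV - {i}. q ^ k j)"
      proof -
        have "\<tau> k j powr (real d - s) = q ^ k j" for j
        proof -
          have "\<tau> k j powr (real d - s) = ((1 / 2) powr real (k j)) powr (real d - s)"
            by (simp add: \<tau>_def powr_realpow)
          also have "\<dots> = q powr real (k j)" by (simp add: q_def powr_powr mult.commute)
          also have "\<dots> = q ^ k j" by (rule powr_realpow) (simp add: q_def)
          finally show ?thesis .
        qed
        moreover have "\<rho> powr (real d - s) = (\<Prod>j\<in>UNIV - {i}. \<tau> k j powr (real d - s))"
          unfolding \<rho>_def by (rule prod_powr_distrib)
        ultimately show ?thesis by (simp only:)
      qed
      have f\<delta>: "f (\<delta> k) / \<delta> k ^ d \<le> f r / r ^ d * (\<Prod>j\<in>UNIV - {i}. q ^ k j)"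
        unfolding \<rho>q[symmetric] by (rule gauge_le_power_of_ratio[OF ratio fp r r\<delta> rd s(1)])
      have "f (2 * \<delta> k) / (2 * \<delta> k) ^ d \<le> f (\<delta> k) / \<delta> k ^ d * 1 powr (real d - s)"
        by (rule gauge_le_power_of_ratio[OF ratio fp \<delta>0 _ _ s(1)]) (use \<delta>0 in auto)
      then have "2 ^ d * (f (2 * \<delta> k) / (2 * \<delta> k) ^ d) \<le> 2 ^ d * (f (\<delta> k) / \<delta> k ^ d)"
        by (intro mult_left_mono) simp_all
      moreover have "2 ^ d * (f (2 * \<delta> k) / (2 * \<delta> k) ^ d) = f (2 * \<delta> k) / \<delta> k ^ d"
        by (simp add: power_mult_distrib)
      ultimately have f2: "f (2 * \<delta> k) / \<delta> k ^ d \<le> 2 ^ d * (f (\<delta> k) / \<delta> k ^ d)" by (simp only:)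
      \<comment> \<open>One factor \<open>2 ^ d\<close> comes from rounding to dyadic sides, the
        other from the cube diameter \<open>2 * \<delta> k\<close>; together they form the
        \<open>4 ^ d\<close>.\<close>
      have "(\<Prod>j\<in>UNIV. C j * (\<tau> k j / \<delta> k)) * f (2 * \<delta> k)
          = (\<Prod>j\<in>UNIV. C j) * (\<Prod>j\<in>UNIV. \<tau> k j) * (f (2 * \<delta> k) / \<delta> k ^ d)"
        by (simp add: prod.distrib prod_dividef d_def)
      also have "\<dots> \<le> (\<Prod>j\<in>UNIV. C j) * (2 ^ d * p) * (2 ^ d * (f r / r ^ d * (\<Prod>j\<in>UNIV - {i}. q ^ k j)))"
      proof (rule mult_mono)
        have C0: "0 \<le> (\<Prod>j\<in>UNIV. C j)" using C by (intro prod_nonneg) auto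
        then show "(\<Prod>j\<in>UNIV. C j) * (\<Prod>j\<in>UNIV. \<tau> k j) \<le> (\<Prod>j\<in>UNIV. C j) * (2 ^ d * p)"
          using kp(2) by (intro mult_left_mono) auto
        show "0 \<le> (\<Prod>j\<in>UNIV. C j) * (2 ^ d * p)" using C0 p by (intro mult_nonneg_nonneg) auto
        show "0 \<le> f (2 * \<delta> k) / \<delta> k ^ d" using fp[of "2 * \<delta> k"] \<delta>0 by simp
        show "f (2 * \<delta> k) / \<delta> k ^ d \<le> 2 ^ d * (f r / r ^ d * (\<Prod>j\<in>UNIV - {i}. q ^ k j))"
          by (rule order_trans[OF f2 mult_left_mono[OF f\<delta>]]) simp
      qed
      also have "\<dots> = B * t * (\<Prod>j\<in>UNIV - {i}. q ^ k j)"
      proof -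
        have "(4 :: real) ^ d = 2 ^ d * 2 ^ d" by (simp flip: power_mult_distrib)
        then show ?thesis by (simp add: B_def t_def)
      qed
      \<comment> \<open>Which coordinate is the shortest depends on \<open>k\<close>, so the sum
        over all coordinates is taken; this costs one of the two factors \<open>d\<close>.\<close>
      also have "\<dots> \<le> B * t * (\<Sum>i\<in>UNIV. \<Prod>j\<in>UNIV - {i}. q ^ k j)"
        using B0 t0 q0 by (intro mult_left_mono member_le_sum) (auto intro: prod_nonneg)
      finally show "(\<Prod>j\<in>UNIV. C j * (\<tau> k j / \<delta> k)) * f (2 * \<delta> k)
          \<le> B * t * (\<Sum>i\<in>UNIV. \<Prod>j\<in>UNIV - {i}. q ^ k j)" .
    qed
    finally show ?thesis .
  qed
  have "hausdorff_pre f \<eta> ?E \<le> hausdorff_pre f \<eta> (\<Union>k\<in>\<K>. Box k)" using cover by (rule hausdorff_pre_mono)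
  also have "\<dots> \<le> (\<Sum>k\<in>\<K>. hausdorff_pre f \<eta> (Box k))" by (rule hausdorff_pre_finite_Union_le[OF f \<eta> finK])
  also have "\<dots> \<le> (\<Sum>k\<in>\<K>. ennreal (B * t * (\<Sum>i\<in>UNIV. \<Prod>j\<in>UNIV - {i}. q ^ k j)))"
    by (intro sum_mono box)
  also have "\<dots> = ennreal (\<Sum>k\<in>\<K>. B * t * (\<Sum>i\<in>UNIV. \<Prod>j\<in>UNIV - {i}. q ^ k j))"
    using B0 t0 q0 by (intro sum_ennreal) (auto intro!: mult_nonneg_nonneg sum_nonneg prod_nonneg)
  also have "(\<Sum>k\<in>\<K>. B * t * (\<Sum>i\<in>UNIV. \<Prod>j\<in>UNIV - {i}. q ^ k j))
      = B * t * (\<Sum>i\<in>UNIV. \<Sum>k\<in>\<K>. \<Prod>j\<in>UNIV - {i}. q ^ k j)"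
    by (subst sum.swap) (simp add: sum_distrib_left)
  also have "\<dots> \<le> B * t * (\<Sum>i\<in>(UNIV :: 'n set). real d * G ^ (d - 1))"
  proof (intro mult_left_mono sum_mono)
    fix i :: 'n
    have "q < 1 \<or> CARD('n) = 1"
    proof (cases "s < real d")
      case True
      then have "1 < 2 powr (real d - s)" by (intro gr_one_powr) auto
      then show ?thesis by (simp add: q_def powr_divide)
    qed (use s(2) in \<open>auto simp: d_def\<close>)
    then show "(\<Sum>k\<in>\<K>. \<Prod>j\<in>UNIV - {i}. q ^ k j) \<le> real d * G ^ (d - 1)"
      unfolding d_def G_def q_def[unfolded d_def, symmetric]
      by (intro sum_over_dyadic_boxes[OF q0 _ p(1) finK]) (auto simp: \<K>_def)
  qed (use B0 t0 in auto)
  also have "B * t * (\<Sum>i\<in>(UNIV :: 'n set). real d * G ^ (d - 1))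
      = (\<Prod>i\<in>UNIV. 5 * (\<beta> i / (\<beta> i - 1))) * 4 ^ d * (d * (d * G ^ (d - 1))) * t"
    by (simp add: B_def C_def d_def)
  finally show ?thesis by (simp add: t_def r_def ennreal_leI)
qed

section \<open>The dichotomy\<close>

lemma eventually_le_power:
  fixes b :: real
  assumes "1 < b"
  shows "eventually (\<lambda>n. X \<le> b ^ Suc n) sequentially"
proof -
  obtain N where N: "X < b ^ N" using real_arch_pow[OF assms] by blast
  have "X \<le> b ^ Suc n" if "N \<le> n" for n
  proof -
    have "b ^ N \<le> b ^ Suc n" using assms that by (intro power_increasing) auto
    then show ?thesis using N by simp
  qed
  then show ?thesis unfolding eventually_sequentially by blast
qed

text \<open>A Borel-Cantelli argument at each fixed scale \<open>\<eta>\<close>: every tail of the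
  levels covers the set, and a late level costs at most a constant times its term of the
  series.\<close>

lemma hausdorff_measure_W_mult_zero:
  fixes f :: "real \<Rightarrow> real" and \<beta> :: "'n::finite \<Rightarrow> real" and i0 :: 'n and s :: real
  defines "d \<equiv> CARD('n)"
  assumes f: "dimension_function f"
    and s: "s \<le> real d" "s < real d \<or> d = 1"
    and ratio: "\<And>x y. 0 < x \<Longrightarrow> x \<le> y \<Longrightarrow> f y / y powr s \<le> f x / x powr s"
    and growth: "\<And>x y. 0 < x \<Longrightarrow> x \<le> y \<Longrightarrow> f x / x ^ (d - 1) \<le> f y / y ^ (d - 1)"
    and \<beta>: "\<And>i. 1 < \<beta> i" "\<And>i. \<beta> i \<le> \<beta> i0" and \<psi>: "\<And>n. 1 \<le> n \<Longrightarrow> 0 < \<psi> n"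
    and lip: "\<And>i. \<exists>L. L-lipschitz_on {0..<1} (h i)" and h: "\<And>i. h i \<in> {0..<1} \<rightarrow> {0..1}"
    and converges: "summable (\<lambda>n. \<beta> i0 ^ Suc n *
      (f (\<psi> (Suc n) / \<beta> i0 ^ Suc n) / (\<psi> (Suc n) / \<beta> i0 ^ Suc n) ^ (d - 1)))"
  shows "hausdorff_measure f (W_mult \<beta> \<psi> h) = 0"
proof (rule hausdorff_measure_eq_0)
  fix \<eta> :: real assume \<eta>: "0 < \<eta>"
  obtain L where L: "\<And>i. (L i)-lipschitz_on {0..<1} (h i)" using lip by metis
  define b where "b = \<beta> i0"
  have b: "1 < b" using \<beta>(1) by (simp add: b_def)
  define r where "r n = \<psi> (Suc n) / b ^ Suc n" for n
  define t where "t n = b ^ Suc n * (f (r n) / r n ^ (d - 1))" for n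
  have fp: "0 < f x" if "0 < x" for x using f that by (simp add: dimension_function_def)
  have bn: "0 < b ^ Suc n" for n using b by simp
  have r: "0 < r n" for n using \<psi>[of "Suc n"] bn by (simp add: r_def)
  have d: "1 \<le> d" by (simp add: d_def Suc_leI)
  have t0: "0 < t n" for n
    unfolding t_def using b r[of n] fp[OF r] by (intro mult_pos_pos divide_pos_pos zero_less_power) auto
  have t_alt: "t n = \<psi> (Suc n) * (f (r n) / r n ^ d)" for n
  proof -
    have "r n ^ d = r n * r n ^ (d - 1)" using d by (simp flip: power_Suc)
    moreover have "b ^ Suc n = \<psi> (Suc n) / r n" using bn[of n] \<psi>[of "Suc n"] by (simp add: r_def)
    ultimately show ?thesis by (simp add: t_def)
  qed
  have sum: "summable t" using converges by (simp add: t_def[abs_def] r_def b_def)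
  \<comment> \<open>Convergence forces \<psi> below 1 eventually: terms with \<psi> at least 1 are
    at least \<open>f 1\<close>, by \<open>ratio\<close> for radii up to 1 and by
    \<open>growth\<close> beyond.\<close>
  have large: "f 1 \<le> t n" if "1 \<le> \<psi> (Suc n)" for n
  proof (cases "r n \<le> 1")
    case True
    have "f 1 / 1 ^ d \<le> f (r n) / r n ^ d * 1 powr (real d - s)"
      by (rule gauge_le_power_of_ratio[OF ratio fp r True _ s(1)]) (use True in auto)
    then have "f 1 \<le> 1 * (f (r n) / r n ^ d)" by simp
    also have "\<dots> \<le> t n"
      unfolding t_alt using that fp[OF r[of n]] r[of n] by (intro mult_right_mono) auto
    finally show ?thesis .
  next
    case False
    have "f 1 / 1 ^ (d - 1) \<le> f (r n) / r n ^ (d - 1)" using False by (intro growth) auto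
    then have "1 * f 1 \<le> t n"
      unfolding t_def using b fp[of 1] by (intro mult_mono) (auto intro: one_le_power simp del: power_Suc)
    then show ?thesis by simp
  qed
  have "eventually (\<lambda>n. t n < f 1) sequentially"
    using summable_LIMSEQ_zero[OF sum] fp[of 1] by (intro order_tendstoD(2)[where y = 0]) auto
  then have ev1: "eventually (\<lambda>n. \<psi> (Suc n) < 1) sequentially"
  proof (rule eventually_mono)
    show "\<psi> (Suc n) < 1" if "t n < f 1" for n using that large[of n] by linarith
  qed
  have ev2: "eventually (\<lambda>n. \<forall>i. 2 * L i \<le> \<beta> i ^ Suc n) sequentially"
    by (intro eventually_all_finite eventually_le_power \<beta>)
  have ev3: "eventually (\<lambda>n. \<forall>i. 2 / \<eta> \<le> \<beta> i ^ Suc n) sequentially"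
    by (intro eventually_all_finite eventually_le_power \<beta>)
  obtain N0 where N0: "\<And>n. N0 \<le> n \<Longrightarrow> \<psi> (Suc n) < 1 \<and> (\<forall>i. 2 * L i \<le> \<beta> i ^ Suc n) \<and> (\<forall>i. 2 / \<eta> \<le> \<beta> i ^ Suc n)"
    using eventually_conj[OF ev1 eventually_conj[OF ev2 ev3]] unfolding eventually_sequentially by blast
  define E where "E n = {x :: real ^ 'n. (\<forall>i. x $ i \<in> {0..<1}) \<and>
      (\<Prod>i\<in>UNIV. \<bar>(beta_map (\<beta> i) ^^ n) (x $ i) - h i (x $ i)\<bar>) < \<psi> n}" for n
  \<comment> \<open>The maximum with 0 spares a discussion of the sign of the constant.\<close>
  define K where "K = max 0 ((\<Prod>i\<in>UNIV. 5 * (\<beta> i / (\<beta> i - 1))) * 4 ^ d *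
     (d * (d * (1 / (1 - (1 / 2) powr (real d - s))) ^ (d - 1))))"
  have level: "hausdorff_pre f \<eta> (E (Suc n)) \<le> ennreal (K * t n)" if n: "N0 \<le> n" for n
  proof -
    have \<beta>n: "0 < \<beta> i ^ Suc n" for i using \<beta>(1)[of i] by simp
    have "2 / \<beta> i ^ Suc n \<le> \<eta>" for i
    proof -
      have "2 / \<eta> \<le> \<beta> i ^ Suc n" using N0[OF n] by blast
      then have "2 \<le> \<beta> i ^ Suc n * \<eta>" using \<eta> by (simp only: pos_divide_le_eq)
      then show ?thesis using \<beta>n[of i] by (simp only: pos_divide_le_eq mult.commute)
    qed
    note le = this
    have n1: "2 * L i \<le> \<beta> i ^ Suc n" for i using N0[OF n] by blast
    have p: "0 < \<psi> (Suc n)" "\<psi> (Suc n) < 1" using N0[OF n] \<psi>[of "Suc n"] by auto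
    have "hausdorff_pre f \<eta> (E (Suc n)) \<le> ennreal ((\<Prod>i\<in>UNIV. 5 * (\<beta> i / (\<beta> i - 1))) * 4 ^ d *
        (d * (d * (1 / (1 - (1 / 2) powr (real d - s))) ^ (d - 1))) *
        (\<psi> (Suc n) * (f (r n) / r n ^ d)))"
      unfolding E_def r_def b_def d_def
      by (rule hausdorff_pre_level_le[where L = L]) (fact f s[unfolded d_def] ratio \<beta> L h n1 le p)+
    also have "\<dots> \<le> ennreal (K * t n)"
      unfolding t_alt[symmetric] using t0[of n] by (intro ennreal_leI mult_right_mono) (auto simp: K_def)
    finally show ?thesis .
  qed
  have "hausdorff_pre f \<eta> (W_mult \<beta> \<psi> h) \<le> 0 + ennreal e" if e: "0 < e" for e :: real
  proof -
    have K0: "0 \<le> K" by (simp add: K_def)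
    then have K1: "0 < K + 1" by simp
    have Kt: "0 \<le> K * t m" for m using K0 t0[of m] by simp
    obtain N1 where N1: "\<And>n. N1 \<le> n \<Longrightarrow> norm (\<Sum>k. t (k + n)) < e / (K + 1)"
      using suminf_exist_split[OF _ sum, of "e / (K + 1)"] e K1 by auto
    define N where "N = max N0 N1"
    have "W_mult \<beta> \<psi> h \<subseteq> (\<Union>k. E (Suc (k + N)))"
    proof
      fix x assume x: "x \<in> W_mult \<beta> \<psi> h"
      then have "infinite {n. n \<ge> 1 \<and> (\<Prod>i\<in>UNIV. \<bar>(beta_map (\<beta> i) ^^ n) (x $ i) - h i (x $ i)\<bar>) < \<psi> n}"
        by (simp add: W_mult_def)
      then obtain n where n: "n > N" "(\<Prod>i\<in>UNIV. \<bar>(beta_map (\<beta> i) ^^ n) (x $ i) - h i (x $ i)\<bar>) < \<psi> n"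
        unfolding infinite_nat_iff_unbounded by blast
      have "x \<in> E n" using x n(2) by (simp add: E_def W_mult_def)
      moreover have "n = Suc ((n - Suc N) + N)" using n(1) by simp
      ultimately show "x \<in> (\<Union>k. E (Suc (k + N)))" by (metis UNIV_I UN_I)
    qed
    then have "hausdorff_pre f \<eta> (W_mult \<beta> \<psi> h) \<le> hausdorff_pre f \<eta> (\<Union>k. E (Suc (k + N)))"
      by (rule hausdorff_pre_mono)
    also have "\<dots> \<le> (\<Sum>k. hausdorff_pre f \<eta> (E (Suc (k + N))))" by (rule hausdorff_pre_Union_le)
    also have "\<dots> \<le> (\<Sum>k. ennreal (K * t (k + N)))"
      by (intro suminf_le summableI level) (simp add: N_def)
    also have "\<dots> = ennreal (\<Sum>k. K * t (k + N))"
      by (intro suminf_ennreal2 summable_mult summable_ignore_initial_segment Kt sum)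
    also have "(\<Sum>k. K * t (k + N)) = K * (\<Sum>k. t (k + N))"
      by (intro suminf_mult summable_ignore_initial_segment sum)
    also have "\<dots> \<le> (K + 1) * (e / (K + 1))"
    proof (rule mult_mono)
      show "(\<Sum>k. t (k + N)) \<le> e / (K + 1)" using N1[of N] by (simp add: N_def)
      show "0 \<le> (\<Sum>k. t (k + N))"
        using t0 sum by (intro suminf_nonneg summable_ignore_initial_segment) (auto intro: less_imp_le)
    qed (use K1 in auto)
    also have "\<dots> = e" using K1 by simp
    finally show ?thesis by (simp add: ennreal_leI)
  qed
  then show "hausdorff_pre f \<eta> (W_mult \<beta> \<psi> h) = 0" by (metis ennreal_le_epsilon le_zero_eq)
qed

section \<open>Reduction of both statements to a one-dimensional gauge\<close>

lemma suminf_ennreal_infinite_iff: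
  fixes t :: "nat \<Rightarrow> real"
  assumes "\<And>n. 0 \<le> t n"
  shows "(\<Sum>n. ennreal (t n)) = \<infinity> \<longleftrightarrow> \<not> summable t"
  using summable_suminf_not_top[of t] suminf_ennreal2[of t] assms by (metis ennreal_neq_top infinity_ennreal_def)

lemma gauge_preceq_le:
  "gauge_preceq f g \<Longrightarrow> 0 < x \<Longrightarrow> x \<le> y \<Longrightarrow> f y / g y \<le> f x / g x"
  unfolding gauge_preceq_def by (cases "x = y") auto

lemma hausdorff_measure_eq_top_superset:
  assumes "hausdorff_measure f A = top" "A \<subseteq> B"
  shows "hausdorff_measure f B = top"
  using hausdorff_measure_le[OF hausdorff_pre_mono[OF assms(2)], of f] assms(1) by (simp add: top_unique)

lemma W_mult_subset_cube: "W_mult \<beta> \<psi> h \<subseteq> {x. \<forall>i. x $ i \<in> {0..1}}"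
  by (auto simp: W_mult_def less_imp_le)

text \<open>That r^(d-1) / f(r) decreases makes \<open>g\<close> nondecreasing, and its divergence
  at 0 makes \<open>g\<close> continuous there; s < d makes g(r) / r decrease and tend to infinity
  at 0.\<close>

lemma quotient_gauge:
  fixes f :: "real \<Rightarrow> real" and d :: nat
  defines "g \<equiv> \<lambda>r. f r / r ^ (d - 1)"
  assumes d: "2 \<le> d" and s: "s < real d" and f: "dimension_function f"
    and prec: "gauge_prec (\<lambda>r. r powr (real d - 1)) f" and preceq: "gauge_preceq f (\<lambda>r. r powr s)"
  shows "dimension_function g"
    and "\<And>x y. 0 < x \<Longrightarrow> x \<le> y \<Longrightarrow> g y / y \<le> g x / x"
    and "\<And>K. 0 < K \<Longrightarrow> \<exists>e>0. \<forall>x. 0 < x \<longrightarrow> x < e \<longrightarrow> K * x \<le> g x"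
proof -
  have pw: "x powr (real d - 1) = x ^ (d - 1)" if "0 < x" for x :: real
    using that d by (simp add: of_nat_diff flip: powr_realpow)
  have fp: "0 < f x" if "0 < x" for x using f that by (simp add: dimension_function_def)
  have gp: "0 < g x" if "0 < x" for x using fp[OF that] that by (simp add: g_def)
  \<comment> \<open>Division by zero gives 0, so the formula for \<open>g\<close> has the right
    value at 0.\<close>
  have g0: "g 0 = 0" using d by (simp add: g_def)
  have g_inv: "g x = inverse (x powr (real d - 1) / f x)" if "0 < x" for x
    by (simp add: g_def pw[OF that])
  have mono: "g x \<le> g y" if xy: "0 < x" "x \<le> y" for x y
  proof -
    have "y powr (real d - 1) / f y \<le> x powr (real d - 1) / f x"
      using prec xy unfolding gauge_prec_def by (intro gauge_preceq_le[of "\<lambda>r. r powr (real d - 1)"]) auto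
    then have "inverse (x powr (real d - 1) / f x) \<le> inverse (y powr (real d - 1) / f y)"
      using xy fp[of y] by (intro le_imp_inverse_le) auto
    then show ?thesis using xy g_inv[of x] g_inv[of y] by simp
  qed
  have quot: "g x / x = f x / x ^ d" for x
    using d by (cases d) (auto simp: g_def mult.commute)
  have ratio: "f y / y powr s \<le> f x / x powr s" if "0 < x" "x \<le> y" for x y
    using gauge_preceq_le[OF preceq that] .
  show "dimension_function g"
    unfolding dimension_function_def
  proof (intro conjI allI impI)
    show "continuous_on {0..} g"
      unfolding continuous_on_eq_continuous_within
    proof
      fix x :: real assume x: "x \<in> {0..}"
      show "continuous (at x within {0..}) g"
      proof (cases "x = 0")
        case True
        have "((\<lambda>r. inverse (r powr (real d - 1) / f r)) \<longlongrightarrow> 0) (at_right 0)"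
          using prec unfolding gauge_prec_def by (intro tendsto_inverse_0_at_top) auto
        moreover have "eventually (\<lambda>r. inverse (r powr (real d - 1) / f r) = g r) (at_right 0)"
          unfolding eventually_at_right_field by (intro exI[of _ 1]) (auto simp: g_inv)
        ultimately have "(g \<longlongrightarrow> 0) (at_right 0)" by (rule Lim_transform_eventually)
        then show ?thesis by (simp add: True continuous_within g0 at_within_Ici_at_right)
      next
        case False
        then have "0 < x" using x by simp
        have "continuous_on {0<..} f"
          using f by (auto simp: dimension_function_def intro: continuous_on_subset)
        then have "continuous_on {0<..} g" unfolding g_def by (intro continuous_intros) auto
        then have "isCont g x" using \<open>0 < x\<close> by (simp add: continuous_on_eq_continuous_at)
        then show ?thesis by (rule continuous_at_imp_continuous_within)
      qed
    qed
    show "mono_on {0..} g"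
    proof (rule mono_onI)
      fix x y :: real assume xy: "x \<in> {0..}" "y \<in> {0..}" "x \<le> y"
      show "g x \<le> g y"
      proof (cases "x = 0")
        case True
        then show ?thesis using xy g0 gp[of y] by (cases "y = 0") auto
      next
        case False
        then show ?thesis using xy mono by auto
      qed
    qed
  qed (use g0 gp in auto)
  show "g y / y \<le> g x / x" if xy: "0 < x" "x \<le> y" for x y
    using gauge_le_power_of_ratio[OF ratio fp xy, of 1 d] s xy by (simp add: quot)
  show "\<exists>e>0. \<forall>x. 0 < x \<longrightarrow> x < e \<longrightarrow> K * x \<le> g x" if K: "0 < K" for K
  \<comment> \<open>Below 1 the gauge satisfies f(x) / x^d >= f(1) x^(s - d), and the second bound
    makes this at least \<open>K\<close>.\<close>
  proof (intro exI[of _ "min 1 ((f 1 / K) powr (1 / (real d - s)))"] conjI allI impI)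
    show "0 < min 1 ((f 1 / K) powr (1 / (real d - s)))" using fp[of 1] K by simp
    fix x assume x: "0 < x" "x < min 1 ((f 1 / K) powr (1 / (real d - s)))"
    have "x powr (real d - s) \<le> ((f 1 / K) powr (1 / (real d - s))) powr (real d - s)"
      using x s by (intro powr_mono2) auto
    also have "\<dots> = f 1 / K" using s fp[of 1] K by (simp add: powr_powr)
    finally have small: "x powr (real d - s) \<le> f 1 / K" .
    have "f 1 / 1 ^ d \<le> f x / x ^ d * x powr (real d - s)"
      using x s by (intro gauge_le_power_of_ratio[OF ratio fp]) auto
    also have "\<dots> \<le> f x / x ^ d * (f 1 / K)"
      using small fp[OF x(1)] x(1) by (intro mult_left_mono) auto
    also have "\<dots> = f 1 * (f x / x ^ d) / K" by simp
    finally have "f 1 \<le> f 1 * (f x / x ^ d) / K" by (simp only: power_one div_by_1)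
    then have "f 1 * K \<le> f 1 * (f x / x ^ d)" using K by (simp only: pos_le_divide_eq)
    moreover have "0 < f 1" by (simp add: fp)
    ultimately have "K \<le> g x / x" unfolding quot by (simp only: mult_le_cancel_left_pos)
    then show "K * x \<le> g x" using x(1) by (simp add: pos_le_divide_eq)
  qed
qed

theorem theorem1p4:
  fixes \<beta> :: "'n::{finite,linorder} \<Rightarrow> real"
    and \<psi> :: "nat \<Rightarrow> real"
    and h :: "'n \<Rightarrow> real \<Rightarrow> real"
    and d :: nat and \<beta>\<^sub>d :: real
  assumes "d = CARD('n)"
    and "\<beta>\<^sub>d = \<beta> (Max UNIV)"
    and "\<And>i. 1 < \<beta> i"
    and "mono \<beta>"
    and "\<And>n. n \<ge> 1 \<Longrightarrow> 0 < \<psi> n"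
    and "\<And>i. \<exists>L. L-lipschitz_on {0..<1} (h i)"
    and "\<And>i. h i \<in> {0..<1} \<rightarrow> {0..1}"
  shows
    "(d = 1 \<longrightarrow>
       (\<forall>g. dimension_function g \<and> gauge_preceq g (\<lambda>r. r powr 1) \<longrightarrow>
         ((\<Sum>n. ennreal (\<beta>\<^sub>d ^ Suc n * g (\<psi> (Suc n) / \<beta>\<^sub>d ^ Suc n))) < \<infinity> \<longrightarrow>
            hausdorff_measure g (W_mult \<beta> \<psi> h) = 0) \<and>
         ((\<Sum>n. ennreal (\<beta>\<^sub>d ^ Suc n * g (\<psi> (Suc n) / \<beta>\<^sub>d ^ Suc n))) = \<infinity> \<longrightarrow>
            hausdorff_measure g (W_mult \<beta> \<psi> h) =
            hausdorff_measure g {x :: real ^ 'n::{finite,linorder}. \<forall>i. x $ i \<in> {0..1}}))) \<and>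
     (d \<ge> 2 \<longrightarrow>
       (\<forall>f s. dimension_function f \<and> s \<in> {real d - 1<..<real d} \<and>
              gauge_prec (\<lambda>r. r powr (real d - 1)) f \<and> gauge_preceq f (\<lambda>r. r powr s) \<longrightarrow>
         ((\<Sum>n. ennreal (\<beta>\<^sub>d ^ (d * Suc n) * \<psi> (Suc n) powi (1 - int d)
                 * f (\<psi> (Suc n) / \<beta>\<^sub>d ^ Suc n))) < \<infinity> \<longrightarrow>
            hausdorff_measure f (W_mult \<beta> \<psi> h) = 0) \<and>
         ((\<Sum>n. ennreal (\<beta>\<^sub>d ^ (d * Suc n) * \<psi> (Suc n) powi (1 - int d)
                 * f (\<psi> (Suc n) / \<beta>\<^sub>d ^ Suc n))) = \<infinity> \<longrightarrow>
            hausdorff_measure f (W_mult \<beta> \<psi> h) =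
            hausdorff_measure f {x :: real ^ 'n::{finite,linorder}. \<forall>i. x $ i \<in> {0..1}})))"
proof (intro conjI impI allI)
  define i0 :: 'n where "i0 = Max UNIV"
  have \<beta>: "\<And>i. 1 < \<beta> i" "\<And>i. \<beta> i \<le> \<beta> i0"
    using assms(3) monoD[OF assms(4)] by (auto simp: i0_def)
  have \<beta>d: "\<beta>\<^sub>d = \<beta> i0" by (simp add: assms(2) i0_def)
  have b: "1 < \<beta>\<^sub>d" using \<beta> by (simp add: \<beta>d)
  note \<psi> = assms(5) and lip = assms(6) and h = assms(7)
  have arg: "0 < \<psi> (Suc n) / \<beta>\<^sub>d ^ Suc n" for n using \<psi>[of "Suc n"] b by simp
  {
    fix g assume d: "d = 1" and g: "dimension_function g \<and> gauge_preceq g (\<lambda>r. r powr 1)"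
    have card: "CARD('n) = 1" using d assms(1) by simp
    have dg: "dimension_function g" using g by blast
    have gp: "0 < g x" if "0 < x" for x using dg that by (simp add: dimension_function_def)
    have ratio: "g y / y powr 1 \<le> g x / x powr 1" if "0 < x" "x \<le> y" for x y
      using gauge_preceq_le[OF conjunct2[OF g] that] .
    have ratio': "g y / y \<le> g x / x" if "0 < x" "x \<le> y" for x y
      using ratio[OF that] that by simp
    have mono: "g x \<le> g y" if "0 < x" "x \<le> y" for x y
      using dg that by (auto simp: dimension_function_def mono_on_def)
    let ?t = "\<lambda>n. \<beta>\<^sub>d ^ Suc n * g (\<psi> (Suc n) / \<beta>\<^sub>d ^ Suc n)"
    have t0: "0 \<le> ?t n" for n using gp[OF arg] b by (intro mult_nonneg_nonneg less_imp_le) auto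
    show "hausdorff_measure g (W_mult \<beta> \<psi> h) = 0" if "(\<Sum>n. ennreal (?t n)) < \<infinity>"
    proof (rule hausdorff_measure_W_mult_zero[where s = 1 and ?i0.0 = i0])
      have "(\<Sum>n. ennreal (?t n)) \<noteq> \<infinity>" using that by (rule less_imp_neq)
      then have "summable ?t" using suminf_ennreal_infinite_iff[of ?t, OF t0] by blast
      then show "summable (\<lambda>n. \<beta> i0 ^ Suc n * (g (\<psi> (Suc n) / \<beta> i0 ^ Suc n) /
          (\<psi> (Suc n) / \<beta> i0 ^ Suc n) ^ (CARD('n) - 1)))" by (simp add: card \<beta>d)
    qed (use dg ratio mono \<beta> \<psi> lip h card in auto)
    show "hausdorff_measure g (W_mult \<beta> \<psi> h) =
        hausdorff_measure g {x :: real ^ 'n::{finite,linorder}. \<forall>i. x $ i \<in> {0..1}}"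
      if "(\<Sum>n. ennreal (?t n)) = \<infinity>"
    proof -
      have div: "\<not> summable (\<lambda>n. \<beta> i0 ^ Suc n * g (\<psi> (Suc n) / \<beta> i0 ^ Suc n))"
        using that suminf_ennreal_infinite_iff[of ?t, OF t0] unfolding \<beta>d by blast
      show ?thesis
      \<comment> \<open>As g(r) / r decreases, either it is bounded, and only a null set is missing
        from the unit interval, or it tends to infinity at 0, and both measures are
        infinite.\<close>
      proof (cases "\<exists>C>0. \<forall>x>0. g x \<le> C * x")
        case True
        then obtain C where C: "0 < C" "\<And>x. 0 < x \<Longrightarrow> g x \<le> C * x" by blast
        show ?thesis
          by (rule hausdorff_measure_W_mult_full[where ?i0.0 = i0 and C = C])
            (fact card \<beta>(1) \<psi> lip h dg ratio' div C)+
      next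
        case False
        have "\<exists>e>0. \<forall>x. 0 < x \<longrightarrow> x < e \<longrightarrow> K * x \<le> g x" if "0 < K" for K
        proof -
          have "\<not> (\<forall>x>0. g x \<le> K * x)" using False that by blast
          \<comment> \<open>One violation at \<open>e\<close> suffices, since g(x) / x is at least
            g(e) / e for all smaller x.\<close>
          then obtain e where e: "0 < e" "K * e < g e" by (auto simp: not_le)
          have "K * x \<le> g x" if "0 < x" "x < e" for x
          proof -
            have "K < g e / e" using e by (simp add: pos_less_divide_eq)
            also have "\<dots> \<le> g x / x" using ratio' that by simp
            finally show ?thesis using that by (simp add: pos_less_divide_eq)
          qed
          then show ?thesis using e(1) by blast
        qed
        note large = this
        have g_eq: "g x = g x * x ^ (CARD('n) - 1)" if "0 < x" for x by (simp add: card)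
        have "hausdorff_measure g (W_mult \<beta> \<psi> h) = top"
          by (rule hausdorff_measure_W_mult_top[where ?i0.0 = i0 and g = g])
            (fact g_eq \<beta>(1) \<psi> lip h dg ratio' large div)+
        then show ?thesis using hausdorff_measure_eq_top_superset[OF _ W_mult_subset_cube] by metis
      qed
    qed
  }
  {
    fix f s assume d: "2 \<le> d" and fs: "dimension_function f \<and> s \<in> {real d - 1<..<real d} \<and>
      gauge_prec (\<lambda>r. r powr (real d - 1)) f \<and> gauge_preceq f (\<lambda>r. r powr s)"
    have df: "dimension_function f" and s: "s < real d" and prec: "gauge_prec (\<lambda>r. r powr (real d - 1)) f"
      and preceq: "gauge_preceq f (\<lambda>r. r powr s)" using fs by auto
    define g where "g r = f r / r ^ (d - 1)" for r
    note g = quotient_gauge[OF d s df prec preceq, folded g_def]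
    have gp: "0 < g x" if "0 < x" for x using g(1) that by (simp add: dimension_function_def)
    have mono: "g x \<le> g y" if "0 < x" "x \<le> y" for x y
      using g(1) that by (auto simp: dimension_function_def mono_on_def)
    let ?t = "\<lambda>n. \<beta>\<^sub>d ^ (d * Suc n) * \<psi> (Suc n) powi (1 - int d) * f (\<psi> (Suc n) / \<beta>\<^sub>d ^ Suc n)"
    \<comment> \<open>With p and B as below, both sides equal B^d p^(1-d) f(p / B).\<close>
    have t: "?t n = \<beta>\<^sub>d ^ Suc n * g (\<psi> (Suc n) / \<beta>\<^sub>d ^ Suc n)" for n
    proof -
      define p B where "p = \<psi> (Suc n)" and "B = \<beta>\<^sub>d ^ Suc n"
      have pB: "0 < p" "0 < B" using \<psi>[of "Suc n"] b by (auto simp: p_def B_def)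
      obtain k where k: "d = Suc k" using d by (cases d) auto
      have "p powi (1 - int d) = 1 / p ^ k" using k by (simp add: power_int_minus divide_inverse)
      moreover have "\<beta>\<^sub>d ^ (d * Suc n) = B * B ^ k"
        unfolding B_def k power_Suc[symmetric] by (metis power_mult mult.commute)
      ultimately show ?thesis unfolding p_def[symmetric] B_def[symmetric] g_def
        using pB by (simp add: k power_divide)
    qed
    have t0: "0 \<le> ?t n" for n unfolding t using gp[OF arg] b by (intro mult_nonneg_nonneg less_imp_le) auto
    show "hausdorff_measure f (W_mult \<beta> \<psi> h) = 0" if "(\<Sum>n. ennreal (?t n)) < \<infinity>"
    proof (rule hausdorff_measure_W_mult_zero[where s = s and ?i0.0 = i0])
      have "(\<Sum>n. ennreal (?t n)) \<noteq> \<infinity>" using that by (rule less_imp_neq)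
      then have "summable ?t" using suminf_ennreal_infinite_iff[of ?t, OF t0] by blast
      then have "summable (\<lambda>n. \<beta>\<^sub>d ^ Suc n * g (\<psi> (Suc n) / \<beta>\<^sub>d ^ Suc n))" by (simp only: t)
      then show "summable (\<lambda>n. \<beta> i0 ^ Suc n * (f (\<psi> (Suc n) / \<beta> i0 ^ Suc n) /
          (\<psi> (Suc n) / \<beta> i0 ^ Suc n) ^ (CARD('n) - 1)))"
        unfolding g_def \<beta>d assms(1)[symmetric] .
      show "f x / x ^ (CARD('n) - 1) \<le> f y / y ^ (CARD('n) - 1)" if "0 < x" "x \<le> y" for x y
        using mono[OF that] unfolding g_def assms(1) .
      show "f y / y powr s \<le> f x / x powr s" if "0 < x" "x \<le> y" for x y
        using gauge_preceq_le[OF preceq that] .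
    qed (use df s \<beta> \<psi> lip h assms(1) in auto)
    show "hausdorff_measure f (W_mult \<beta> \<psi> h) =
        hausdorff_measure f {x :: real ^ 'n::{finite,linorder}. \<forall>i. x $ i \<in> {0..1}}"
      if "(\<Sum>n. ennreal (?t n)) = \<infinity>"
    proof -
      have "\<not> summable ?t" using that suminf_ennreal_infinite_iff[of ?t, OF t0] by blast
      then have "\<not> summable (\<lambda>n. \<beta>\<^sub>d ^ Suc n * g (\<psi> (Suc n) / \<beta>\<^sub>d ^ Suc n))" unfolding t .
      then have div: "\<not> summable (\<lambda>n. \<beta> i0 ^ Suc n * g (\<psi> (Suc n) / \<beta> i0 ^ Suc n))"
        unfolding \<beta>d .
      have f_eq: "f x = g x * x ^ (CARD('n) - 1)" if "0 < x" for x
        using that by (simp add: g_def assms(1))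
      \<comment> \<open>No finite case arises here, because \<open>g\<close> exceeds every multiple
        of r near 0; the cube then has infinite measure as a superset.\<close>
      have "hausdorff_measure f (W_mult \<beta> \<psi> h) = top"
        by (rule hausdorff_measure_W_mult_top[where ?i0.0 = i0 and g = g])
          (fact f_eq \<beta>(1) \<psi> lip h g div)+
      then show ?thesis using hausdorff_measure_eq_top_superset[OF _ W_mult_subset_cube] by metis
    qed
  }
qed

end
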